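(* Let $\theta\in(0,1)$ and let $\eta,\xi\in\mathcal F_\theta(E^\infty,\mathbb R)$ with $\xi\ge0$. Suppose there exists a unique $\delta\in\mathbb R$ with $P(\eta-\delta\xi)=0$, and let $t^*=\sup\{t\in\mathbb R:\eta+t\xi\text{ is summable}\}$. If $-\delta<t^*$, then $z\mapsto(\mathrm{Id}-\mathcal L_{\eta+z\xi})^{-1}\in\mathcal B(\mathcal F_\theta^b(E^\infty))$ has a simple pole at $z=-\delta$. In particular, for each $\chi\in\mathcal F_\theta^b(E^\infty)$, $$(\mathrm{Id}-\mathcal L_{\eta+z\xi})^{-1}\chi=\frac{e^{P(\eta+z\xi)}}{1-e^{P(\eta+z\xi)}}\,\nu_{\eta+z\xi}(\chi)\,h_{\eta+z\xi}+(\mathrm{Id}-\mathcal L''_{\eta+z\xi})^{-1}\chi$$ for $z$ in some punctured neighbourhood of $-\delta$, where $\mathcal L''_{\eta+z\xi}=\mathcal L_{\eta+z\xi}-\mathcal L'_{\eta+z\xi}$ and $\mathcal L'_{\eta+z\xi}\chi=e^{P(\eta+z\xi)}\nu_{\eta+z\xi}(\chi)\,h_{\eta+z\xi}$ for $\chi\in\mathcal F_\theta^b(E^\infty)$.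
   Context: Let $I\subset\mathbb N$ be an at most countable alphabet, $A\colon I\times I\to\{0,1\}$ an incidence matrix, $E^\infty=\{\omega\in I^{\mathbb N}: A_{\omega_j\omega_{j+1}}=1\ \forall j\ge 1\}$ with the subspace topology of the product of discrete topologies, $E^n$ the set of subwords of length $n$ of elements of $E^\infty$, $E^*=\bigcup_{n\ge0}E^n$ ($E^0$ contains only the empty word). Standing assumption: $A$ is finitely irreducible, i.e. there is a finite set $\Lambda\subset E^*$ such that for all $i,j\in I$ there is $\omega\in\Lambda$ with $i\omega j\in E^*$. $\sigma$ is the left shift on $E^\infty$; $[\omega]$ is the cylinder set of $\omega\in E^n$; $S_nf=\sum_{j=0}^{n-1}f\circ\sigma^j$. The pressure of $u\colon E^\infty\to\mathbb R$ is $P(u)=\lim_{n\to\infty}\frac1n\log\sum_{\omega\in E^n}\exp(\sup_{\tau\in[\omega]}S_nu(\tau))$. For continuous $f\colon E^\infty\to\mathbb C$, $\mathrm{var}_n(f)=\sup\{|f(x)-f(y)|: x_i=y_i\text{ for }i\le n\}$ and $\|f\|_\theta=\sup_{n\ge1}\mathrm{var}_n(f)/\theta^n$. $\mathcal F_\theta(E^\infty,\mathbb R)$: real continuous functions with $\|f\|_\theta<\infty$ (possibly unbounded). $\mathcal F_\theta^b(E^\infty)$: bounded continuous complex functions with $\|f\|_\theta<\infty$, a Banach space under $\|\cdot\|_\theta+\|\cdot\|_\infty$; $\mathcal B(\mathcal F_\theta^b(E^\infty))$: bounded linear operators on it. A real-valued $u\in\mathcal F_\theta(E^\infty,\mathbb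 R)$ is summable if $\sum_{e\in I}\exp(\sup(u|_{[e]}))<\infty$. For $f=u+\mathbf{i}v$ with $u,v\in\mathcal F_\theta(E^\infty,\mathbb R)$ and $u$ summable, $\mathcal L_f(g)(\omega)=\sum_{y:\sigma y=\omega}e^{f(y)}g(y)$. For summable $u$, $\nu_u$ is the unique Borel probability measure with $\mathcal L_u^*\nu_u=e^{P(u)}\nu_u$ and $h_u$ is the positive bounded eigenfunction in $\mathcal F_\theta^b(E^\infty)$ with $\mathcal L_uh_u=e^{P(u)}h_u$, $\int h_u\,d\nu_u=1$. By regular perturbation theory, the functions $t\mapsto\gamma_{\eta+t\xi}=\exp(P(\eta+t\xi))$, $t\mapsto h_{\eta+t\xi}$, $t\mapsto\nu_{\eta+t\xi}$ on $(-\infty,t^* )$ extend to holomorphic functions $z\mapsto\gamma_{\eta+z\xi}\in\mathbb C$, $z\mapsto h_{\eta+z\xi}\in\mathcal F_\theta^b(E^\infty)$, $z\mapsto\nu_{\eta+z\xi}$ (in the dual of $\mathcal F_\theta^b(E^\infty)$) in a complex neighbourhood of $(-\infty,t^* )$ with $\gamma_{\eta+z\xi}\ne0$, $\mathcal L_{\eta+z\xi}h_{\eta+z\xi}=\gamma_{\eta+z\xi}h_{\eta+z\xi}$, $\mathcal L^*_{\eta+z\xi}\nu_{\eta+z\xi}=\gamma_{\eta+z\xi}\nu_{\eta+z\xi}$ and $\nu_{\eta+z\xi}(h_{\eta+z\xi})=1$. For complex $z$ there, $P(\eta+z\xi):=\log\gamma_{\eta+z\xi}$ (defined modulo $2\pi\mathbf{i}$),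 so $e^{P(\eta+z\xi)}=\gamma_{\eta+z\xi}$. "Simple pole" refers to the meromorphic extension of the resolvent to a neighbourhood of $-\delta$. *)

theory Defs
  imports "HOL-Probability.Probability_Measure" "HOL-Library.Function_Algebras"
begin

section \<open>Complex scaling, bounded linear maps and vector-valued holomorphy\<close>

text \<open>
  The Banach space of the statement depends on the terms \<open>I\<close>, \<open>A\<close> and \<open>\<theta>\<close>, so it cannot be a type.
  Complex normed spaces are therefore given by a carrier \<open>V\<close> together with a norm \<open>N\<close> on it, inside
  an ambient type with pointwise complex scaling (scalars, functions, functionals, operators).
\<close>

class complex_space = ab_group_add +
  fixes cscale :: "complex \<Rightarrow> 'a \<Rightarrow> 'a"  (infixr \<open>*\<^sub>C\<close> 75)
  assumes cscale_add_right: "c *\<^sub>C (x + y) = c *\<^sub>C x + c *\<^sub>C y"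
    and cscale_add_left: "(c + d) *\<^sub>C x = c *\<^sub>C x + d *\<^sub>C x"
    and cscale_cscale: "c *\<^sub>C (d *\<^sub>C x) = (c * d) *\<^sub>C x"
    and cscale_one: "1 *\<^sub>C x = x"

instantiation complex :: complex_space
begin
definition cscale_complex_def: "c *\<^sub>C (x::complex) = c * x"
instance by standard (simp_all add: cscale_complex_def algebra_simps)
end

instantiation "fun" :: (type, complex_space) complex_space
begin
definition cscale_fun_def: "c *\<^sub>C (f :: 'a \<Rightarrow> 'b) = (\<lambda>x. c *\<^sub>C f x)"
instance
  by standard
    (simp_all add: cscale_fun_def fun_eq_iff cscale_add_right cscale_add_left cscale_cscale cscale_one)
end

text \<open>Only the values on the carrier \<open>V\<close> of a map in \<open>bounded_maps\<close> are meaningful.\<close>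

definition bounded_maps ::
  "'v::complex_space set \<Rightarrow> ('v \<Rightarrow> real) \<Rightarrow> 'w::complex_space set \<Rightarrow> ('w \<Rightarrow> real) \<Rightarrow> ('v \<Rightarrow> 'w) set"
  where "bounded_maps V N W M = {T.
    (\<forall>f\<in>V. T f \<in> W) \<and>
    (\<forall>f\<in>V. \<forall>g\<in>V. T (f + g) = T f + T g) \<and>
    (\<forall>c. \<forall>f\<in>V. T (c *\<^sub>C f) = c *\<^sub>C T f) \<and>
    (\<exists>C. \<forall>f\<in>V. M (T f) \<le> C * N f)}"

definition map_norm :: "'v set \<Rightarrow> ('v \<Rightarrow> real) \<Rightarrow> ('w \<Rightarrow> real) \<Rightarrow> ('v \<Rightarrow> 'w) \<Rightarrow> real"
  where "map_norm V N M T = (SUP f\<in>{f\<in>V. N f \<le> 1}. M (T f))"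

abbreviation bounded_ops :: "'v::complex_space set \<Rightarrow> ('v \<Rightarrow> real) \<Rightarrow> ('v \<Rightarrow> 'v) set"
  where "bounded_ops V N \<equiv> bounded_maps V N V N"

abbreviation dual_space :: "'v::complex_space set \<Rightarrow> ('v \<Rightarrow> real) \<Rightarrow> ('v \<Rightarrow> complex) set"
  where "dual_space V N \<equiv> bounded_maps V N UNIV cmod"

definition invertible_op :: "'v::complex_space set \<Rightarrow> ('v \<Rightarrow> real) \<Rightarrow> ('v \<Rightarrow> 'v) \<Rightarrow> bool"
  where "invertible_op V N T \<longleftrightarrow>
    T \<in> bounded_ops V N \<and> bij_betw T V V \<and> inv_into V T \<in> bounded_ops V N"

text \<open>Norm-holomorphy, on an open set \<open>U\<close>, of a map into the normed space with carrier \<open>V\<close>.\<close>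

definition holomorphic_into ::
  "'v::complex_space set \<Rightarrow> ('v \<Rightarrow> real) \<Rightarrow> (complex \<Rightarrow> 'v) \<Rightarrow> complex set \<Rightarrow> bool"
  where "holomorphic_into V N F U \<longleftrightarrow>
    (\<forall>z\<in>U. F z \<in> V \<and>
      (\<exists>D\<in>V. ((\<lambda>w. N ((1 / (w - z)) *\<^sub>C (F w - F z) - D)) \<longlongrightarrow> 0) (at z)))"

text \<open>
  The operator-valued map \<open>R\<close> has a simple pole at \<open>z0\<close>: near \<open>z0\<close>, \<open>R z\<close> is a bounded operator equal
  to \<open>G z / (z - z0)\<close>, with \<open>G\<close> norm-holomorphic, \<open>z0\<close> included, and \<open>G z0\<close> not the zero operator.
\<close>

definition simple_pole_op ::
  "'v::complex_space set \<Rightarrow> ('v \<Rightarrow> real) \<Rightarrow> (complex \<Rightarrow> 'v \<Rightarrow> 'v) \<Rightarrow> complex \<Rightarrow> bool"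
  where "simple_pole_op V N R z0 \<longleftrightarrow>
    (\<exists>r>0. \<exists>G.
      holomorphic_into (bounded_ops V N) (map_norm V N N) G (ball z0 r) \<and>
      (\<exists>f\<in>V. G z0 f \<noteq> 0) \<and>
      (\<forall>z\<in>ball z0 r - {z0}. R z \<in> bounded_ops V N \<and> (\<forall>f\<in>V. (z - z0) *\<^sub>C R z f = G z f)))"


section \<open>The shift space\<close>

text \<open>
  Sequences are indexed from 0. \<open>A i j\<close> stands for the matrix entry at \<open>(i, j)\<close> being 1. Type
  \<^typ>\<open>nat \<Rightarrow> nat\<close> carries the product of the discrete topologies.
\<close>

type_synonym seq = "nat \<Rightarrow> nat"

definition E_inf :: "nat set \<Rightarrow> (nat \<Rightarrow> nat \<Rightarrow> bool) \<Rightarrow> seq set"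
  where "E_inf I A = {\<omega>. (\<forall>j. \<omega> j \<in> I) \<and> (\<forall>j. A (\<omega> j) (\<omega> (Suc j)))}"

definition E_words :: "nat set \<Rightarrow> (nat \<Rightarrow> nat \<Rightarrow> bool) \<Rightarrow> nat \<Rightarrow> nat list set"
  where "E_words I A n = {map \<omega> [k..<k + n] | \<omega> k. \<omega> \<in> E_inf I A}"

definition E_star :: "nat set \<Rightarrow> (nat \<Rightarrow> nat \<Rightarrow> bool) \<Rightarrow> nat list set"
  where "E_star I A = (\<Union>n. E_words I A n)"

definition finitely_irreducible :: "nat set \<Rightarrow> (nat \<Rightarrow> nat \<Rightarrow> bool) \<Rightarrow> bool"
  where "finitely_irreducible I A \<longleftrightarrow>
    (\<exists>\<Lambda>. finite \<Lambda> \<and> \<Lambda> \<subseteq> E_star I A \<and>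
      (\<forall>i\<in>I. \<forall>j\<in>I. \<exists>\<omega>\<in>\<Lambda>. [i] @ \<omega> @ [j] \<in> E_star I A))"

definition shift :: "seq \<Rightarrow> seq"
  where "shift \<omega> = (\<lambda>j. \<omega> (Suc j))"

definition cylinder :: "nat set \<Rightarrow> (nat \<Rightarrow> nat \<Rightarrow> bool) \<Rightarrow> nat list \<Rightarrow> seq set"
  where "cylinder I A w = {\<tau>\<in>E_inf I A. \<forall>i<length w. \<tau> i = w ! i}"

definition birkhoff_sum :: "nat \<Rightarrow> (seq \<Rightarrow> real) \<Rightarrow> seq \<Rightarrow> real"
  where "birkhoff_sum n u \<tau> = (\<Sum>j<n. u ((shift ^^ j) \<tau>))"


section \<open>Pressure and summability\<close>

text \<open>
  The pressure is an extended real. The exponential of a supremum is written as the supremum of the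
  exponentials in \<^typ>\<open>ennreal\<close>, which also covers potentials that are unbounded on a cylinder.
\<close>

definition ext_log :: "ennreal \<Rightarrow> ereal"
  where "ext_log x = (if x = 0 then -\<infinity> else if x = \<infinity> then \<infinity> else ereal (ln (enn2real x)))"

definition partition_sum :: "nat set \<Rightarrow> (nat \<Rightarrow> nat \<Rightarrow> bool) \<Rightarrow> (seq \<Rightarrow> real) \<Rightarrow> nat \<Rightarrow> ennreal"
  where "partition_sum I A u n =
    (\<Sum>\<^sub>\<infinity>w\<in>E_words I A n. SUP \<tau>\<in>cylinder I A w. ennreal (exp (birkhoff_sum n u \<tau>)))"

definition pressure :: "nat set \<Rightarrow> (nat \<Rightarrow> nat \<Rightarrow> bool) \<Rightarrow> (seq \<Rightarrow> real) \<Rightarrow> ereal"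
  where "pressure I A u = lim (\<lambda>n. ext_log (partition_sum I A u n) / ereal (real n))"

definition summable_potential :: "nat set \<Rightarrow> (nat \<Rightarrow> nat \<Rightarrow> bool) \<Rightarrow> (seq \<Rightarrow> real) \<Rightarrow> bool"
  where "summable_potential I A u \<longleftrightarrow>
    (\<Sum>\<^sub>\<infinity>e\<in>I. SUP \<tau>\<in>cylinder I A [e]. ennreal (exp (u \<tau>))) < \<infinity>"

definition t_star ::
  "nat set \<Rightarrow> (nat \<Rightarrow> nat \<Rightarrow> bool) \<Rightarrow> (seq \<Rightarrow> real) \<Rightarrow> (seq \<Rightarrow> real) \<Rightarrow> ereal"
  where "t_star I A \<eta> \<xi> =
    Sup {ereal t | t. summable_potential I A (\<lambda>\<omega>. \<eta> \<omega> + t * \<xi> \<omega>)}"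


section \<open>Hoelder function spaces\<close>

definition variation ::
  "nat set \<Rightarrow> (nat \<Rightarrow> nat \<Rightarrow> bool) \<Rightarrow> nat \<Rightarrow> (seq \<Rightarrow> 'b::real_normed_vector) \<Rightarrow> ennreal"
  where "variation I A n f =
    (SUP (x, y)\<in>{(x, y). x \<in> E_inf I A \<and> y \<in> E_inf I A \<and> (\<forall>i<n. x i = y i)}.
      ennreal (norm (f x - f y)))"

definition theta_norm ::
  "nat set \<Rightarrow> (nat \<Rightarrow> nat \<Rightarrow> bool) \<Rightarrow> real \<Rightarrow> (seq \<Rightarrow> 'b::real_normed_vector) \<Rightarrow> ennreal"
  where "theta_norm I A \<theta> f = (SUP n\<in>{1..}. variation I A n f / ennreal (\<theta> ^ n))"

definition F_theta :: "nat set \<Rightarrow> (nat \<Rightarrow> nat \<Rightarrow> bool) \<Rightarrow> real \<Rightarrow> (seq \<Rightarrow> real) set"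
  where "F_theta I A \<theta> = {f. continuous_on (E_inf I A) f \<and> theta_norm I A \<theta> f < \<infinity>}"

text \<open>
  Elements of the space of bounded functions are extended by 0 outside the shift space, so that
  equality of such functions on the shift space is equality in HOL.
\<close>

definition Fb_theta :: "nat set \<Rightarrow> (nat \<Rightarrow> nat \<Rightarrow> bool) \<Rightarrow> real \<Rightarrow> (seq \<Rightarrow> complex) set"
  where "Fb_theta I A \<theta> = {f. continuous_on (E_inf I A) f \<and> bounded (f ` E_inf I A) \<and>
    theta_norm I A \<theta> f < \<infinity> \<and> (\<forall>\<omega>. \<omega> \<notin> E_inf I A \<longrightarrow> f \<omega> = 0)}"

definition Fb_norm :: "nat set \<Rightarrow> (nat \<Rightarrow> nat \<Rightarrow> bool) \<Rightarrow> real \<Rightarrow> (seq \<Rightarrow> complex) \<Rightarrow> real"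
  where "Fb_norm I A \<theta> f =
    enn2real (theta_norm I A \<theta> f) + (SUP \<omega>\<in>E_inf I A. norm (f \<omega>))"


section \<open>Transfer operators and their eigendata\<close>

text \<open>Outside the shift space the index set of the sum is empty, so the value there is 0.\<close>

definition transfer_op ::
  "nat set \<Rightarrow> (nat \<Rightarrow> nat \<Rightarrow> bool) \<Rightarrow> (seq \<Rightarrow> complex) \<Rightarrow> (seq \<Rightarrow> complex) \<Rightarrow> seq \<Rightarrow> complex"
  where "transfer_op I A f g \<omega> = (\<Sum>\<^sub>\<infinity>y\<in>{y\<in>E_inf I A. shift y = \<omega>}. exp (f y) * g y)"

definition perturbed_op ::
  "nat set \<Rightarrow> (nat \<Rightarrow> nat \<Rightarrow> bool) \<Rightarrow> (seq \<Rightarrow> real) \<Rightarrow> (seq \<Rightarrow> real) \<Rightarrow> complex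
    \<Rightarrow> (seq \<Rightarrow> complex) \<Rightarrow> seq \<Rightarrow> complex"
  where "perturbed_op I A \<eta> \<xi> z =
    transfer_op I A (\<lambda>\<omega>. complex_of_real (\<eta> \<omega>) + z * complex_of_real (\<xi> \<omega>))"

definition exp_pressure :: "nat set \<Rightarrow> (nat \<Rightarrow> nat \<Rightarrow> bool) \<Rightarrow> (seq \<Rightarrow> real) \<Rightarrow> real"
  where "exp_pressure I A u = exp (real_of_ereal (pressure I A u))"

definition eigenmeasure ::
  "nat set \<Rightarrow> (nat \<Rightarrow> nat \<Rightarrow> bool) \<Rightarrow> real \<Rightarrow> (seq \<Rightarrow> real) \<Rightarrow> seq measure \<Rightarrow> bool"
  where "eigenmeasure I A \<theta> u m \<longleftrightarrow>
    prob_space m \<and> space m = E_inf I A \<and> sets m = sets (restrict_space borel (E_inf I A)) \<and>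
    (\<forall>g\<in>Fb_theta I A \<theta>.
      integral\<^sup>L m (transfer_op I A (\<lambda>\<omega>. complex_of_real (u \<omega>)) g)
        = complex_of_real (exp_pressure I A u) * integral\<^sup>L m g)"

definition eigenfunction ::
  "nat set \<Rightarrow> (nat \<Rightarrow> nat \<Rightarrow> bool) \<Rightarrow> real \<Rightarrow> (seq \<Rightarrow> real) \<Rightarrow> seq measure \<Rightarrow> (seq \<Rightarrow> complex) \<Rightarrow> bool"
  where "eigenfunction I A \<theta> u m h \<longleftrightarrow>
    h \<in> Fb_theta I A \<theta> \<and> (\<forall>\<omega>\<in>E_inf I A. h \<omega> \<in> \<real> \<and> 0 < Re (h \<omega>)) \<and>
    transfer_op I A (\<lambda>\<omega>. complex_of_real (u \<omega>)) h
      = complex_of_real (exp_pressure I A u) *\<^sub>C h \<and>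
    integral\<^sup>L m h = 1"

text \<open>
  \<open>\<gamma>\<close>, \<open>h\<close>, \<open>\<nu>\<close> are holomorphic extensions, to the complex neighbourhood \<open>U\<close> of the real half-line
  below \<open>t_star\<close>, of the exponential of the pressure, the normalised eigenfunction and the eigenmeasure
  (acting as a functional by integration). The real part bound on \<open>U\<close> is the region where the
  transfer operator is defined.
\<close>

definition eigendata_extension ::
  "nat set \<Rightarrow> (nat \<Rightarrow> nat \<Rightarrow> bool) \<Rightarrow> real \<Rightarrow> (seq \<Rightarrow> real) \<Rightarrow> (seq \<Rightarrow> real) \<Rightarrow> complex set
    \<Rightarrow> (complex \<Rightarrow> complex) \<Rightarrow> (complex \<Rightarrow> seq \<Rightarrow> complex)
    \<Rightarrow> (complex \<Rightarrow> (seq \<Rightarrow> complex) \<Rightarrow> complex) \<Rightarrow> bool"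
  where "eigendata_extension I A \<theta> \<eta> \<xi> U \<gamma> h \<nu> \<longleftrightarrow>
    open U \<and> (\<forall>z\<in>U. ereal (Re z) < t_star I A \<eta> \<xi>) \<and>
    (\<forall>t. ereal t < t_star I A \<eta> \<xi> \<longrightarrow> complex_of_real t \<in> U) \<and>
    \<gamma> holomorphic_on U \<and>
    holomorphic_into (Fb_theta I A \<theta>) (Fb_norm I A \<theta>) h U \<and>
    holomorphic_into (dual_space (Fb_theta I A \<theta>) (Fb_norm I A \<theta>))
      (map_norm (Fb_theta I A \<theta>) (Fb_norm I A \<theta>) cmod) \<nu> U \<and>
    (\<forall>t. ereal t < t_star I A \<eta> \<xi> \<longrightarrow>
      (let u = (\<lambda>\<omega>. \<eta> \<omega> + t * \<xi> \<omega>); z = complex_of_real t in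
        \<gamma> z = complex_of_real (exp_pressure I A u) \<and>
        (\<exists>m. eigenmeasure I A \<theta> u m \<and> (\<forall>g\<in>Fb_theta I A \<theta>. \<nu> z g = integral\<^sup>L m g) \<and>
          eigenfunction I A \<theta> u m (h z)))) \<and>
    (\<forall>z\<in>U. \<gamma> z \<noteq> 0 \<and>
      perturbed_op I A \<eta> \<xi> z (h z) = \<gamma> z *\<^sub>C h z \<and>
      (\<forall>g\<in>Fb_theta I A \<theta>. \<nu> z (perturbed_op I A \<eta> \<xi> z g) = \<gamma> z * \<nu> z g) \<and>
      \<nu> z (h z) = 1)"

text \<open>The operators written with one and two primes; \<open>\<gamma> z\<close> is the exponential of the pressure at \<open>z\<close>.\<close>

definition principal_op ::
  "(complex \<Rightarrow> complex) \<Rightarrow> (complex \<Rightarrow> seq \<Rightarrow> complex) \<Rightarrow> (complex \<Rightarrow> (seq \<Rightarrow> complex) \<Rightarrow> complex)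
    \<Rightarrow> complex \<Rightarrow> (seq \<Rightarrow> complex) \<Rightarrow> seq \<Rightarrow> complex"
  where "principal_op \<gamma> h \<nu> z g = (\<gamma> z * \<nu> z g) *\<^sub>C h z"

definition remainder_op ::
  "nat set \<Rightarrow> (nat \<Rightarrow> nat \<Rightarrow> bool) \<Rightarrow> (seq \<Rightarrow> real) \<Rightarrow> (seq \<Rightarrow> real)
    \<Rightarrow> (complex \<Rightarrow> complex) \<Rightarrow> (complex \<Rightarrow> seq \<Rightarrow> complex) \<Rightarrow> (complex \<Rightarrow> (seq \<Rightarrow> complex) \<Rightarrow> complex)
    \<Rightarrow> complex \<Rightarrow> (seq \<Rightarrow> complex) \<Rightarrow> seq \<Rightarrow> complex"
  where "remainder_op I A \<eta> \<xi> \<gamma> h \<nu> z g = perturbed_op I A \<eta> \<xi> z g - principal_op \<gamma> h \<nu> z g"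

end

theory Submission
  imports Defs "HOL-Complex_Analysis.Cauchy_Integral_Formula"
begin

text \<open>
  Let \<open>L\<close> be the transfer operator at \<open>z0 = - \<delta>\<close>, a positive operator with weight \<open>exp u\<close>, \<open>u = \<eta> - \<delta> \<xi>\<close>, and
  \<open>L_z\<close> the perturbed family. The resolvent is studied through the averages
  \<open>Q_z = (L_z + ... + L_z^m) / m\<close>, where \<open>m\<close> exceeds the lengths of the connecting words given by finite
  irreducibility. The average removes the possible periodicity of the shift, and
  \<open>Id - Q_z = (Id - L_z) p(L_z)\<close> carries invertibility back to \<open>Id - L_z\<close>.

  Spectral gap. On log-Lipschitz functions \<open>Q = Q_{z0}\<close> satisfies \<open>c \<Phi>(g) \<le> Q g \<le> C \<Phi>(g)\<close>, where \<open>\<Phi>\<close> is a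
  weighted sum of evaluations, one for each letter (\<open>Q_lower\<close>). For small \<open>\<epsilon>\<close> the operator
  \<open>K = Q - \<epsilon> \<Phi>(.) 1\<close> therefore still preserves a cone of such functions (\<open>cone_K\<close>). The renewal expansion of \<open>Q^n 1\<close>
  in terms of \<open>K^j 1\<close>, with \<open>Q^n 1\<close> bounded above and away from 0, forces \<open>\<Sum> K^j 1\<close> to converge (\<open>k_partial_sums\<close>).
  So the Neumann series inverts \<open>Id - K\<close> on the Hoelder space (\<open>spectral_gap\<close>), \<open>h = \<Sum> K^j 1\<close> is a fixed point of \<open>Q\<close>,
  and \<open>\<epsilon> \<Phi>(h) = 1\<close> (\<open>\<phi>_h\<close>).

  Zero pressure enters through the bounds for \<open>Q^n 1\<close>: \<open>sup L^n 1\<close> is multiplicative up to constants and comparable to the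
  partition sums, so it equals \<open>exp (n P)\<close> up to a bounded factor (\<open>r_exponential_growth\<close>).

  The pole. The operator \<open>Id - Q_z + \<epsilon> \<Phi>(.) 1\<close> is \<open>Id - K\<close> at \<open>z0\<close>, hence has a holomorphic inverse \<open>R_z\<close> near
  \<open>z0\<close>. Removing the rank one part shows that \<open>Id - Q_z\<close> is invertible when \<open>d(z) = 1 - \<epsilon> \<Phi>(R_z 1)\<close> is nonzero, and that
  the inverse has \<open>d\<close> in the denominator (\<open>simple_pole_of_resolvent\<close>). Here \<open>d(z0) = 0\<close>, and \<open>d'(z0) = - \<epsilon> \<Phi>(R_{z0} Q' h)\<close>
  with \<open>Q'\<close> the derivative of \<open>Q_z\<close> at \<open>z0\<close>. The function \<open>Q' h\<close> is nonnegative since \<open>\<xi> \<ge> 0\<close>, and it is nonzero since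
  \<open>\<xi>\<close> does not vanish identically: otherwise the pressure would not depend on \<open>\<delta>\<close>. The functional \<open>\<epsilon> \<Phi> R_{z0}\<close> does not vanish
  on such a function \<open>f\<close> (\<open>functional_nonzero\<close>), because otherwise \<open>f = G - Q G\<close> and the sums of \<open>Q^j f\<close> would stay bounded.

  The explicit formula. Where \<open>Id - L_z\<close> is invertible, subtracting the rank one operator given by any normalized
  eigendata of \<open>L_z\<close> changes the inverse by an explicit rank one term (\<open>resolvent_split\<close>).
\<close>

section \<open>Bounded operators on a complex Banach space given by a carrier\<close>

lemma cscale_zero_left [simp]: "0 *\<^sub>C (x::'a::complex_space) = 0"
  using cscale_add_left[of 0 0 x] by simp

lemma cscale_zero_right [simp]: "c *\<^sub>C (0::'a::complex_space) = 0"
  using cscale_add_right[of c 0 "0::'a"] by simp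

lemma cscale_minus_left: "(- c) *\<^sub>C (x::'a::complex_space) = - (c *\<^sub>C x)"
  using cscale_add_left[of "-c" c x] by (simp add: eq_neg_iff_add_eq_0)

lemma cscale_minus_right: "c *\<^sub>C (- x::'a::complex_space) = - (c *\<^sub>C x)"
  using cscale_add_right[of c "-x" x] by (simp add: eq_neg_iff_add_eq_0)

lemma cscale_diff_left: "(c - d) *\<^sub>C (x::'a::complex_space) = c *\<^sub>C x - d *\<^sub>C x"
  using cscale_add_left[of c "-d" x] by (simp add: cscale_minus_left)

lemma cscale_diff_right: "c *\<^sub>C (x - y::'a::complex_space) = c *\<^sub>C x - c *\<^sub>C y"
  using cscale_add_right[of c x "-y"] by (simp add: cscale_minus_right)

lemma minus_eq_cscale: "- (x::'a::complex_space) = (-1) *\<^sub>C x"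
  by (simp add: cscale_minus_left cscale_one)

lemma cscale_sum_right: "c *\<^sub>C (\<Sum>i\<in>S. f i) = (\<Sum>i\<in>S. c *\<^sub>C (f i::'a::complex_space))"
  by (induction S rule: infinite_finite_induct) (simp_all add: cscale_add_right)

lemma cscale_sum_left: "(\<Sum>i\<in>S. c i) *\<^sub>C (f::'a::complex_space) = (\<Sum>i\<in>S. c i *\<^sub>C f)"
  by (induction S rule: infinite_finite_induct) (simp_all add: cscale_add_left)

lemmas cscale_algebra =
  cscale_add_left cscale_add_right cscale_diff_left cscale_diff_right cscale_cscale
  cscale_minus_left cscale_minus_right cscale_one

lemma null_sequence_squeeze:
  fixes a b :: "nat \<Rightarrow> real"
  assumes "b \<longlonglongrightarrow> 0" "\<And>k. 0 \<le> a k" "\<And>k. a k \<le> b k"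
  shows "a \<longlonglongrightarrow> 0"
  using assms by (intro tendsto_sandwich[OF _ _ tendsto_const assms(1)]) auto

locale carrier_banach =
  fixes V :: "'v::complex_space set" and N :: "'v \<Rightarrow> real"
  assumes zero_mem: "0 \<in> V"
    and add_mem: "f \<in> V \<Longrightarrow> g \<in> V \<Longrightarrow> f + g \<in> V"
    and cscale_mem: "f \<in> V \<Longrightarrow> c *\<^sub>C f \<in> V"
    and N_nonneg: "f \<in> V \<Longrightarrow> 0 \<le> N f"
    and N_triangle: "f \<in> V \<Longrightarrow> g \<in> V \<Longrightarrow> N (f + g) \<le> N f + N g"
    and N_cscale: "f \<in> V \<Longrightarrow> N (c *\<^sub>C f) = cmod c * N f"
    and N_eq_0: "f \<in> V \<Longrightarrow> N f = 0 \<Longrightarrow> f = 0"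
    and complete: "(\<And>n. F n \<in> V) \<Longrightarrow> summable (\<lambda>n. N (F n)) \<Longrightarrow>
      \<exists>s\<in>V. (\<lambda>k. N (s - (\<Sum>n<k. F n))) \<longlonglongrightarrow> 0"
begin

abbreviation ops :: "('v \<Rightarrow> 'v) set" where "ops \<equiv> bounded_ops V N"

lemma uminus_mem: "f \<in> V \<Longrightarrow> - f \<in> V"
  using cscale_mem[of f "-1"] by (simp add: minus_eq_cscale[symmetric])

lemma diff_mem: "f \<in> V \<Longrightarrow> g \<in> V \<Longrightarrow> f - g \<in> V"
  using add_mem[of f "-g"] uminus_mem by simp

lemma sum_mem: "(\<And>i. i \<in> S \<Longrightarrow> F i \<in> V) \<Longrightarrow> sum F S \<in> V"
  by (induction S rule: infinite_finite_induct) (auto intro: add_mem zero_mem)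

lemma N_zero [simp]: "N 0 = 0"
  using N_cscale[OF zero_mem, of 0] by simp

lemma N_uminus: "f \<in> V \<Longrightarrow> N (- f) = N f"
  using N_cscale[of f "-1"] by (simp add: minus_eq_cscale[symmetric])

lemma N_triangle_diff: "f \<in> V \<Longrightarrow> g \<in> V \<Longrightarrow> N (f - g) \<le> N f + N g"
  using N_triangle[of f "-g"] N_uminus[of g] uminus_mem[of g] by simp

lemma N_minus_commute: "f \<in> V \<Longrightarrow> g \<in> V \<Longrightarrow> N (f - g) = N (g - f)"
  using N_uminus[of "f - g"] diff_mem[of f g] by simp

lemma N_sum_le: "(\<And>i. i \<in> S \<Longrightarrow> F i \<in> V) \<Longrightarrow> N (sum F S) \<le> (\<Sum>i\<in>S. N (F i))"
proof (induction S rule: infinite_finite_induct)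
  case (insert x S)
  have "N (F x + sum F S) \<le> N (F x) + N (sum F S)"
    using insert by (intro N_triangle sum_mem) auto
  then show ?case using insert by force
qed auto

lemma opsI:
  assumes "\<And>f. f \<in> V \<Longrightarrow> T f \<in> V"
    and "\<And>f g. f \<in> V \<Longrightarrow> g \<in> V \<Longrightarrow> T (f + g) = T f + T g"
    and "\<And>c f. f \<in> V \<Longrightarrow> T (c *\<^sub>C f) = c *\<^sub>C T f"
    and "\<And>f. f \<in> V \<Longrightarrow> N (T f) \<le> C * N f"
  shows "T \<in> ops"
  using assms unfolding bounded_maps_def by blast

lemma ops_mem: "T \<in> ops \<Longrightarrow> f \<in> V \<Longrightarrow> T f \<in> V"
  and ops_add: "T \<in> ops \<Longrightarrow> f \<in> V \<Longrightarrow> g \<in> V \<Longrightarrow> T (f + g) = T f + T g"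
  and ops_cscale: "T \<in> ops \<Longrightarrow> f \<in> V \<Longrightarrow> T (c *\<^sub>C f) = c *\<^sub>C T f"
  unfolding bounded_maps_def by blast+

lemma ops_bound:
  assumes "T \<in> ops"
  obtains C where "0 \<le> C" "\<And>f. f \<in> V \<Longrightarrow> N (T f) \<le> C * N f"
proof -
  obtain C where C: "\<And>f. f \<in> V \<Longrightarrow> N (T f) \<le> C * N f"
    using assms unfolding bounded_maps_def by blast
  have "N (T f) \<le> max 0 C * N f" if "f \<in> V" for f
    using C[OF that] N_nonneg[OF that] by (meson max.cobounded2 mult_right_mono order_trans)
  then show ?thesis using that[of "max 0 C"] by simp
qed

lemma ops_zero: "T \<in> ops \<Longrightarrow> T 0 = 0"
  using ops_cscale[OF _ zero_mem, of T 0] by simp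

lemma ops_diff: "T \<in> ops \<Longrightarrow> f \<in> V \<Longrightarrow> g \<in> V \<Longrightarrow> T (f - g) = T f - T g"
  using ops_add[of T f "-g"] ops_cscale[of T g "-1"] uminus_mem[of g]
  by (simp add: minus_eq_cscale[symmetric])

lemma ops_sum: "T \<in> ops \<Longrightarrow> (\<And>i. i \<in> S \<Longrightarrow> F i \<in> V) \<Longrightarrow> T (sum F S) = (\<Sum>i\<in>S. T (F i))"
proof (induction S rule: infinite_finite_induct)
  case (insert x S)
  then have "T (F x + sum F S) = T (F x) + T (sum F S)"
    by (intro ops_add sum_mem) auto
  then show ?case using insert by simp
qed (auto simp: ops_zero)

lemma id_in_ops: "(\<lambda>f. f) \<in> ops"
  by (rule opsI[where C=1]) auto

lemma zero_in_ops: "(\<lambda>f. 0) \<in> ops"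
  by (rule opsI[where C=0]) (auto simp: zero_mem)

lemma comp_in_ops:
  assumes "S \<in> ops" "T \<in> ops" shows "(\<lambda>f. S (T f)) \<in> ops"
proof -
  obtain C where C: "0 \<le> C" "\<And>f. f \<in> V \<Longrightarrow> N (S f) \<le> C * N f"
    using ops_bound[OF assms(1)] by metis
  obtain D where D: "0 \<le> D" "\<And>f. f \<in> V \<Longrightarrow> N (T f) \<le> D * N f"
    using ops_bound[OF assms(2)] by metis
  show ?thesis
  proof (rule opsI[where C="C * D"])
    fix f assume f: "f \<in> V"
    have "N (S (T f)) \<le> C * N (T f)" using C(2) ops_mem[OF assms(2) f] .
    also have "\<dots> \<le> C * (D * N f)" using D(2)[OF f] C(1) by (rule mult_left_mono)
    finally show "N (S (T f)) \<le> C * D * N f" by (simp add: mult.assoc)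
  qed (use assms in \<open>auto simp: ops_mem ops_add ops_cscale\<close>)
qed

lemma add_in_ops:
  assumes "S \<in> ops" "T \<in> ops" shows "(\<lambda>f. S f + T f) \<in> ops"
proof -
  obtain C where C: "0 \<le> C" "\<And>f. f \<in> V \<Longrightarrow> N (S f) \<le> C * N f"
    using ops_bound[OF assms(1)] by metis
  obtain D where D: "0 \<le> D" "\<And>f. f \<in> V \<Longrightarrow> N (T f) \<le> D * N f"
    using ops_bound[OF assms(2)] by metis
  show ?thesis
  proof (rule opsI[where C="C + D"])
    fix f assume f: "f \<in> V"
    have "N (S f + T f) \<le> N (S f) + N (T f)"
      by (rule N_triangle[OF ops_mem[OF assms(1) f] ops_mem[OF assms(2) f]])
    also have "\<dots> \<le> C * N f + D * N f" using C(2)[OF f] D(2)[OF f] by linarith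
    finally show "N (S f + T f) \<le> (C + D) * N f" by (simp add: algebra_simps)
  qed (use assms in \<open>auto simp: ops_mem ops_add ops_cscale cscale_add_right add_mem\<close>)
qed

lemma cscale_in_ops:
  assumes "T \<in> ops" shows "(\<lambda>f. c *\<^sub>C T f) \<in> ops"
proof -
  obtain C where C: "0 \<le> C" "\<And>f. f \<in> V \<Longrightarrow> N (T f) \<le> C * N f"
    using ops_bound[OF assms(1)] by metis
  show ?thesis
  proof (rule opsI[where C="cmod c * C"])
    fix f assume f: "f \<in> V"
    show "N (c *\<^sub>C T f) \<le> cmod c * C * N f"
      using C(2)[OF f] assms f by (simp add: N_cscale ops_mem mult.assoc mult_left_mono)
  qed (use assms in \<open>auto simp: ops_mem ops_add ops_cscale cscale_mem cscale_algebra mult.commute\<close>)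
qed

lemma diff_in_ops:
  assumes "S \<in> ops" "T \<in> ops" shows "(\<lambda>f. S f - T f) \<in> ops"
  using add_in_ops[OF assms(1) cscale_in_ops[OF assms(2), of "-1"]]
  by (simp add: minus_eq_cscale[symmetric])

lemma sum_in_ops: "(\<And>i. i \<in> S \<Longrightarrow> T i \<in> ops) \<Longrightarrow> (\<lambda>f. \<Sum>i\<in>S. T i f) \<in> ops"
  by (induction S rule: infinite_finite_induct) (simp_all add: zero_in_ops add_in_ops)

lemma funpow_in_ops: "T \<in> ops \<Longrightarrow> T ^^ n \<in> ops"
proof (induction n)
  case 0 then show ?case using id_in_ops by (simp add: id_def)
next
  case (Suc n) then show ?case using comp_in_ops[of T "T ^^ n"] by (simp add: o_def)
qed

lemma ops_sums:
  assumes T: "T \<in> ops" and F: "\<And>n. F n \<in> V" and s: "s \<in> V"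
    and lim: "(\<lambda>k. N (s - (\<Sum>n<k. F n))) \<longlonglongrightarrow> 0"
  shows "(\<lambda>k. N (T s - (\<Sum>n<k. T (F n)))) \<longlonglongrightarrow> 0"
proof -
  obtain C where C: "0 \<le> C" "\<And>f. f \<in> V \<Longrightarrow> N (T f) \<le> C * N f"
    using ops_bound[OF T] by metis
  have "(\<lambda>k. C * N (s - (\<Sum>n<k. F n))) \<longlonglongrightarrow> 0"
    using tendsto_mult_left[OF lim, of C] by simp
  then show ?thesis
  proof (rule null_sequence_squeeze)
    have eq: "T s - (\<Sum>n<k. T (F n)) = T (s - (\<Sum>n<k. F n))" for k
      using T F s by (simp add: ops_diff ops_sum sum_mem)
    show "0 \<le> N (T s - (\<Sum>n<k. T (F n)))" for k
      using T F s by (intro N_nonneg diff_mem sum_mem ops_mem[OF T]) auto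
    show "N (T s - (\<Sum>n<k. T (F n))) \<le> C * N (s - (\<Sum>n<k. F n))" for k
      unfolding eq using F s by (intro C diff_mem sum_mem) auto
  qed
qed

lemma N_limit_unique:
  assumes "s \<in> V" "t \<in> V" "\<And>k. F k \<in> V"
    and "(\<lambda>k. N (s - F k)) \<longlonglongrightarrow> 0" "(\<lambda>k. N (t - F k)) \<longlonglongrightarrow> 0"
  shows "s = t"
proof -
  have "(\<lambda>k. N (s - F k) + N (t - F k)) \<longlonglongrightarrow> 0"
    using tendsto_add[OF assms(4,5)] by simp
  moreover have "N (s - t) \<le> N (s - F k) + N (t - F k)" for k
    using N_triangle_diff[of "s - F k" "t - F k"] assms(1-3) by (simp add: diff_mem)
  ultimately have "N (s - t) \<le> 0"
    by (intro tendsto_lowerbound[where f="\<lambda>k. N (s - F k) + N (t - F k)"]) auto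
  then have "N (s - t) = 0" using N_nonneg[of "s - t"] assms(1,2) diff_mem by force
  then show ?thesis using N_eq_0[of "s - t"] assms(1,2) diff_mem by auto
qed

lemma N_le_limit:
  assumes "s \<in> V" "\<And>k. F k \<in> V" "(\<lambda>k. N (s - F k)) \<longlonglongrightarrow> 0" "\<And>k. N (F k) \<le> B"
  shows "N s \<le> B"
proof -
  have "(\<lambda>k. N (s - F k) + B) \<longlonglongrightarrow> 0 + B"
    by (intro tendsto_add assms tendsto_const)
  moreover have "N s \<le> N (s - F k) + B" for k
    using N_triangle[of "s - F k" "F k"] assms(1,2) assms(4)[of k] by (simp add: diff_mem)
  ultimately show ?thesis
    by (intro tendsto_lowerbound[where f="\<lambda>k. N (s - F k) + B"]) auto
qed

definition two_sided_inverse :: "('v \<Rightarrow> 'v) \<Rightarrow> ('v \<Rightarrow> 'v) \<Rightarrow> bool" where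
  "two_sided_inverse T S \<longleftrightarrow> T \<in> ops \<and> S \<in> ops \<and> (\<forall>f\<in>V. T (S f) = f \<and> S (T f) = f)"

lemma two_sided_inverseD:
  assumes "two_sided_inverse T S"
  shows "T \<in> ops" "S \<in> ops" "f \<in> V \<Longrightarrow> T (S f) = f" "f \<in> V \<Longrightarrow> S (T f) = f"
  using assms unfolding two_sided_inverse_def by auto

lemma two_sided_inverse_imp_invertible:
  assumes "two_sided_inverse T S"
  shows "invertible_op V N T" and "f \<in> V \<Longrightarrow> inv_into V T f = S f"
proof -
  note D = two_sided_inverseD[OF assms]
  have inj: "inj_on T V" by (metis D(4) inj_onI)
  have bij: "bij_betw T V V"
    by (rule bij_betw_byWitness[where f'=S]) (use D ops_mem in auto)
  have eq: "inv_into V T f = S f" if "f \<in> V" for f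
    using that D inj by (metis inv_into_f_f ops_mem)
  then show "f \<in> V \<Longrightarrow> inv_into V T f = S f" .
  obtain C where "\<And>f. f \<in> V \<Longrightarrow> N (S f) \<le> C * N f" using ops_bound[OF D(2)] by metis
  then have "inv_into V T \<in> ops"
    using D(2) by (intro opsI[where C=C]) (simp_all add: eq ops_mem ops_add ops_cscale add_mem cscale_mem)
  with bij D(1) show "invertible_op V N T" unfolding invertible_op_def by simp
qed

lemma invertible_op_imp_two_sided_inverse:
  assumes "invertible_op V N T" shows "two_sided_inverse T (inv_into V T)"
  using assms unfolding invertible_op_def two_sided_inverse_def
  by (auto simp: bij_betw_inv_into_left bij_betw_inv_into_right)

text \<open>
  The hypothesis bounds the powers separately, by a summable sequence \<open>c\<close>, instead of asking that
  \<open>K\<close> have norm below 1: in the application \<open>K\<close> has spectral radius below 1, which shows only in the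
  decay of \<open>K ^^ n\<close>. The inverse is the sum of the series; that it inverts on both sides is telescoping.
\<close>

lemma neumann_series:
  assumes K: "K \<in> ops" and c: "summable c"
    and bound: "\<And>n f. f \<in> V \<Longrightarrow> N ((K ^^ n) f) \<le> c n * N f"
  obtains S where "two_sided_inverse (\<lambda>f. f - K f) S"
    and "\<And>f. f \<in> V \<Longrightarrow> (\<lambda>k. N (S f - (\<Sum>n<k. (K ^^ n) f))) \<longlonglongrightarrow> 0"
    and "\<And>f. f \<in> V \<Longrightarrow> N (S f) \<le> suminf c * N f"
proof -
  have Kn: "(K ^^ n) f \<in> V" if "f \<in> V" for n f
    using funpow_in_ops[OF K] that by (rule ops_mem)
  have sm: "summable (\<lambda>n. N ((K ^^ n) f))" if f: "f \<in> V" for f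
    by (rule summable_comparison_test'[OF summable_mult2[OF c, of "N f"], of 0])
      (use N_nonneg[OF Kn[OF f]] bound[OF f] in auto)
  have "\<exists>s\<in>V. (\<lambda>k. N (s - (\<Sum>n<k. (K ^^ n) f))) \<longlonglongrightarrow> 0" if "f \<in> V" for f
    using complete[of "\<lambda>n. (K ^^ n) f"] Kn[OF that] sm[OF that] by blast
  then obtain S where SV: "\<And>f. f \<in> V \<Longrightarrow> S f \<in> V"
    and S: "\<And>f. f \<in> V \<Longrightarrow> (\<lambda>k. N (S f - (\<Sum>n<k. (K ^^ n) f))) \<longlonglongrightarrow> 0"
    by metis
  have partial: "(\<Sum>n<k. (K ^^ n) f) \<in> V" if "f \<in> V" for k f
    using Kn[OF that] by (rule sum_mem)
  have SN: "N (S f) \<le> suminf c * N f" if f: "f \<in> V" for f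
  proof (rule N_le_limit[OF SV[OF f] partial[OF f] S[OF f]])
    fix k
    have "N (\<Sum>n<k. (K ^^ n) f) \<le> (\<Sum>n<k. N ((K ^^ n) f))"
      using Kn[OF f] by (rule N_sum_le)
    also have "\<dots> \<le> (\<Sum>n. N ((K ^^ n) f))"
      using sm[OF f] N_nonneg[OF Kn[OF f]] by (intro sum_le_suminf) auto
    also have "\<dots> \<le> (\<Sum>n. c n * N f)"
      using bound[OF f] sm[OF f] summable_mult2[OF c] by (intro suminf_le) auto
    also have "\<dots> = suminf c * N f" using suminf_mult2[OF c] by simp
    finally show "N (\<Sum>n<k. (K ^^ n) f) \<le> suminf c * N f" .
  qed
  have Sops: "S \<in> ops"
  proof (rule opsI[OF SV _ _ SN])
    fix f g assume f: "f \<in> V" and g: "g \<in> V"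
    have "(\<lambda>k. N (S f - (\<Sum>n<k. (K ^^ n) f)) + N (S g - (\<Sum>n<k. (K ^^ n) g))) \<longlonglongrightarrow> 0"
      using tendsto_add[OF S[OF f] S[OF g]] by simp
    then have "(\<lambda>k. N (S f + S g - (\<Sum>n<k. (K ^^ n) (f + g)))) \<longlonglongrightarrow> 0"
    proof (rule null_sequence_squeeze)
      have eq: "S f + S g - (\<Sum>n<k. (K ^^ n) (f + g)) =
          (S f - (\<Sum>n<k. (K ^^ n) f)) + (S g - (\<Sum>n<k. (K ^^ n) g))" for k
        using f g by (simp add: ops_add[OF funpow_in_ops[OF K]] sum.distrib)
      show "0 \<le> N (S f + S g - (\<Sum>n<k. (K ^^ n) (f + g)))" for k
        by (intro N_nonneg diff_mem add_mem partial SV f g)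
      show "N (S f + S g - (\<Sum>n<k. (K ^^ n) (f + g))) \<le>
          N (S f - (\<Sum>n<k. (K ^^ n) f)) + N (S g - (\<Sum>n<k. (K ^^ n) g))" for k
        unfolding eq by (intro N_triangle diff_mem partial SV f g)
    qed
    then show "S (f + g) = S f + S g"
      using f g by (intro N_limit_unique[OF _ _ _ S]) (auto intro: add_mem SV partial)
  next
    fix a f assume f: "f \<in> V"
    have "(\<lambda>k. cmod a * N (S f - (\<Sum>n<k. (K ^^ n) f))) \<longlonglongrightarrow> 0"
      using tendsto_mult_left[OF S[OF f], of "cmod a"] by simp
    moreover have "cmod a * N (S f - (\<Sum>n<k. (K ^^ n) f)) =
        N (a *\<^sub>C S f - (\<Sum>n<k. (K ^^ n) (a *\<^sub>C f)))" for k
    proof -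
      have "a *\<^sub>C S f - (\<Sum>n<k. (K ^^ n) (a *\<^sub>C f)) = a *\<^sub>C (S f - (\<Sum>n<k. (K ^^ n) f))"
        using f by (simp add: ops_cscale[OF funpow_in_ops[OF K]] cscale_diff_right cscale_sum_right)
      then show ?thesis using f by (simp add: N_cscale diff_mem partial SV)
    qed
    ultimately have "(\<lambda>k. N (a *\<^sub>C S f - (\<Sum>n<k. (K ^^ n) (a *\<^sub>C f)))) \<longlonglongrightarrow> 0"
      by simp
    then show "S (a *\<^sub>C f) = a *\<^sub>C S f"
      using f by (intro N_limit_unique[OF _ _ _ S]) (auto intro: cscale_mem SV partial)
  qed
  have SK: "S (K f) = S f - f" if f: "f \<in> V" for f
  proof (rule N_limit_unique[OF _ _ _ S])
    have eq: "S f - f - (\<Sum>n<k. (K ^^ n) (K f)) = S f - (\<Sum>n<Suc k. (K ^^ n) f)" for k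
      by (simp only: sum.lessThan_Suc_shift)
        (simp add: funpow_swap1 algebra_simps)
    show "(\<lambda>k. N (S f - f - (\<Sum>n<k. (K ^^ n) (K f)))) \<longlonglongrightarrow> 0"
      unfolding eq using S[OF f] by (rule LIMSEQ_Suc)
  qed (use f K in \<open>auto intro: diff_mem SV partial ops_mem[OF K]\<close>)
  have KS: "K (S f) = S f - f" if f: "f \<in> V" for f
  proof (rule N_limit_unique[of _ _ "\<lambda>k. \<Sum>n<k. K ((K ^^ n) f)"])
    show "(\<lambda>k. N (K (S f) - (\<Sum>n<k. K ((K ^^ n) f)))) \<longlonglongrightarrow> 0"
      by (rule ops_sums[OF K Kn[OF f] SV[OF f] S[OF f]])
    have eq: "S f - f - (\<Sum>n<k. K ((K ^^ n) f)) = S f - (\<Sum>n<Suc k. (K ^^ n) f)" for k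
      by (simp only: sum.lessThan_Suc_shift) (simp add: algebra_simps)
    show "(\<lambda>k. N (S f - f - (\<Sum>n<k. K ((K ^^ n) f)))) \<longlonglongrightarrow> 0"
      unfolding eq using S[OF f] by (rule LIMSEQ_Suc)
  qed (use f K Kn in \<open>auto intro: diff_mem SV sum_mem ops_mem[OF K]\<close>)
  have "two_sided_inverse (\<lambda>f. f - K f) S"
    unfolding two_sided_inverse_def using diff_in_ops[OF id_in_ops K] Sops SK KS
    by (simp add: ops_diff ops_mem[OF K])
  then show ?thesis using that S SN by blast
qed

end

section \<open>Holomorphic families of operators\<close>

text \<open>
  The Taylor remainder of order two, with a constant that depends only on a bound for \<open>\<phi>\<close>. Applied to all
  matrix entries of an operator at once, it turns a uniform bound and holomorphy of the entries into
  differentiability in the operator norm.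
\<close>

lemma holomorphic_quadratic_remainder:
  assumes hol: "\<phi> holomorphic_on ball z r" and r: "0 < r"
    and B: "\<And>w. w \<in> ball z r \<Longrightarrow> cmod (\<phi> w) \<le> B" and w: "w \<in> ball z (r / 2)"
  shows "cmod (\<phi> w - \<phi> z - (w - z) * deriv \<phi> z) \<le> (32 * B / r\<^sup>2) * (cmod (w - z))\<^sup>2"
proof -
  have B0: "0 \<le> B" using B[of z] r norm_ge_zero order_trans by (metis centre_in_ball)
  have second: "cmod ((deriv ^^ 2) \<phi> x) \<le> 32 * B / r\<^sup>2" if x: "x \<in> ball z (r / 2)" for x
  proof -
    have sub: "cball x (r/4) \<subseteq> ball z r"
    proof
      fix y assume "y \<in> cball x (r/4)"
      then show "y \<in> ball z r" using x r dist_triangle[of z y x] by (auto simp: dist_commute)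
    qed
    have "cmod ((deriv ^^ 2) \<phi> x) \<le> fact 2 * B / (r/4) ^ 2"
    proof (rule Cauchy_inequality)
      show "\<phi> holomorphic_on ball x (r/4)"
        using hol sub ball_subset_cball by (meson holomorphic_on_subset order_trans)
      show "continuous_on (cball x (r/4)) \<phi>"
        using hol sub by (meson holomorphic_on_imp_continuous_on continuous_on_subset)
      show "cmod (\<phi> y) \<le> B" if "norm (x - y) = r/4" for y
        using that sub by (intro B) (auto simp: dist_norm subset_iff)
    qed (use r in auto)
    also have "\<dots> = 32 * B / r\<^sup>2" by (simp add: field_simps power2_eq_square fact_numeral)
    finally show ?thesis .
  qed
  have "cmod ((deriv ^^ 0) \<phi> w - (\<Sum>i\<le>1. (deriv ^^ i) \<phi> z * (w - z) ^ i / fact i))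
      \<le> (32 * B / r\<^sup>2) * cmod (w - z) ^ Suc 1 / fact 1"
  proof (rule complex_Taylor[where S="ball z (r/2)"])
    fix i x assume x: "x \<in> ball z (r/2)"
    have "(deriv ^^ i) \<phi> holomorphic_on ball z r"
      using hol by (intro holomorphic_higher_deriv) auto
    then have "((deriv ^^ i) \<phi> has_field_derivative deriv ((deriv ^^ i) \<phi>) x) (at x)"
      using x r by (intro holomorphic_derivI[of _ "ball z r"]) auto
    then show "((deriv ^^ i) \<phi> has_field_derivative (deriv ^^ Suc i) \<phi> x) (at x within ball z (r/2))"
      by (simp add: has_field_derivative_at_within)
  qed (use second w r in \<open>auto simp: numeral_2_eq_2\<close>)
  then show ?thesis by (simp add: algebra_simps power2_eq_square)
qed

lemma half_bound: "0 \<le> x \<Longrightarrow> x * (1 / (2 * (x + 1))) \<le> (1/2::real)"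
  by (simp add: pos_divide_le_eq)

context carrier_banach
begin

text \<open>
  Differentiability at \<open>z\<close> is required with a quadratic remainder. For holomorphic families this is no
  restriction, and it makes the product and inverse rules purely algebraic: every remainder
  is a sum of products of two first-order terms or one second-order term.
\<close>

definition has_op_deriv :: "(complex \<Rightarrow> 'v \<Rightarrow> 'v) \<Rightarrow> ('v \<Rightarrow> 'v) \<Rightarrow> complex \<Rightarrow> bool" where
  "has_op_deriv F D z \<longleftrightarrow> D \<in> ops \<and> (\<exists>C r. 0 < r \<and> (\<forall>w\<in>ball z r. F w \<in> ops \<and>
     (\<forall>f\<in>V. N (F w f - F z f - (w - z) *\<^sub>C D f) \<le> C * (cmod (w - z))\<^sup>2 * N f)))"

lemma has_op_derivI:
  assumes "D \<in> ops" "0 < r" "\<And>w. w \<in> ball z r \<Longrightarrow> F w \<in> ops"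
    and "\<And>w f. w \<in> ball z r \<Longrightarrow> f \<in> V \<Longrightarrow>
      N (F w f - F z f - (w - z) *\<^sub>C D f) \<le> C * (cmod (w - z))\<^sup>2 * N f"
  shows "has_op_deriv F D z"
  using assms unfolding has_op_deriv_def by blast

lemma has_op_deriv_mem: "has_op_deriv F D z \<Longrightarrow> D \<in> ops" "has_op_deriv F D z \<Longrightarrow> F z \<in> ops"
  unfolding has_op_deriv_def by auto

text \<open>
  The consequences of differentiability at \<open>z\<close> on one disc and with one constant: local boundedness,
  local Lipschitz continuity and the quadratic remainder.
\<close>

definition op_expansion where
  "op_expansion F D z C r \<longleftrightarrow> 0 \<le> C \<and> 0 < r \<and> (\<forall>f\<in>V. N (D f) \<le> C * N f) \<and>
    (\<forall>w\<in>ball z r. F w \<in> ops \<and> (\<forall>f\<in>V. N (F w f) \<le> C * N f \<and>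
      N (F w f - F z f) \<le> C * cmod (w - z) * N f \<and>
      N (F w f - F z f - (w - z) *\<^sub>C D f) \<le> C * (cmod (w - z))\<^sup>2 * N f))"

lemma op_expansionD:
  assumes "op_expansion F D z C r"
  shows "0 \<le> C" "0 < r"
    "w \<in> ball z r \<Longrightarrow> F w \<in> ops"
    "w \<in> ball z r \<Longrightarrow> f \<in> V \<Longrightarrow> N (F w f) \<le> C * N f"
    "w \<in> ball z r \<Longrightarrow> f \<in> V \<Longrightarrow> N (F w f - F z f) \<le> C * cmod (w - z) * N f"
    "w \<in> ball z r \<Longrightarrow> f \<in> V \<Longrightarrow>
      N (F w f - F z f - (w - z) *\<^sub>C D f) \<le> C * (cmod (w - z))\<^sup>2 * N f"
    "f \<in> V \<Longrightarrow> N (D f) \<le> C * N f"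
  using assms unfolding op_expansion_def by blast+

lemma has_op_derivE:
  assumes "has_op_deriv F D z"
  obtains C r where "op_expansion F D z C r"
proof -
  obtain C0 r0 where r0: "0 < r0" and F: "\<And>w. w \<in> ball z r0 \<Longrightarrow> F w \<in> ops"
    and quad0: "\<And>w f. w \<in> ball z r0 \<Longrightarrow> f \<in> V \<Longrightarrow>
      N (F w f - F z f - (w - z) *\<^sub>C D f) \<le> C0 * (cmod (w - z))\<^sup>2 * N f"
    and D: "D \<in> ops"
    using assms unfolding has_op_deriv_def by blast
  obtain d where d: "0 \<le> d" "\<And>f. f \<in> V \<Longrightarrow> N (D f) \<le> d * N f" using ops_bound[OF D] by metis
  have Fz: "F z \<in> ops" using F r0 by simp
  obtain b where b: "0 \<le> b" "\<And>f. f \<in> V \<Longrightarrow> N (F z f) \<le> b * N f" using ops_bound[OF Fz] by metis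
  define C1 where "C1 = max C0 0"
  define r where "r = min r0 1"
  define C where "C = C1 + d + b"
  have C1: "0 \<le> C1" "C0 \<le> C1" by (auto simp: C1_def)
  have r: "0 < r" "r \<le> 1" "ball z r \<subseteq> ball z r0" using r0 by (auto simp: r_def)
  have quad1: "N (F w f - F z f - (w - z) *\<^sub>C D f) \<le> C1 * (cmod (w - z))\<^sup>2 * N f"
    if "w \<in> ball z r" "f \<in> V" for w f
  proof -
    have "C0 * ((cmod (w - z))\<^sup>2 * N f) \<le> C1 * ((cmod (w - z))\<^sup>2 * N f)"
      using C1 that N_nonneg by (intro mult_right_mono) auto
    then show ?thesis using quad0[of w f] that r by (simp add: mult.assoc subset_iff)
  qed
  have lin: "N (F w f - F z f) \<le> (C1 + d) * cmod (w - z) * N f" if w: "w \<in> ball z r" and f: "f \<in> V" for w f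
  proof -
    have Fw: "F w \<in> ops" using F w r by blast
    have small: "cmod (w - z) \<le> 1" using w r by (simp add: dist_norm norm_minus_commute)
    have "N (F w f - F z f) = N ((F w f - F z f - (w - z) *\<^sub>C D f) + (w - z) *\<^sub>C D f)" by simp
    also have "\<dots> \<le> N (F w f - F z f - (w - z) *\<^sub>C D f) + N ((w - z) *\<^sub>C D f)"
      by (intro N_triangle diff_mem cscale_mem ops_mem[OF Fw] ops_mem[OF Fz] ops_mem[OF D] f)
    also have "\<dots> \<le> C1 * (cmod (w - z))\<^sup>2 * N f + cmod (w - z) * (d * N f)"
      using quad1[OF w f] d(2)[OF f] by (simp add: N_cscale ops_mem[OF D f] add_mono mult_left_mono)
    also have "\<dots> \<le> C1 * cmod (w - z) * N f + cmod (w - z) * (d * N f)"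
    proof -
      have "(cmod (w - z))\<^sup>2 \<le> cmod (w - z)"
        using small by (simp add: power2_eq_square mult_left_le)
      then show ?thesis using C1 N_nonneg[OF f] by (simp add: mult_left_mono mult_right_mono)
    qed
    finally show ?thesis by (simp add: algebra_simps)
  qed
  have "op_expansion F D z C r"
    unfolding op_expansion_def
  proof (intro conjI ballI)
    fix w f assume w: "w \<in> ball z r" and f: "f \<in> V"
    have Fw: "F w \<in> ops" using F w r by blast
    show "N (F w f - F z f - (w - z) *\<^sub>C D f) \<le> C * (cmod (w - z))\<^sup>2 * N f"
    proof (rule order_trans[OF quad1[OF w f]])
      show "C1 * (cmod (w - z))\<^sup>2 * N f \<le> C * (cmod (w - z))\<^sup>2 * N f"
        using N_nonneg[OF f] d(1) b(1) by (intro mult_right_mono) (auto simp: C_def)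
    qed
    show "N (F w f - F z f) \<le> C * cmod (w - z) * N f"
    proof (rule order_trans[OF lin[OF w f]])
      show "(C1 + d) * cmod (w - z) * N f \<le> C * cmod (w - z) * N f"
        using N_nonneg[OF f] b(1) by (intro mult_right_mono) (auto simp: C_def)
    qed
    have "N (F w f) = N ((F w f - F z f) + F z f)" by simp
    also have "\<dots> \<le> N (F w f - F z f) + N (F z f)"
      by (intro N_triangle diff_mem ops_mem[OF Fw] ops_mem[OF Fz] f)
    also have "\<dots> \<le> (C1 + d) * cmod (w - z) * N f + b * N f"
      using lin[OF w f] b(2)[OF f] by simp
    also have "\<dots> \<le> (C1 + d) * 1 * N f + b * N f"
      using w r C1 d(1) N_nonneg[OF f]
      by (intro add_right_mono mult_right_mono mult_left_mono) (auto simp: dist_norm norm_minus_commute)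
    finally show "N (F w f) \<le> C * N f" by (simp add: C_def algebra_simps)
  next
    fix f assume f: "f \<in> V"
    have "d * N f \<le> C * N f" using N_nonneg[OF f] C1 b by (intro mult_right_mono) (auto simp: C_def)
    then show "N (D f) \<le> C * N f" using d(2)[OF f] by linarith
  qed (use F r C1 d b in \<open>auto simp: C_def\<close>)
  then show ?thesis by (rule that)
qed

lemma has_op_deriv_const: "T \<in> ops \<Longrightarrow> has_op_deriv (\<lambda>w. T) (\<lambda>f. 0) z"
  by (rule has_op_derivI[where r=1 and C=0]) (auto simp: zero_in_ops)

lemma has_op_deriv_add:
  assumes F: "has_op_deriv F D z" and G: "has_op_deriv G E z"
  shows "has_op_deriv (\<lambda>w f. F w f + G w f) (\<lambda>f. D f + E f) z"
proof -
  note memz = has_op_deriv_mem[OF F] has_op_deriv_mem[OF G]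
  from F obtain C r where "op_expansion F D z C r" by (rule has_op_derivE)
  note C = op_expansionD[OF this]
  from G obtain B s where "op_expansion G E z B s" by (rule has_op_derivE)
  note B = op_expansionD[OF this]
  show ?thesis
  proof (rule has_op_derivI[where r="min r s" and C="C + B"])
    fix w f assume w: "w \<in> ball z (min r s)" and f: "f \<in> V"
    have wr: "w \<in> ball z r" "w \<in> ball z s" using w by auto
    note m = ops_mem[OF C(3)[OF wr(1)] f] ops_mem[OF B(3)[OF wr(2)] f]
      ops_mem[OF memz(1) f] ops_mem[OF memz(2) f] ops_mem[OF memz(3) f] ops_mem[OF memz(4) f]
    have eq: "F w f + G w f - (F z f + G z f) - (w - z) *\<^sub>C (D f + E f) =
        (F w f - F z f - (w - z) *\<^sub>C D f) + (G w f - G z f - (w - z) *\<^sub>C E f)"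
      by (simp add: cscale_add_right algebra_simps)
    have "N (F w f + G w f - (F z f + G z f) - (w - z) *\<^sub>C (D f + E f)) \<le>
        N (F w f - F z f - (w - z) *\<^sub>C D f) + N (G w f - G z f - (w - z) *\<^sub>C E f)"
      unfolding eq by (intro N_triangle diff_mem cscale_mem m)
    also have "\<dots> \<le> (C + B) * (cmod (w - z))\<^sup>2 * N f"
      using C(6)[OF wr(1) f] B(6)[OF wr(2) f] by (simp add: algebra_simps)
    finally show "N (F w f + G w f - (F z f + G z f) - (w - z) *\<^sub>C (D f + E f))
        \<le> (C + B) * (cmod (w - z))\<^sup>2 * N f" .
  qed (use C B memz add_in_ops in auto)
qed

lemma has_op_deriv_sum:
  assumes "\<And>i. i \<in> S \<Longrightarrow> has_op_deriv (F i) (D i) z"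
  shows "has_op_deriv (\<lambda>w f. \<Sum>i\<in>S. F i w f) (\<lambda>f. \<Sum>i\<in>S. D i f) z"
  using assms
proof (induction S rule: infinite_finite_induct)
  case (insert x S)
  then show ?case using has_op_deriv_add[of "F x" "D x" z] by simp
qed (auto intro: has_op_deriv_const zero_in_ops)

lemma has_op_deriv_comp:
  assumes F: "has_op_deriv F D z" and G: "has_op_deriv G E z"
  shows "has_op_deriv (\<lambda>w f. F w (G w f)) (\<lambda>f. D (G z f) + F z (E f)) z"
proof -
  note memz = has_op_deriv_mem[OF F] has_op_deriv_mem[OF G]
  from F obtain C r where "op_expansion F D z C r" by (rule has_op_derivE)
  note C = op_expansionD[OF this]
  from G obtain B s where "op_expansion G E z B s" by (rule has_op_derivE)
  note B = op_expansionD[OF this]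
  show ?thesis
  proof (rule has_op_derivI[where r="min r s" and C="C * B + C * B + C * B"])
    show "(\<lambda>f. D (G z f) + F z (E f)) \<in> ops"
      by (rule add_in_ops[OF comp_in_ops[OF memz(1) memz(4)] comp_in_ops[OF memz(2) memz(3)]])
    show "(\<lambda>f. F w (G w f)) \<in> ops" if "w \<in> ball z (min r s)" for w
      using that by (intro comp_in_ops[OF C(3) B(3)]) auto
    fix w f assume w: "w \<in> ball z (min r s)" and f: "f \<in> V"
    have wr: "w \<in> ball z r" "w \<in> ball z s" "z \<in> ball z r" using w C by auto
    note Fw = C(3)[OF wr(1)] and Gw = B(3)[OF wr(2)]
    have m: "G w f \<in> V" "G z f \<in> V" "E f \<in> V"
      using ops_mem[OF Gw f] ops_mem[OF memz(4) f] ops_mem[OF memz(3) f] .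
    let ?h = "w - z"
    \<comment> \<open>Second-order parts: the remainder of \<open>F\<close>, the remainder of \<open>G\<close>, and a mixed increment.\<close>
    define a where "a = F w (G w f) - F z (G w f) - ?h *\<^sub>C D (G w f)"
    define b where "b = F z (G w f - G z f - ?h *\<^sub>C E f)"
    define c where "c = ?h *\<^sub>C D (G w f - G z f)"
    have abc: "a \<in> V" "b \<in> V" "c \<in> V" unfolding a_def b_def c_def
      by (intro diff_mem cscale_mem m ops_mem[OF Fw] ops_mem[OF memz(2)] ops_mem[OF memz(1)])+
    have eq: "F w (G w f) - F z (G z f) - ?h *\<^sub>C (D (G z f) + F z (E f)) = a + b + c"
      unfolding a_def b_def c_def using m
      by (simp add: ops_diff[OF memz(2)] ops_diff[OF memz(1)] ops_cscale[OF memz(2)]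
          diff_mem cscale_mem cscale_algebra)
    have "N (a + b + c) \<le> N a + N b + N c"
      using N_triangle[of "a + b" c] N_triangle[of a b] abc add_mem[of a b] by linarith
    moreover have "N a \<le> C * B * (cmod ?h)\<^sup>2 * N f"
    proof -
      have "N a \<le> C * (cmod ?h)\<^sup>2 * N (G w f)"
        unfolding a_def by (rule C(6)[OF wr(1) m(1)])
      also have "\<dots> \<le> C * (cmod ?h)\<^sup>2 * (B * N f)"
        using B(4)[OF wr(2) f] C(1) by (intro mult_left_mono) auto
      finally show ?thesis by (simp add: ac_simps)
    qed
    moreover have "N b \<le> C * B * (cmod ?h)\<^sup>2 * N f"
    proof -
      have "N b \<le> C * N (G w f - G z f - ?h *\<^sub>C E f)"
        unfolding b_def by (intro C(4) wr diff_mem cscale_mem m)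
      also have "\<dots> \<le> C * (B * (cmod ?h)\<^sup>2 * N f)"
        using B(6)[OF wr(2) f] C(1) by (intro mult_left_mono) auto
      finally show ?thesis by (simp add: ac_simps)
    qed
    moreover have "N c \<le> C * B * (cmod ?h)\<^sup>2 * N f"
    proof -
      have "N c = cmod ?h * N (D (G w f - G z f))"
        unfolding c_def by (intro N_cscale ops_mem[OF memz(1)] diff_mem m)
      also have "\<dots> \<le> cmod ?h * (C * N (G w f - G z f))"
        by (intro mult_left_mono C(7) diff_mem m) auto
      also have "\<dots> \<le> cmod ?h * (C * (B * cmod ?h * N f))"
        using B(5)[OF wr(2) f] C(1) by (intro mult_left_mono) auto
      finally show ?thesis by (simp add: ac_simps power2_eq_square)
    qed
    ultimately show "N (F w (G w f) - F z (G z f) - ?h *\<^sub>C (D (G z f) + F z (E f)))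
        \<le> (C * B + C * B + C * B) * (cmod ?h)\<^sup>2 * N f"
      unfolding eq by (simp add: algebra_simps)
  qed (use C B in auto)
qed

lemma has_op_deriv_scalar:
  assumes "s holomorphic_on U" "open U" "z \<in> U"
  shows "has_op_deriv (\<lambda>w f. s w *\<^sub>C f) (\<lambda>f. deriv s z *\<^sub>C f) z"
proof -
  obtain r0 where r0: "0 < r0" "cball z r0 \<subseteq> U"
    using assms open_contains_cball by blast
  have "continuous_on (cball z r0) s"
    using assms r0 by (meson continuous_on_subset holomorphic_on_imp_continuous_on)
  then have "bounded (s ` cball z r0)"
    by (intro compact_imp_bounded compact_continuous_image) auto
  then obtain B where B: "\<And>w. w \<in> cball z r0 \<Longrightarrow> cmod (s w) \<le> B"
    unfolding bounded_iff by blast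
  have hol: "s holomorphic_on ball z r0"
    using assms(1) r0 ball_subset_cball by (meson holomorphic_on_subset order_trans)
  show ?thesis
  proof (rule has_op_derivI[where r="r0 / 2" and C="32 * B / r0\<^sup>2"])
    fix w f assume w: "w \<in> ball z (r0/2)" and f: "f \<in> V"
    have eq: "s w *\<^sub>C f - s z *\<^sub>C f - (w - z) *\<^sub>C deriv s z *\<^sub>C f
        = (s w - s z - (w - z) * deriv s z) *\<^sub>C f"
      by (simp add: cscale_algebra)
    have "cmod (s w - s z - (w - z) * deriv s z) \<le> (32 * B / r0\<^sup>2) * (cmod (w - z))\<^sup>2"
      by (rule holomorphic_quadratic_remainder[OF hol r0(1) B w]) auto
    then show "N (s w *\<^sub>C f - s z *\<^sub>C f - (w - z) *\<^sub>C deriv s z *\<^sub>C f)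
        \<le> 32 * B / r0\<^sup>2 * (cmod (w - z))\<^sup>2 * N f"
      unfolding eq N_cscale[OF f] using N_nonneg[OF f] by (rule mult_right_mono)
  qed (use r0 in \<open>auto intro: cscale_in_ops[OF id_in_ops]\<close>)
qed

lemma has_op_deriv_cmult:
  assumes "has_op_deriv F D z"
  shows "has_op_deriv (\<lambda>w f. c *\<^sub>C F w f) (\<lambda>f. c *\<^sub>C D f) z"
  using has_op_deriv_comp[OF has_op_deriv_const[OF cscale_in_ops[OF id_in_ops]] assms]
  by simp

text \<open>
  The resolvent identity \<open>R w - R z = - R w (F w - F z) R z\<close> first bounds \<open>R w\<close> near \<open>z\<close>
  by twice the norm of \<open>R z\<close> and, applied a second time, yields the quadratic remainder.
\<close>

lemma has_op_deriv_inverse: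
  assumes F: "has_op_deriv F D z" and s: "0 < s"
    and inv: "\<And>w. w \<in> ball z s \<Longrightarrow> two_sided_inverse (F w) (R w)"
  shows "has_op_deriv R (\<lambda>f. - R z (D (R z f))) z"
proof -
  from F obtain C r where "op_expansion F D z C r" by (rule has_op_derivE)
  note C = op_expansionD[OF this]
  have D: "D \<in> ops" and Fz: "F z \<in> ops" using has_op_deriv_mem[OF F] .
  have zs: "z \<in> ball z s" using s by simp
  note Rz = two_sided_inverseD[OF inv[OF zs]]
  obtain c where c: "0 \<le> c" "\<And>f. f \<in> V \<Longrightarrow> N (R z f) \<le> c * N f" using ops_bound[OF Rz(2)] by metis
  define t where "t = min (min r s) (1 / (2 * (c * C + 1)))"
  have cC: "0 < 2 * (c * C + 1)" using c(1) C(1) by (intro mult_pos_pos add_nonneg_pos) auto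
  have t: "0 < t" "ball z t \<subseteq> ball z r" "ball z t \<subseteq> ball z s" using C s cC by (auto simp: t_def)
  have R: "R w \<in> ops" if "w \<in> ball z t" for w using two_sided_inverseD(2)[OF inv] that t by blast
  have Fw: "F w \<in> ops" if "w \<in> ball z t" for w using C(3) that t by blast
  have diff: "R w f - R z f = - R w (F w (R z f) - F z (R z f))"
    if w: "w \<in> ball z t" and f: "f \<in> V" for w f
  proof -
    have "w \<in> ball z s" using w t by blast
    note Rw = two_sided_inverseD[OF inv[OF this]]
    show ?thesis using f by (simp add: ops_diff[OF Rw(2)] ops_mem[OF Rw(1)] ops_mem[OF Rz(1)] ops_mem[OF Rz(2)]
          Rw(4) Rz(3))
  qed
  have diff': "R w f = R z f - R z (F w (R w f) - F z (R w f))"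
    if w: "w \<in> ball z t" and f: "f \<in> V" for w f
  proof -
    have "w \<in> ball z s" using w t by blast
    note Rw = two_sided_inverseD[OF inv[OF this]]
    show ?thesis using f by (simp add: ops_diff[OF Rz(2)] ops_mem[OF Rw(2)] ops_mem[OF Rz(1)]
          Rw(3) Rz(4))
  qed
  have Rbound: "N (R w f) \<le> 2 * c * N f" if w: "w \<in> ball z t" and f: "f \<in> V" for w f
  proof -
    have wr: "w \<in> ball z r" using w t by blast
    have Rwf: "R w f \<in> V" using ops_mem[OF R[OF w] f] .
    have m: "F w (R w f) - F z (R w f) \<in> V"
      by (intro diff_mem ops_mem[OF Fw[OF w]] ops_mem[OF Fz] Rwf)
    have small: "c * C * cmod (w - z) \<le> 1/2"
    proof -
      have "cmod (w - z) \<le> 1 / (2 * (c * C + 1))"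
        using w by (simp add: t_def dist_norm norm_minus_commute)
      then have "c * C * cmod (w - z) \<le> c * C * (1 / (2 * (c * C + 1)))"
        using c(1) C(1) by (intro mult_left_mono) auto
      also have "\<dots> \<le> 1/2" using half_bound[of "c * C"] c(1) C(1) by simp
      finally show ?thesis .
    qed
    have "N (R w f) \<le> N (R z f) + N (R z (F w (R w f) - F z (R w f)))"
      by (subst diff'[OF w f]) (intro N_triangle_diff ops_mem[OF Rz(2)] m f)
    also have "\<dots> \<le> c * N f + c * N (F w (R w f) - F z (R w f))"
      using c(2)[OF f] c(2)[OF m] by (rule add_mono)
    also have "\<dots> \<le> c * N f + c * (C * cmod (w - z) * N (R w f))"
      using C(5)[OF wr Rwf] c(1) by (intro add_left_mono mult_left_mono)
    also have "\<dots> \<le> c * N f + 1/2 * N (R w f)"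
      using mult_right_mono[OF small N_nonneg[OF Rwf]] by (simp add: ac_simps)
    finally show ?thesis by simp
  qed
  show ?thesis
  proof (rule has_op_derivI[where r=t and C="2*c*C*c + 2*c*C*c*C*c"])
    show "(\<lambda>f. - R z (D (R z f))) \<in> ops"
      using cscale_in_ops[OF comp_in_ops[OF Rz(2) comp_in_ops[OF D Rz(2)]], of "-1"]
      by (simp add: minus_eq_cscale[symmetric])
    fix w f assume w: "w \<in> ball z t" and f: "f \<in> V"
    have wr: "w \<in> ball z r" using w t by blast
    let ?h = "w - z"
    define g where "g = R z f"
    have g: "g \<in> V" "N g \<le> c * N f" unfolding g_def using ops_mem[OF Rz(2) f] c(2)[OF f] by auto
    have Dg: "D g \<in> V" "N (D g) \<le> C * (c * N f)"
      using ops_mem[OF D g(1)] order_trans[OF C(7)[OF g(1)] mult_left_mono[OF g(2) C(1)]] by auto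
    \<comment> \<open>\<open>q\<close> is the remainder of \<open>F\<close> at \<open>g\<close>; \<open>p\<close> is an increment of \<open>F\<close>, and comes with another factor \<open>w - z\<close>.\<close>
    define q where "q = F w g - F z g - ?h *\<^sub>C D g"
    define p where "p = F w (R z (D g)) - F z (R z (D g))"
    have RD: "R z (D g) \<in> V" using ops_mem[OF Rz(2) Dg(1)] .
    have q: "q \<in> V" unfolding q_def by (intro diff_mem cscale_mem g Dg ops_mem[OF Fw[OF w]] ops_mem[OF Fz])
    have p: "p \<in> V" unfolding p_def by (intro diff_mem RD ops_mem[OF Fw[OF w]] ops_mem[OF Fz])
    have Fg: "F w g - F z g \<in> V" by (intro diff_mem g ops_mem[OF Fw[OF w]] ops_mem[OF Fz])
    have eq: "R w f - R z f - ?h *\<^sub>C (- R z (D (R z f))) = ?h *\<^sub>C R w p - R w q"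
    proof -
      have "R w f - R z f = - R w (F w g - F z g)" using diff[OF w f] by (simp add: g_def)
      moreover have "R w q = R w (F w g - F z g) - ?h *\<^sub>C R w (D g)"
        unfolding q_def using Fg Dg by (simp add: ops_diff[OF R[OF w]] ops_cscale[OF R[OF w]] cscale_mem)
      moreover have "R w (D g) - R z (D g) = - R w p" using diff[OF w Dg(1)] by (simp add: p_def)
      ultimately show ?thesis
        by (simp add: g_def cscale_minus_right) (simp add: algebra_simps flip: cscale_add_right cscale_diff_right)
    qed
    have RWP: "N (R w p) \<le> 2 * c * (C * cmod ?h * (c * (C * (c * N f))))"
    proof -
      have "N (R w p) \<le> 2 * c * N p" by (rule Rbound[OF w p])
      also have "N p \<le> C * cmod ?h * N (R z (D g))" unfolding p_def by (rule C(5)[OF wr RD])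
      also have "N (R z (D g)) \<le> c * N (D g)" by (rule c(2)[OF Dg(1)])
      also note Dg(2)
      finally show ?thesis using c(1) C(1) by (simp add: mult_left_mono)
    qed
    have RWQ: "N (R w q) \<le> 2 * c * (C * (cmod ?h)\<^sup>2 * (c * N f))"
    proof -
      have "N (R w q) \<le> 2 * c * N q" by (rule Rbound[OF w q])
      also have "N q \<le> C * (cmod ?h)\<^sup>2 * N g" unfolding q_def by (rule C(6)[OF wr g(1)])
      also note g(2)
      finally show ?thesis using c(1) C(1) by (simp add: mult_left_mono)
    qed
    have "N (?h *\<^sub>C R w p - R w q) \<le> N (?h *\<^sub>C R w p) + N (R w q)"
      by (intro N_triangle_diff cscale_mem ops_mem[OF R[OF w]] p q)
    also have "\<dots> = cmod ?h * N (R w p) + N (R w q)" by (simp add: N_cscale ops_mem[OF R[OF w] p])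
    also have "\<dots> \<le> cmod ?h * (2 * c * (C * cmod ?h * (c * (C * (c * N f))))) + 2 * c * (C * (cmod ?h)\<^sup>2 * (c * N f))"
      using RWP RWQ by (intro add_mono mult_left_mono) auto
    finally show "N (R w f - R z f - ?h *\<^sub>C (- R z (D (R z f))))
        \<le> (2*c*C*c + 2*c*C*c*C*c) * (cmod ?h)\<^sup>2 * N f"
      unfolding eq by (simp add: algebra_simps power2_eq_square)
  qed (use t R in auto)
qed

text \<open>
  \<open>F w = F z (Id - K)\<close> with \<open>K = R0 (F z - F w)\<close>, which has norm at most 1/2 for \<open>w\<close> close to \<open>z\<close>.
\<close>

lemma invertible_nearby:
  assumes F: "has_op_deriv F D z" and inv: "two_sided_inverse (F z) R0"
  obtains s where "0 < s" "\<And>w. w \<in> ball z s \<Longrightarrow> invertible_op V N (F w)"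
proof -
  from F obtain C r where "op_expansion F D z C r" by (rule has_op_derivE)
  note C = op_expansionD[OF this]
  note R0 = two_sided_inverseD[OF inv]
  obtain c where c: "0 \<le> c" "\<And>f. f \<in> V \<Longrightarrow> N (R0 f) \<le> c * N f" using ops_bound[OF R0(2)] by metis
  define t where "t = min r (1 / (2 * (c * C + 1)))"
  have cC: "0 < 2 * (c * C + 1)" using c(1) C(1) by (intro mult_pos_pos add_nonneg_pos) auto
  have t: "0 < t" "ball z t \<subseteq> ball z r" using C cC by (auto simp: t_def)
  show ?thesis
  proof (rule that[OF t(1)])
    fix w assume w: "w \<in> ball z t"
    then have wr: "w \<in> ball z r" using t by blast
    define K where "K = (\<lambda>f. R0 (F z f - F w f))"
    have K: "K \<in> ops" unfolding K_def by (rule comp_in_ops[OF R0(2) diff_in_ops[OF R0(1) C(3)[OF wr]]])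
    have K1: "N (K f) \<le> 1/2 * N f" if f: "f \<in> V" for f
    proof -
      have m: "F z f \<in> V" "F w f \<in> V" using ops_mem[OF R0(1) f] ops_mem[OF C(3)[OF wr] f] .
      have "cmod (w - z) \<le> 1 / (2 * (c * C + 1))"
        using w by (simp add: t_def dist_norm norm_minus_commute)
      then have "c * C * cmod (w - z) \<le> c * C * (1 / (2 * (c * C + 1)))"
        using c(1) C(1) by (intro mult_left_mono) auto
      also have "\<dots> \<le> 1/2" using half_bound[of "c * C"] c(1) C(1) by simp
      finally have small: "c * C * cmod (w - z) \<le> 1/2" .
      have "N (K f) \<le> c * N (F z f - F w f)" unfolding K_def by (intro c(2) diff_mem m)
      also have "\<dots> \<le> c * (C * cmod (w - z) * N f)"
        using C(5)[OF wr f] c(1) N_minus_commute[OF m] by (intro mult_left_mono) auto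
      also have "\<dots> \<le> 1/2 * N f" using mult_right_mono[OF small N_nonneg[OF f]] by (simp add: ac_simps)
      finally show ?thesis .
    qed
    have Kn: "N ((K ^^ n) f) \<le> (1/2)^n * N f" if f: "f \<in> V" for n f
    proof (induction n)
      case (Suc n)
      have "(K ^^ n) f \<in> V" using ops_mem[OF funpow_in_ops[OF K] f] .
      from K1[OF this] Suc show ?case by simp
    qed simp
    obtain S where S: "two_sided_inverse (\<lambda>f. f - K f) S"
      by (rule neumann_series[OF K _ Kn]) auto
    note SD = two_sided_inverseD[OF S]
    have Fw: "F w f = F z (f - K f)" if f: "f \<in> V" for f
      unfolding K_def using f C(3)[OF wr]
      by (simp add: ops_diff[OF R0(1)] ops_mem[OF R0(1)] ops_mem[OF R0(2)] R0(3) diff_mem ops_mem[OF C(3)[OF wr]])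
    have "two_sided_inverse (F w) (\<lambda>f. S (R0 f))"
      unfolding two_sided_inverse_def
    proof (intro conjI ballI)
      show "F w \<in> ops" by (rule C(3)[OF wr])
      show "(\<lambda>f. S (R0 f)) \<in> ops" by (rule comp_in_ops[OF SD(2) R0(2)])
      fix f assume f: "f \<in> V"
      show "F w (S (R0 f)) = f"
        using f by (simp add: Fw SD(3) ops_mem[OF SD(2)] ops_mem[OF R0(2)] R0(3))
      show "S (R0 (F w f)) = f"
        using f by (simp add: Fw SD(4) R0(4) diff_mem ops_mem[OF K])
    qed
    then show "invertible_op V N (F w)" by (rule two_sided_inverse_imp_invertible)
  qed
qed

lemma dual_spaceD:
  assumes "\<phi> \<in> dual_space V N"
  shows "f \<in> V \<Longrightarrow> g \<in> V \<Longrightarrow> \<phi> (f + g) = \<phi> f + \<phi> g"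
    and "f \<in> V \<Longrightarrow> g \<in> V \<Longrightarrow> \<phi> (f - g) = \<phi> f - \<phi> g"
    and "f \<in> V \<Longrightarrow> \<phi> (c *\<^sub>C f) = c * \<phi> f"
    and "\<phi> 0 = 0"
proof -
  have add: "\<phi> (f + g) = \<phi> f + \<phi> g" if "f \<in> V" "g \<in> V" for f g
    using assms that unfolding bounded_maps_def by blast
  have sc: "\<phi> (c *\<^sub>C f) = c * \<phi> f" if "f \<in> V" for f c
    using assms that unfolding bounded_maps_def cscale_complex_def by blast
  show "f \<in> V \<Longrightarrow> g \<in> V \<Longrightarrow> \<phi> (f + g) = \<phi> f + \<phi> g" by (rule add)
  show "f \<in> V \<Longrightarrow> \<phi> (c *\<^sub>C f) = c * \<phi> f" by (rule sc)
  show "f \<in> V \<Longrightarrow> g \<in> V \<Longrightarrow> \<phi> (f - g) = \<phi> f - \<phi> g"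
    using add[of f "-g"] sc[of g "-1"] uminus_mem[of g] by (simp add: minus_eq_cscale[symmetric])
  show "\<phi> 0 = 0" using sc[OF zero_mem, of 0] by simp
qed

lemma has_op_deriv_functional:
  assumes R: "has_op_deriv R D z" and \<phi>: "\<phi> \<in> dual_space V N" and e: "e \<in> V"
  shows "((\<lambda>w. \<phi> (R w e)) has_field_derivative \<phi> (D e)) (at z)"
proof -
  from R obtain C r where "op_expansion R D z C r" by (rule has_op_derivE)
  note C = op_expansionD[OF this]
  have D: "D \<in> ops" using has_op_deriv_mem[OF R] by simp
  obtain b0 where b0: "\<And>f. f \<in> V \<Longrightarrow> cmod (\<phi> f) \<le> b0 * N f"
    using \<phi> unfolding bounded_maps_def by blast
  define b where "b = max b0 0"
  have b: "cmod (\<phi> f) \<le> b * N f" if "f \<in> V" for f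
    using b0[OF that] mult_right_mono[OF _ N_nonneg[OF that], of b0 b] by (simp add: b_def)
  have bound: "cmod ((\<phi> (R w e) - \<phi> (R z e)) / (w - z) - \<phi> (D e)) \<le> b * C * N e * cmod (w - z)"
    if w: "w \<in> ball z r" "w \<noteq> z" for w
  proof -
    have Rw: "R w e \<in> V" and Rz: "R z e \<in> V" and De: "D e \<in> V"
      using ops_mem[OF C(3)[OF w(1)] e] ops_mem[OF has_op_deriv_mem(2)[OF R] e] ops_mem[OF D e] .
    have "\<phi> (R w e) - \<phi> (R z e) - (w - z) * \<phi> (D e) = \<phi> (R w e - R z e - (w - z) *\<^sub>C D e)"
      using Rw Rz De by (simp add: dual_spaceD[OF \<phi>] diff_mem cscale_mem)
    also have "cmod \<dots> \<le> b * (C * (cmod (w - z))\<^sup>2 * N e)"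
      using b[of "R w e - R z e - (w - z) *\<^sub>C D e"] C(6)[OF w(1) e] Rw Rz De
      by (smt (verit, best) b_def cscale_mem diff_mem mult_left_mono)
    finally have *: "cmod (\<phi> (R w e) - \<phi> (R z e) - (w - z) * \<phi> (D e)) \<le> b * (C * (cmod (w - z))\<^sup>2 * N e)" .
    have "(\<phi> (R w e) - \<phi> (R z e)) / (w - z) - \<phi> (D e) = (\<phi> (R w e) - \<phi> (R z e) - (w - z) * \<phi> (D e)) / (w - z)"
      using w(2) by (simp add: field_simps)
    then show ?thesis using * w(2)
      by (simp add: norm_divide divide_le_eq power2_eq_square ac_simps)
  qed
  have "((\<lambda>w. (\<phi> (R w e) - \<phi> (R z e)) / (w - z)) \<longlongrightarrow> \<phi> (D e)) (at z)"
  proof (rule Lim_transform_bound[of _ "\<lambda>w. b * C * N e * cmod (w - z)", THEN Lim_null[THEN iffD2]])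
    show "\<forall>\<^sub>F w in at z. cmod ((\<phi> (R w e) - \<phi> (R z e)) / (w - z) - \<phi> (D e))
        \<le> norm (b * C * N e * cmod (w - z))"
      unfolding eventually_at using C(2) bound by (intro exI[of _ r]) (force simp: dist_commute)
    show "((\<lambda>w. b * C * N e * cmod (w - z)) \<longlongrightarrow> 0) (at z)"
      by (auto intro!: tendsto_eq_intros)
  qed
  then show ?thesis by (simp add: DERIV_def has_field_derivative_iff)
qed

lemma map_norm_bounds:
  assumes T: "\<And>f. f \<in> V \<Longrightarrow> T f \<in> V" and B: "\<And>f. f \<in> V \<Longrightarrow> N (T f) \<le> B * N f" "0 \<le> B"
  shows "0 \<le> map_norm V N N T" "map_norm V N N T \<le> B"
proof -
  have le: "N (T f) \<le> B" if "f \<in> {f\<in>V. N f \<le> 1}" for f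
    using B that mult_left_le[of "N f" B] by (auto intro: order_trans)
  have "N (T 0) \<le> map_norm V N N T" unfolding map_norm_def
    by (rule cSUP_upper) (auto simp: zero_mem intro!: bdd_aboveI2 le)
  then show "0 \<le> map_norm V N N T" using N_nonneg[OF T[OF zero_mem]] by linarith
  show "map_norm V N N T \<le> B" unfolding map_norm_def
    using zero_mem le by (intro cSUP_least) force+
qed

lemma has_op_deriv_imp_holomorphic_into:
  assumes "\<And>z. z \<in> U \<Longrightarrow> \<exists>D. has_op_deriv F D z"
  shows "holomorphic_into ops (map_norm V N N) F U"
  unfolding holomorphic_into_def
proof (intro ballI conjI)
  fix z assume "z \<in> U"
  with assms obtain D where D: "has_op_deriv F D z" by blast
  show "F z \<in> ops" using has_op_deriv_mem[OF D] by simp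
  from D obtain C r where "op_expansion F D z C r" by (rule has_op_derivE)
  note C = op_expansionD[OF this]
  have Dops: "D \<in> ops" and Fz: "F z \<in> ops" using has_op_deriv_mem[OF D] .
  let ?T = "\<lambda>w. (1 / (w - z)) *\<^sub>C (F w - F z) - D"
  have bounds: "0 \<le> map_norm V N N (?T w)" "map_norm V N N (?T w) \<le> C * cmod (w - z)"
    if w: "w \<in> ball z r" "w \<noteq> z" for w
  proof -
    have V: "?T w f \<in> V" if "f \<in> V" for f
      unfolding cscale_fun_def using that
      by (simp add: fun_diff_def diff_mem cscale_mem ops_mem[OF C(3)[OF w(1)]] ops_mem[OF Fz] ops_mem[OF Dops])
    have "N (?T w f) \<le> C * cmod (w - z) * N f" if f: "f \<in> V" for f
    proof -
      have "?T w f = (1 / (w - z)) *\<^sub>C (F w f - F z f - (w - z) *\<^sub>C D f)"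
        using w(2) by (simp add: cscale_fun_def cscale_diff_right cscale_cscale cscale_one)
      also have "N \<dots> = cmod (1 / (w - z)) * N (F w f - F z f - (w - z) *\<^sub>C D f)"
        using f by (intro N_cscale diff_mem cscale_mem ops_mem[OF C(3)[OF w(1)]] ops_mem[OF Fz] ops_mem[OF Dops])
      also have "\<dots> \<le> cmod (1 / (w - z)) * (C * (cmod (w - z))\<^sup>2 * N f)"
        using C(6)[OF w(1) f] by (intro mult_left_mono) auto
      also have "\<dots> = C * cmod (w - z) * N f" using w(2) by (simp add: norm_divide power2_eq_square)
      finally show ?thesis .
    qed
    then show "0 \<le> map_norm V N N (?T w)" "map_norm V N N (?T w) \<le> C * cmod (w - z)"
      using map_norm_bounds[of "?T w" "C * cmod (w - z)", OF V] C(1) by auto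
  qed
  have "((\<lambda>w. map_norm V N N (?T w)) \<longlongrightarrow> 0) (at z)"
  proof (rule tendsto_sandwich[OF _ _ tendsto_const])
    show "\<forall>\<^sub>F w in at z. 0 \<le> map_norm V N N (?T w)"
      unfolding eventually_at using C(2) bounds by (intro exI[of _ r]) (auto simp: dist_commute)
    show "\<forall>\<^sub>F w in at z. map_norm V N N (?T w) \<le> C * cmod (w - z)"
      unfolding eventually_at using C(2) bounds by (intro exI[of _ r]) (auto simp: dist_commute)
    show "((\<lambda>w. C * cmod (w - z)) \<longlongrightarrow> 0) (at z)" by (auto intro!: tendsto_eq_intros)
  qed
  then show "\<exists>D\<in>ops. ((\<lambda>w. map_norm V N N ((1 / (w - z)) *\<^sub>C (F w - F z) - D)) \<longlongrightarrow> 0) (at z)"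
    using Dops by blast
qed

end

section \<open>A criterion for simple poles of the resolvent\<close>

text \<open>
  The derivative of \<open>T ^^ n\<close> when \<open>T\<close> moves with velocity \<open>D\<close>. It is unfolded from the left so that each
  summand is built from \<open>T\<close> and \<open>D\<close> alone, which keeps positivity visible.
\<close>

fun power_deriv :: "('v \<Rightarrow> 'v) \<Rightarrow> ('v \<Rightarrow> 'v) \<Rightarrow> nat \<Rightarrow> 'v \<Rightarrow> 'v::ab_group_add" where
  "power_deriv T D 0 f = 0"
| "power_deriv T D (Suc n) f = D ((T ^^ n) f) + T (power_deriv T D n f)"

definition power_average :: "nat \<Rightarrow> ('v \<Rightarrow> 'v) \<Rightarrow> 'v \<Rightarrow> 'v::complex_space" where
  "power_average m T f = (1 / of_nat m) *\<^sub>C (\<Sum>k<m. (T ^^ Suc k) f)"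

text \<open>
  The operator \<open>p(T)\<close> of the factorization \<open>Id - (T + ... + T^m) / m = (Id - T) p(T)\<close>.
\<close>

definition power_cofactor :: "nat \<Rightarrow> ('v \<Rightarrow> 'v) \<Rightarrow> 'v \<Rightarrow> 'v::complex_space" where
  "power_cofactor m T f = (1 / of_nat m) *\<^sub>C (\<Sum>k<m. \<Sum>j<Suc k. (T ^^ j) f)"

context carrier_banach
begin

lemma rank_one_in_ops:
  assumes \<phi>: "\<phi> \<in> dual_space V N" and e: "e \<in> V"
  shows "(\<lambda>f. \<phi> f *\<^sub>C e) \<in> ops"
proof -
  obtain b where b: "\<And>f. f \<in> V \<Longrightarrow> cmod (\<phi> f) \<le> b * N f"
    using \<phi> unfolding bounded_maps_def by blast
  show ?thesis
  proof (rule opsI[where C="b * N e"])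
    fix f assume f: "f \<in> V"
    have "N (\<phi> f *\<^sub>C e) = cmod (\<phi> f) * N e" using e by (rule N_cscale)
    also have "\<dots> \<le> b * N f * N e" using b[OF f] N_nonneg[OF e] by (rule mult_right_mono)
    finally show "N (\<phi> f *\<^sub>C e) \<le> b * N e * N f" by (simp add: ac_simps)
  qed (use e dual_spaceD[OF \<phi>] in \<open>auto simp: cscale_mem cscale_algebra\<close>)
qed

lemma power_average_in_ops: "T \<in> ops \<Longrightarrow> power_average m T \<in> ops"
  unfolding power_average_def
  by (intro cscale_in_ops sum_in_ops funpow_in_ops)

lemma power_cofactor_in_ops: "T \<in> ops \<Longrightarrow> power_cofactor m T \<in> ops"
  unfolding power_cofactor_def
  by (intro cscale_in_ops sum_in_ops funpow_in_ops)

lemma power_cofactor_identity: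
  assumes T: "T \<in> ops" and f: "f \<in> V" and m: "0 < m"
  shows "power_cofactor m T (f - T f) = f - power_average m T f"
    and "power_cofactor m T f - T (power_cofactor m T f) = f - power_average m T f"
proof -
  have Tn: "(T ^^ n) f \<in> V" for n using ops_mem[OF funpow_in_ops[OF T] f] .
  have telescope: "(\<Sum>j<n. (T ^^ j) f) - (\<Sum>j<n. T ((T ^^ j) f)) = f - (T ^^ n) f" for n
    by (induction n) (simp_all add: algebra_simps)
  have avg: "(1 / of_nat m) *\<^sub>C (\<Sum>k<m. f - (T ^^ Suc k) f) = f - power_average m T f"
  proof -
    have "(1 / of_nat m) *\<^sub>C (\<Sum>k<m. f) = f"
    proof -
      have "(\<Sum>k<m. f) = (\<Sum>k<m. 1) *\<^sub>C f" unfolding cscale_sum_left by (simp add: cscale_one)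
      then show ?thesis using m by (simp add: cscale_cscale cscale_one)
    qed
    then show ?thesis by (simp add: sum_subtractf cscale_diff_right power_average_def)
  qed
  have "power_cofactor m T (f - T f)
      = (1 / of_nat m) *\<^sub>C (\<Sum>k<m. (\<Sum>j<Suc k. (T ^^ j) f) - (\<Sum>j<Suc k. T ((T ^^ j) f)))"
    unfolding power_cofactor_def using f
    by (simp only: ops_diff[OF funpow_in_ops[OF T] f ops_mem[OF T f]] sum_subtractf funpow_swap1)
  then show "power_cofactor m T (f - T f) = f - power_average m T f"
    unfolding telescope avg .
  have "T (power_cofactor m T f) = (1 / of_nat m) *\<^sub>C (\<Sum>k<m. \<Sum>j<Suc k. T ((T ^^ j) f))"
    unfolding power_cofactor_def
    by (simp only: ops_cscale[OF T sum_mem[OF sum_mem[OF Tn]]] ops_sum[OF T sum_mem[OF Tn]] ops_sum[OF T Tn])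
  then have "power_cofactor m T f - T (power_cofactor m T f)
      = (1 / of_nat m) *\<^sub>C (\<Sum>k<m. (\<Sum>j<Suc k. (T ^^ j) f) - (\<Sum>j<Suc k. T ((T ^^ j) f)))"
    unfolding power_cofactor_def by (simp only: cscale_diff_right sum_subtractf)
  then show "power_cofactor m T f - T (power_cofactor m T f) = f - power_average m T f"
    unfolding telescope avg .
qed

lemma has_op_deriv_power:
  assumes "has_op_deriv L D z"
  shows "has_op_deriv (\<lambda>w. L w ^^ n) (power_deriv (L z) D n) z"
proof (induction n)
  case 0
  have "power_deriv (L z) D 0 = (\<lambda>f. 0)" by auto
  then show ?case using has_op_deriv_const[OF id_in_ops] by (simp add: id_def)
next
  case (Suc n)
  have "(\<lambda>w. L w ^^ Suc n) = (\<lambda>w f. L w ((L w ^^ n) f))" by (simp add: o_def)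
  moreover have "power_deriv (L z) D (Suc n) = (\<lambda>f. D ((L z ^^ n) f) + L z (power_deriv (L z) D n f))"
    by auto
  ultimately show ?case using has_op_deriv_comp[OF assms Suc] by simp
qed

lemma has_op_deriv_power_average:
  assumes "has_op_deriv L D z"
  shows "has_op_deriv (\<lambda>w. power_average m (L w))
     (\<lambda>f. (1 / of_nat m) *\<^sub>C (\<Sum>k<m. power_deriv (L z) D (Suc k) f)) z"
  unfolding power_average_def
  by (intro has_op_deriv_cmult has_op_deriv_sum has_op_deriv_power assms)

lemma has_op_deriv_power_cofactor:
  assumes "has_op_deriv L D z"
  shows "\<exists>E. has_op_deriv (\<lambda>w. power_cofactor m (L w)) E z"
  unfolding power_cofactor_def
  by (rule exI) (rule has_op_deriv_cmult[OF has_op_deriv_sum[OF has_op_deriv_sum[OF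
        has_op_deriv_power[OF assms]]]])

text \<open>
  The Sherman-Morrison formula: removing the rank one part from the invertible operator
  \<open>Id - Q + \<phi>(.) e\<close> preserves invertibility unless the scalar \<open>1 - \<phi>(R e)\<close> vanishes.
\<close>

lemma rank_one_resolvent:
  assumes Q: "Q \<in> ops" and \<phi>: "\<phi> \<in> dual_space V N" and e: "e \<in> V"
    and R: "two_sided_inverse (\<lambda>f. f - Q f + \<phi> f *\<^sub>C e) R" and d: "\<phi> (R e) \<noteq> 1"
  shows "two_sided_inverse (\<lambda>f. f - Q f) (\<lambda>f. R f + (\<phi> (R f) / (1 - \<phi> (R e))) *\<^sub>C R e)"
proof -
  note R = two_sided_inverseD[OF R] and \<phi>p = dual_spaceD[OF \<phi>]
  define S where "S = (\<lambda>f. R f + (\<phi> (R f) / (1 - \<phi> (R e))) *\<^sub>C R e)"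
  have Re: "R e \<in> V" using ops_mem[OF R(2) e] .
  have Rf: "R f \<in> V" if "f \<in> V" for f using ops_mem[OF R(2) that] .
  have S_ops: "S \<in> ops"
  proof -
    have eq: "S = (\<lambda>f. R f + (1 / (1 - \<phi> (R e))) *\<^sub>C R (\<phi> (R f) *\<^sub>C e))"
      unfolding S_def using e by (simp add: ops_cscale[OF R(2)] cscale_cscale)
    show ?thesis unfolding eq
      by (rule add_in_ops[OF R(2) cscale_in_ops[OF comp_in_ops[OF R(2)
            comp_in_ops[OF rank_one_in_ops[OF \<phi> e] R(2)]]]])
  qed
  have idQ: "(\<lambda>f. f - Q f) \<in> ops" by (rule diff_in_ops[OF id_in_ops Q])
  have D: "g - Q g = f - \<phi> g *\<^sub>C e" if "f \<in> V" "g = R f" for f g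
    using R(3)[OF that(1)] that(2) by (simp add: algebra_simps)
  have right: "S f - Q (S f) = f" if f: "f \<in> V" for f
  proof -
    let ?c = "\<phi> (R f) / (1 - \<phi> (R e))"
    have "S f - Q (S f) = (R f - Q (R f)) + ?c *\<^sub>C (R e - Q (R e))"
      unfolding S_def using Rf[OF f] Re
      by (simp add: ops_add[OF Q] ops_cscale[OF Q] cscale_mem cscale_algebra)
    also have "\<dots> = (f - \<phi> (R f) *\<^sub>C e) + ?c *\<^sub>C (e - \<phi> (R e) *\<^sub>C e)"
      using D[OF f refl] D[OF e refl] by simp
    also have "e - \<phi> (R e) *\<^sub>C e = (1 - \<phi> (R e)) *\<^sub>C e"
      by (simp add: cscale_diff_left cscale_one)
    also have "f - \<phi> (R f) *\<^sub>C e + ?c *\<^sub>C (1 - \<phi> (R e)) *\<^sub>C e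
        = f + (?c * (1 - \<phi> (R e)) - \<phi> (R f)) *\<^sub>C e"
      by (simp only: cscale_cscale cscale_diff_left[of "?c * (1 - \<phi> (R e))"] add_diff_eq diff_add_eq)
    also have "\<dots> = f" using d by simp
    finally show ?thesis .
  qed
  have inj: "g = 0" if g: "g \<in> V" and 0: "g - Q g = 0" for g
  proof -
    have "R (g - Q g + \<phi> g *\<^sub>C e) = g" using R(4)[OF g] .
    then have g_eq: "\<phi> g *\<^sub>C R e = g" using 0 e by (simp add: ops_cscale[OF R(2)])
    then have "\<phi> g = \<phi> g * \<phi> (R e)" using \<phi>p(3)[OF Re, of "\<phi> g"] by simp
    then have "\<phi> g = 0" using d by simp
    then show "g = 0" using g_eq by simp
  qed
  have left: "S (f - Q f) = f" if f: "f \<in> V" for f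
  proof -
    have m: "f - Q f \<in> V" using ops_mem[OF idQ f] .
    have SV: "S (f - Q f) \<in> V" using ops_mem[OF S_ops m] .
    have "S (f - Q f) - f - Q (S (f - Q f) - f) = 0"
      using right[OF m] SV f by (simp add: ops_diff[OF Q]) (simp add: algebra_simps)
    then show ?thesis using inj[of "S (f - Q f) - f"] SV f by (simp add: diff_mem)
  qed
  show ?thesis using S_ops idQ right left unfolding S_def two_sided_inverse_def by blast
qed

text \<open>
  Since \<open>p(T)\<close> commutes with \<open>Id - T\<close>, the factorization of \<open>Id - Q\<close> gives a right inverse of
  \<open>Id - T\<close> and, read in the other order, injectivity of \<open>Id - T\<close>.
\<close>

lemma resolvent_from_power_average:
  assumes T: "T \<in> ops" and m: "0 < m" and S: "two_sided_inverse (\<lambda>f. f - power_average m T f) S"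
  shows "two_sided_inverse (\<lambda>f. f - T f) (\<lambda>f. power_cofactor m T (S f))"
proof -
  note S = two_sided_inverseD[OF S]
  note p = power_cofactor_in_ops[OF T, of m]
  have idT: "(\<lambda>f. f - T f) \<in> ops" by (rule diff_in_ops[OF id_in_ops T])
  have right: "power_cofactor m T (S f) - T (power_cofactor m T (S f)) = f" if f: "f \<in> V" for f
    using power_cofactor_identity(2)[OF T ops_mem[OF S(2) f] m] S(3)[OF f] by simp
  have inj: "g = 0" if g: "g \<in> V" and 0: "g - T g = 0" for g
    using power_cofactor_identity(1)[OF T g m] 0 ops_zero[OF p] S(4)[OF g] ops_zero[OF S(2)] by simp
  have left: "power_cofactor m T (S (f - T f)) = f" if f: "f \<in> V" for f
  proof -
    have mem: "f - T f \<in> V" using ops_mem[OF idT f] .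
    have gV: "power_cofactor m T (S (f - T f)) \<in> V" using ops_mem[OF p ops_mem[OF S(2) mem]] .
    let ?g = "power_cofactor m T (S (f - T f)) - f"
    have "?g - T ?g = 0"
      using right[OF mem] gV f by (simp add: ops_diff[OF T]) (simp add: algebra_simps)
    then show ?thesis using inj[of ?g] gV f by (simp add: diff_mem)
  qed
  show ?thesis unfolding two_sided_inverse_def
    using idT comp_in_ops[OF p S(2)] right left by blast
qed

text \<open>
  The mechanism of the pole. Let \<open>F z = Id - Q z + \<phi>(.) e\<close>, with \<open>Q z\<close> the average of the first \<open>m\<close> powers of \<open>L z\<close>,
  and let \<open>R z\<close> be its inverse, holomorphic near \<open>z0\<close>. The resolvent of \<open>L z\<close> is
  \<open>p(L z) (R z f + (\<phi>(R z f) / d z) R z e)\<close> with \<open>d z = 1 - \<phi>(R z e)\<close>. The hypothesis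
  \<open>\<phi>(R0 e) = 1\<close> says \<open>d z0 = 0\<close>, and the transversality hypothesis says \<open>deriv d z0 \<noteq> 0\<close>, because
  the derivative of \<open>R\<close> at \<open>z0\<close> is \<open>R0 Q' R0\<close>. The residue maps \<open>e\<close> to a nonzero multiple of
  \<open>p(L z0) (R0 e)\<close>, whence the last hypothesis.
\<close>

theorem simple_pole_of_resolvent:
  fixes L D :: "complex \<Rightarrow> 'v \<Rightarrow> 'v"
  assumes r: "0 < r" and L: "\<And>z. z \<in> ball z0 r \<Longrightarrow> has_op_deriv L (D z) z"
    and m: "0 < m" and \<phi>: "\<phi> \<in> dual_space V N" and e: "e \<in> V"
    and R0: "two_sided_inverse (\<lambda>f. f - power_average m (L z0) f + \<phi> f *\<^sub>C e) R0"
    and one: "\<phi> (R0 e) = 1"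
    and transversal: "\<phi> (R0 ((1 / of_nat m) *\<^sub>C (\<Sum>k<m. power_deriv (L z0) (D z0) (Suc k) (R0 e)))) \<noteq> 0"
    and nonzero: "power_cofactor m (L z0) (R0 e) \<noteq> 0"
  shows "\<forall>\<^sub>F z in at z0. invertible_op V N (\<lambda>f. f - L z f)"
    and "simple_pole_op V N (\<lambda>z. inv_into V (\<lambda>f. f - L z f)) z0"
proof -
  note \<phi>p = dual_spaceD[OF \<phi>]
  define Q where "Q z = power_average m (L z)" for z
  define Q' where "Q' z = (\<lambda>f. (1 / of_nat m) *\<^sub>C (\<Sum>k<m. power_deriv (L z) (D z) (Suc k) f))" for z
  define F where "F z = (\<lambda>f. f - Q z f + \<phi> f *\<^sub>C e)" for z
  define R where "R z = inv_into V (F z)" for z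
  have Lops: "L z \<in> ops" if "z \<in> ball z0 r" for z using has_op_deriv_mem(2)[OF L[OF that]] .
  have Q_deriv: "has_op_deriv Q (Q' z) z" if "z \<in> ball z0 r" for z
    unfolding Q_def Q'_def by (rule has_op_deriv_power_average[OF L[OF that]])
  have F_deriv: "has_op_deriv F (\<lambda>f. - Q' z f) z" if z: "z \<in> ball z0 r" for z
  proof -
    have "has_op_deriv (\<lambda>w f. (f + (-1) *\<^sub>C Q w f) + \<phi> f *\<^sub>C e) (\<lambda>f. (0 + (-1) *\<^sub>C Q' z f) + 0) z"
      by (rule has_op_deriv_add[OF has_op_deriv_add[OF has_op_deriv_const[OF id_in_ops]
            has_op_deriv_cmult[OF Q_deriv[OF z]]] has_op_deriv_const[OF rank_one_in_ops[OF \<phi> e]]])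
    then show ?thesis by (simp add: F_def[abs_def] cscale_minus_left cscale_one)
  qed
  have z0: "z0 \<in> ball z0 r" using r by simp
  have R0': "two_sided_inverse (F z0) R0" using R0 by (simp add: F_def Q_def)
  obtain s0 where s0: "0 < s0" "\<And>w. w \<in> ball z0 s0 \<Longrightarrow> invertible_op V N (F w)"
    by (rule invertible_nearby[OF F_deriv[OF z0] R0']) blast
  define s1 where "s1 = min s0 r"
  have s1: "0 < s1" "ball z0 s1 \<subseteq> ball z0 r" "ball z0 s1 \<subseteq> ball z0 s0" using s0 r by (auto simp: s1_def)
  have R: "two_sided_inverse (F w) (R w)" if "w \<in> ball z0 s1" for w
    unfolding R_def using that s0 s1 by (intro invertible_op_imp_two_sided_inverse) blast
  have R_R0: "R z0 f = R0 f" if "f \<in> V" for f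
    unfolding R_def using two_sided_inverse_imp_invertible(2)[OF R0' that] .
  have R_deriv: "has_op_deriv R (\<lambda>f. - R z (- Q' z (R z f))) z" if z: "z \<in> ball z0 s1" for z
  proof -
    obtain t where t: "0 < t" "ball z t \<subseteq> ball z0 s1" using z open_contains_ball open_ball by blast
    show ?thesis
      using z s1 t by (intro has_op_deriv_inverse[OF F_deriv t(1) R]) auto
  qed
  have z01: "z0 \<in> ball z0 s1" using s1 by simp
  define d where "d z = 1 - \<phi> (R z e)" for z
  have d_deriv: "(d has_field_derivative - \<phi> (- R z (- Q' z (R z e)))) (at z)" if z: "z \<in> ball z0 s1" for z
    unfolding d_def[abs_def]
    by (rule derivative_eq_intros has_op_deriv_functional[OF R_deriv[OF z] \<phi> e] refl)+ simp
  have d_hol: "d holomorphic_on ball z0 s1"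
    unfolding holomorphic_on_open[OF open_ball] using d_deriv by blast
  have Q'_ops: "Q' z0 \<in> ops" using has_op_deriv_mem(1)[OF Q_deriv[OF z0]] .
  note R0D = two_sided_inverseD[OF R0']
  have d0: "d z0 = 0" by (simp add: d_def R_R0[OF e] one)
  have d0': "deriv d z0 \<noteq> 0"
  proof -
    have mem: "Q' z0 (R0 e) \<in> V" using ops_mem[OF Q'_ops ops_mem[OF R0D(2) e]] .
    have "- R z0 (- Q' z0 (R z0 e)) = R0 (Q' z0 (R0 e))"
      using ops_diff[OF R0D(2) zero_mem mem]
      by (simp add: R_R0 e mem uminus_mem ops_zero[OF R0D(2)])
    moreover have "\<phi> (R0 (Q' z0 (R0 e))) \<noteq> 0" using transversal by (simp add: Q'_def)
    ultimately show ?thesis using DERIV_imp_deriv[OF d_deriv[OF z01]] by simp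
  qed
  \<comment> \<open>\<open>d\<close> has a simple zero at \<open>z0\<close>; \<open>k\<close> is the nonvanishing cofactor of \<open>z - z0\<close>.\<close>
  define k where "k = (\<lambda>z. if z = z0 then deriv d z0 else (d z - d z0) / (z - z0))"
  have k_hol: "k holomorphic_on ball z0 s1"
    unfolding k_def by (rule pole_lemma_open[OF d_hol open_ball])
  have k0: "k z0 \<noteq> 0" using d0' by (simp add: k_def)
  have dk: "d z = (z - z0) * k z" for z by (simp add: k_def d0)
  obtain s2 where s2: "0 < s2" "\<And>z. z \<in> ball z0 s2 \<Longrightarrow> k z \<noteq> 0"
  proof -
    have "isCont k z0" using k_hol z01
      by (meson holomorphic_on_imp_continuous_on continuous_on_eq_continuous_at open_ball)
    from continuous_at_avoid[OF this k0] obtain s2 where "0 < s2" "\<forall>y. dist z0 y < s2 \<longrightarrow> k y \<noteq> 0" by blast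
    then show ?thesis using that[of s2] by (simp add: dist_commute)
  qed
  define s where "s = min s1 s2"
  have s: "0 < s" "ball z0 s \<subseteq> ball z0 s1" "ball z0 s \<subseteq> ball z0 s2" using s1 s2 by (auto simp: s_def)
  define p where "p z = power_cofactor m (L z)" for z
  define S where "S z = (\<lambda>f. R z f + (\<phi> (R z f) / (1 - \<phi> (R z e))) *\<^sub>C R z e)" for z
  have resolvent: "two_sided_inverse (\<lambda>f. f - L z f) (\<lambda>f. p z (S z f))" if z: "z \<in> ball z0 s - {z0}" for z
  proof -
    have zs: "z \<in> ball z0 s1" "z \<in> ball z0 s2" "z \<in> ball z0 r" using z s s1 by blast+
    have "\<phi> (R z e) \<noteq> 1" using dk[of z] s2(2)[OF zs(2)] z by (auto simp: d_def)
    then show ?thesis unfolding p_def S_def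
      using resolvent_from_power_average[OF Lops[OF zs(3)] m]
        rank_one_resolvent[OF power_average_in_ops[OF Lops[OF zs(3)]] \<phi> e] R[OF zs(1)]
      by (simp add: F_def Q_def)
  qed
  define G where "G z = (\<lambda>f. p z ((z - z0) *\<^sub>C R z f + (1 / k z) *\<^sub>C R z (\<phi> (R z f) *\<^sub>C e)))" for z
  have G_deriv: "\<exists>E. has_op_deriv G E z" if z: "z \<in> ball z0 s" for z
  proof -
    have zs: "z \<in> ball z0 s1" "z \<in> ball z0 s2" "z \<in> ball z0 r" using z s s1 by blast+
    obtain E where p: "has_op_deriv p E z"
      unfolding p_def using has_op_deriv_power_cofactor[OF L[OF zs(3)]] by blast
    have hol1: "(\<lambda>z. z - z0) holomorphic_on ball z0 s" by (intro holomorphic_intros)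
    have hol2: "(\<lambda>z. 1 / k z) holomorphic_on ball z0 s"
      using s s2 holomorphic_on_subset[OF k_hol] by (intro holomorphic_intros) auto
    note c = has_op_deriv_scalar[OF hol1 open_ball z] has_op_deriv_scalar[OF hol2 open_ball z]
    note RPR = has_op_deriv_comp[OF R_deriv[OF zs(1)] has_op_deriv_comp[OF
          has_op_deriv_const[OF rank_one_in_ops[OF \<phi> e]] R_deriv[OF zs(1)]]]
    show ?thesis unfolding G_def[abs_def]
      by (rule exI) (rule has_op_deriv_comp[OF p has_op_deriv_add[OF
            has_op_deriv_comp[OF c(1) R_deriv[OF zs(1)]] has_op_deriv_comp[OF c(2) RPR]]])
  qed
  show inv: "\<forall>\<^sub>F z in at z0. invertible_op V N (\<lambda>f. f - L z f)"
    unfolding eventually_at using s(1) resolvent two_sided_inverse_imp_invertible(1)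
    by (intro exI[of _ s]) (auto simp: dist_commute)
  show "simple_pole_op V N (\<lambda>z. inv_into V (\<lambda>f. f - L z f)) z0"
    unfolding simple_pole_op_def
  proof (intro exI[of _ s] exI[of _ G] conjI ballI)
    show "holomorphic_into ops (map_norm V N N) G (ball z0 s)"
      using G_deriv by (rule has_op_deriv_imp_holomorphic_into)
    have "G z0 e = (1 / k z0) *\<^sub>C power_cofactor m (L z0) (R0 e)"
      unfolding G_def p_def using ops_mem[OF R0D(2) e] e
      by (simp add: R_R0 one cscale_one ops_cscale[OF power_cofactor_in_ops[OF Lops[OF z0]]])
    moreover have "c *\<^sub>C f \<noteq> 0" if "c \<noteq> 0" "f \<noteq> 0" for c and f :: 'v
      using that cscale_cscale[of "1/c" c f] by (auto simp: cscale_one)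
    ultimately have "G z0 e \<noteq> 0" using nonzero k0 by simp
    then show "\<exists>f\<in>V. G z0 f \<noteq> 0" using e by blast
    fix z assume z: "z \<in> ball z0 s - {z0}"
    then show "inv_into V (\<lambda>f. f - L z f) \<in> ops"
      using two_sided_inverse_imp_invertible(1)[OF resolvent[OF z]] by (simp add: invertible_op_def)
    fix f assume f: "f \<in> V"
    have zs: "z \<in> ball z0 s1" "z \<in> ball z0 s2" "z \<in> ball z0 r" using z s s1 by blast+
    note RD = two_sided_inverseD[OF R[OF zs(1)]]
    have kz: "k z \<noteq> 0" using s2 zs by blast
    have inveq: "inv_into V (\<lambda>f. f - L z f) f = p z (S z f)"
      using two_sided_inverse_imp_invertible(2)[OF resolvent[OF z] f] .
    have p_ops: "p z \<in> ops" unfolding p_def by (rule power_cofactor_in_ops[OF Lops[OF zs(3)]])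
    have "S z f \<in> V" unfolding S_def
      using f e by (intro add_mem cscale_mem ops_mem[OF RD(2)])
    then have "(z - z0) *\<^sub>C p z (S z f) = p z ((z - z0) *\<^sub>C S z f)" by (simp add: ops_cscale[OF p_ops])
    also have "(z - z0) *\<^sub>C S z f = (z - z0) *\<^sub>C R z f + (1 / k z) *\<^sub>C R z (\<phi> (R z f) *\<^sub>C e)"
    proof -
      have "(z - z0) * (\<phi> (R z f) / (1 - \<phi> (R z e))) = (1 / k z) * \<phi> (R z f)"
        using dk[of z] z kz by (simp add: d_def)
      then show ?thesis unfolding S_def using e by (simp add: cscale_algebra ops_cscale[OF RD(2)])
    qed
    finally show "(z - z0) *\<^sub>C inv_into V (\<lambda>f. f - L z f) f = G z f"
      unfolding inveq G_def .
  qed (rule s(1))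
qed

text \<open>
  Where \<open>Id - T\<close> is invertible, a normalized eigenpair \<open>h\<close>, \<open>\<phi>\<close> of \<open>T\<close> splits off algebraically: \<open>R\<close> acts on \<open>h\<close>
  as \<open>1 / (1 - c)\<close> and so does \<open>\<phi>\<close> composed with \<open>R\<close>, and the stated operator can be checked
  to be the inverse. The eigenvalue \<open>c\<close> cannot be 1, since \<open>h\<close> would be in the kernel of \<open>Id - T\<close>.
\<close>

lemma resolvent_split:
  assumes T: "T \<in> ops" and R: "two_sided_inverse (\<lambda>f. f - T f) R"
    and \<phi>: "\<phi> \<in> dual_space V N" and h: "h \<in> V"
    and Th: "T h = c *\<^sub>C h" and \<phi>T: "\<And>f. f \<in> V \<Longrightarrow> \<phi> (T f) = c * \<phi> f" and \<phi>h: "\<phi> h = 1"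
  shows "c \<noteq> 1"
    and "two_sided_inverse (\<lambda>f. f - (T f - (c * \<phi> f) *\<^sub>C h)) (\<lambda>f. R f - (c / (1 - c) * \<phi> f) *\<^sub>C h)"
proof -
  note RD = two_sided_inverseD[OF R] and \<phi>p = dual_spaceD[OF \<phi>]
  show c: "c \<noteq> 1"
  proof
    assume "c = 1"
    then have "h - T h = 0" using Th by (simp add: cscale_one)
    then have "h = 0" using RD(4)[OF h] ops_zero[OF RD(2)] by simp
    then show False using \<phi>h \<phi>p(4) by simp
  qed
  have P: "(\<lambda>f. (c * \<phi> f) *\<^sub>C h) \<in> ops" and P': "(\<lambda>f. (c / (1 - c) * \<phi> f) *\<^sub>C h) \<in> ops"
    using cscale_in_ops[OF rank_one_in_ops[OF \<phi> h], of c]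
      cscale_in_ops[OF rank_one_in_ops[OF \<phi> h], of "c / (1 - c)"] by (simp_all add: cscale_cscale)
  have Rh: "R h = (1 / (1 - c)) *\<^sub>C h"
  proof -
    have "h - T h = (1 - c) *\<^sub>C h" using Th by (simp add: cscale_diff_left cscale_one)
    then have "(1 - c) *\<^sub>C R h = h" using RD(4)[OF h] h by (simp add: ops_cscale[OF RD(2)])
    then have "(1 / (1 - c)) *\<^sub>C (1 - c) *\<^sub>C R h = (1 / (1 - c)) *\<^sub>C h" by simp
    then show ?thesis using c by (simp add: cscale_cscale cscale_one)
  qed
  have \<phi>R: "\<phi> (R f) = \<phi> f / (1 - c)" if f: "f \<in> V" for f
  proof -
    have Rf: "R f \<in> V" using ops_mem[OF RD(2) f] .
    have "\<phi> f = \<phi> (R f - T (R f))" using RD(3)[OF f] by simp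
    also have "\<dots> = \<phi> (R f) - c * \<phi> (R f)" using Rf ops_mem[OF T Rf] by (simp add: \<phi>p(2) \<phi>T)
    finally show ?thesis using c by (simp add: field_simps)
  qed
  have num: "c * (x / (1 - c) - c / (1 - c) * x) - c / (1 - c) * x * (1 - c) = 0" for x
    using c by (simp add: divide_simps) (simp add: algebra_simps)
  show "two_sided_inverse (\<lambda>f. f - (T f - (c * \<phi> f) *\<^sub>C h)) (\<lambda>f. R f - (c / (1 - c) * \<phi> f) *\<^sub>C h)"
    unfolding two_sided_inverse_def
  proof (intro conjI ballI)
    show "(\<lambda>f. f - (T f - (c * \<phi> f) *\<^sub>C h)) \<in> ops"
      by (rule diff_in_ops[OF id_in_ops diff_in_ops[OF T P]])
    show "(\<lambda>f. R f - (c / (1 - c) * \<phi> f) *\<^sub>C h) \<in> ops" by (rule diff_in_ops[OF RD(2) P'])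
    fix f assume f: "f \<in> V"
    have Rf: "R f \<in> V" using ops_mem[OF RD(2) f] .
    have Tf: "T f \<in> V" using ops_mem[OF T f] .
    have RT: "R f - T (R f) = f" using RD(3)[OF f] .
    define a where "a = c / (1 - c) * \<phi> f"
    define b where "b = \<phi> f / (1 - c)"
    have "T (R f - a *\<^sub>C h) = T (R f) - (a * c) *\<^sub>C h"
      using Rf h by (simp add: ops_diff[OF T] ops_cscale[OF T] cscale_mem Th cscale_cscale)
    moreover have "\<phi> (R f - a *\<^sub>C h) = b - a"
      using Rf h f by (simp add: \<phi>p cscale_mem \<phi>h \<phi>R b_def)
    moreover have "(y - a * (1 - c)) *\<^sub>C h = y *\<^sub>C h - a *\<^sub>C h + (a * c) *\<^sub>C h" for y
      by (simp add: cscale_algebra algebra_simps)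
    ultimately have "R f - a *\<^sub>C h - (T (R f - a *\<^sub>C h) - (c * \<phi> (R f - a *\<^sub>C h)) *\<^sub>C h)
      = (R f - T (R f)) + (c * (b - a) - a * (1 - c)) *\<^sub>C h"
      by simp
    also have "\<dots> = f" unfolding a_def b_def num RT by simp
    finally show "R f - (c / (1 - c) * \<phi> f) *\<^sub>C h - (T (R f - (c / (1 - c) * \<phi> f) *\<^sub>C h)
        - (c * \<phi> (R f - (c / (1 - c) * \<phi> f) *\<^sub>C h)) *\<^sub>C h) = f"
      unfolding a_def .
    have eq: "f - (T f - (c * \<phi> f) *\<^sub>C h) = (f - T f) + (c * \<phi> f) *\<^sub>C h" by simp
    have "R (f - (T f - (c * \<phi> f) *\<^sub>C h)) = f + (c * \<phi> f) *\<^sub>C (1 / (1 - c)) *\<^sub>C h"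
      unfolding eq using f Tf h by (simp add: ops_add[OF RD(2)] ops_cscale[OF RD(2)] diff_mem cscale_mem RD(4) Rh)
    moreover have "\<phi> (f - (T f - (c * \<phi> f) *\<^sub>C h)) = \<phi> f"
      unfolding eq using f Tf h by (simp add: \<phi>p diff_mem cscale_mem \<phi>h \<phi>T)
    ultimately show "R (f - (T f - (c * \<phi> f) *\<^sub>C h)) - (c / (1 - c) * \<phi> (f - (T f - (c * \<phi> f) *\<^sub>C h))) *\<^sub>C h = f"
      by (simp add: cscale_cscale ac_simps)
  qed
qed

end

section \<open>The Hoelder space and operators given by weights\<close>

definition cons_seq :: "nat \<Rightarrow> seq \<Rightarrow> seq" where
  "cons_seq i x = (\<lambda>n. case n of 0 \<Rightarrow> i | Suc k \<Rightarrow> x k)"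

definition agree :: "nat \<Rightarrow> seq \<Rightarrow> seq \<Rightarrow> bool" where
  "agree n x y \<longleftrightarrow> (\<forall>i<n. x i = y i)"

lemma cons_seq_simps [simp]: "cons_seq i x 0 = i" "cons_seq i x (Suc n) = x n"
  by (simp_all add: cons_seq_def)

lemma shift_cons_seq [simp]: "shift (cons_seq i x) = x"
  by (simp add: shift_def)

lemma cons_seq_shift: "cons_seq (x 0) (shift x) = x"
  by (auto simp: fun_eq_iff cons_seq_def shift_def split: nat.split)

lemma inj_cons_seq: "inj (\<lambda>i. cons_seq i x)"
  by (metis cons_seq_simps(1) injI)

lemma agree_cons_seq [simp]: "agree (Suc n) (cons_seq i x) (cons_seq i y) \<longleftrightarrow> agree n x y"
  by (auto simp: agree_def less_Suc_eq_0_disj)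

lemma agree_sym: "agree n x y \<Longrightarrow> agree n y x"
  by (simp add: agree_def)

lemma agree_head: "agree n x y \<Longrightarrow> 1 \<le> n \<Longrightarrow> x 0 = y 0"
  by (simp add: agree_def)

lemma agree_1_iff: "agree 1 x y \<longleftrightarrow> x 0 = y 0" "agree (Suc 0) x y \<longleftrightarrow> x 0 = y 0"
  by (simp_all add: agree_def)

text \<open>
  The transfer operator with weight \<open>W\<close>, written as a series over the possible first letters. The
  weights below vanish off the shift space, so inadmissible letters contribute 0.
\<close>

definition ker_op :: "(seq \<Rightarrow> 'a::{real_normed_algebra,banach}) \<Rightarrow> (seq \<Rightarrow> 'a) \<Rightarrow> seq \<Rightarrow> 'a" where
  "ker_op W g x = (\<Sum>i. W (cons_seq i x) * g (cons_seq i x))"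

text \<open>
  The mean value estimate on the segment from \<open>p\<close> to \<open>q\<close>, where the modulus of the exponential is at most its
  larger value at the ends because the real part is affine.
\<close>

lemma norm_exp_diff_le: "cmod (exp p - exp q) \<le> cmod (p - q) * (cmod (exp p) + cmod (exp q))"
proof -
  have "cmod (exp p - exp q) \<le> (cmod (exp p) + cmod (exp q)) * cmod (p - q)"
  proof (rule field_differentiable_bound[of "closed_segment p q" exp exp])
    fix u assume "u \<in> closed_segment p q"
    then obtain t where t: "0 \<le> t" "t \<le> 1" and u: "u = (1 - t) *\<^sub>R p + t *\<^sub>R q"
      by (auto simp: in_segment)
    have "(1 - t) * Re p + t * Re q \<le> (1 - t) * max (Re p) (Re q) + t * max (Re p) (Re q)"
      using t by (intro add_mono mult_left_mono) auto
    then have "Re u \<le> max (Re p) (Re q)" by (simp add: u algebra_simps)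
    then have "exp (Re u) \<le> max (exp (Re p)) (exp (Re q))" by (simp add: max_def split: if_splits)
    then show "cmod (exp u) \<le> cmod (exp p) + cmod (exp q)"
      using exp_ge_zero[of "Re p"] exp_ge_zero[of "Re q"] unfolding norm_exp_eq_Re by linarith
  qed (auto intro!: derivative_eq_intros)
  then show ?thesis by (simp add: mult.commute)
qed

locale shift_space =
  fixes I :: "nat set" and A :: "nat \<Rightarrow> nat \<Rightarrow> bool" and \<theta> :: real
  assumes theta: "0 < \<theta>" "\<theta> < 1" and E_nonempty: "E_inf I A \<noteq> {}"
begin

abbreviation E :: "seq set" where "E \<equiv> E_inf I A"
abbreviation V :: "(seq \<Rightarrow> complex) set" where "V \<equiv> Fb_theta I A \<theta>"
abbreviation N :: "(seq \<Rightarrow> complex) \<Rightarrow> real" where "N \<equiv> Fb_norm I A \<theta>"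

lemma cons_in_E: "cons_seq i x \<in> E \<longleftrightarrow> i \<in> I \<and> A i (x 0) \<and> x \<in> E"
proof -
  have all: "(\<forall>j. P j) \<longleftrightarrow> P 0 \<and> (\<forall>j. P (Suc j))" for P :: "nat \<Rightarrow> bool"
    by (metis not0_implies_Suc)
  show ?thesis unfolding E_inf_def mem_Collect_eq
    by (subst all, subst (2) all) (auto simp del: all_simps)
qed

lemma cons_in_E_agree: "agree n x y \<Longrightarrow> 1 \<le> n \<Longrightarrow> x \<in> E \<Longrightarrow> y \<in> E \<Longrightarrow> cons_seq i x \<in> E \<longleftrightarrow> cons_seq i y \<in> E"
  using agree_head[of n x y] by (simp add: cons_in_E)

lemma shift_in_E: "x \<in> E \<Longrightarrow> shift x \<in> E"
  by (simp add: E_inf_def shift_def)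

lemma theta_power: "0 < \<theta> ^ n" "\<theta> ^ n \<le> 1"
  using theta by (auto simp: power_le_one)

text \<open>
  \<open>lip f b\<close> says that the Hoelder seminorm of \<open>f\<close> is at most \<open>b\<close>, in a form free of extended reals.
\<close>

definition lip :: "(seq \<Rightarrow> 'b::real_normed_vector) \<Rightarrow> real \<Rightarrow> bool" where
  "lip f b \<longleftrightarrow> (\<forall>n\<ge>1. \<forall>x\<in>E. \<forall>y\<in>E. agree n x y \<longrightarrow> norm (f x - f y) \<le> b * \<theta> ^ n)"

lemma lipI: "(\<And>n x y. 1 \<le> n \<Longrightarrow> x \<in> E \<Longrightarrow> y \<in> E \<Longrightarrow> agree n x y \<Longrightarrow> norm (f x - f y) \<le> b * \<theta> ^ n) \<Longrightarrow> lip f b"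
  unfolding lip_def by blast

lemma lipD: "lip f b \<Longrightarrow> 1 \<le> n \<Longrightarrow> x \<in> E \<Longrightarrow> y \<in> E \<Longrightarrow> agree n x y \<Longrightarrow> norm (f x - f y) \<le> b * \<theta> ^ n"
  unfolding lip_def by blast

lemma lip_mono: "lip f b \<Longrightarrow> b \<le> c \<Longrightarrow> lip f c"
  unfolding lip_def by (meson less_imp_le mult_right_mono order_trans theta_power(1))

lemma theta_norm_le_iff:
  assumes b: "0 \<le> b"
  shows "theta_norm I A \<theta> f \<le> ennreal b \<longleftrightarrow> lip f b"
proof
  assume L: "theta_norm I A \<theta> f \<le> ennreal b"
  show "lip f b"
  proof (rule lipI)
    fix n :: nat and x y assume n: "1 \<le> n" and xy: "x \<in> E" "y \<in> E" "agree n x y"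
    have "ennreal (norm (f x - f y)) \<le> variation I A n f"
      unfolding variation_def using xy by (intro SUP_upper2[of "(x, y)"]) (auto simp: agree_def)
    then have "ennreal (norm (f x - f y)) / ennreal (\<theta> ^ n) \<le> variation I A n f / ennreal (\<theta> ^ n)"
      by (rule divide_right_mono_ennreal)
    also have "\<dots> \<le> theta_norm I A \<theta> f"
      unfolding theta_norm_def using n by (intro SUP_upper) auto
    also note L
    finally have "norm (f x - f y) / \<theta> ^ n \<le> b"
      using theta_power(1)[of n] b by (simp add: divide_ennreal)
    then show "norm (f x - f y) \<le> b * \<theta> ^ n" using theta_power(1)[of n] by (simp add: pos_divide_le_eq)
  qed
next
  assume L: "lip f b"
  show "theta_norm I A \<theta> f \<le> ennreal b"
    unfolding theta_norm_def
  proof (rule SUP_least)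
    fix n :: nat assume n: "n \<in> {1..}"
    have "variation I A n f \<le> ennreal (b * \<theta> ^ n)"
      unfolding variation_def
    proof (rule SUP_least, clarsimp)
      fix x y assume "x \<in> E" "y \<in> E" "\<forall>i<n. x i = y i"
      then show "ennreal (norm (f x - f y)) \<le> ennreal (b * \<theta> ^ n)"
        using lipD[OF L, of n x y] n by (intro ennreal_leI) (auto simp: agree_def)
    qed
    then show "variation I A n f / ennreal (\<theta> ^ n) \<le> ennreal b"
      using theta_power(1)[of n] b by (intro divide_le_posI_ennreal) (auto simp: ennreal_mult mult.commute)
  qed
qed

lemma lip_theta_norm:
  assumes "theta_norm I A \<theta> f < \<infinity>"
  shows "lip f (enn2real (theta_norm I A \<theta> f))"
  using assms by (subst theta_norm_le_iff[symmetric]) (auto simp: less_top)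

lemma continuous_on_lip:
  assumes "lip f b" shows "continuous_on E f"
  unfolding continuous_on_def
proof (intro ballI tendstoI)
  fix x and \<epsilon> :: real assume x: "x \<in> E" and e: "0 < \<epsilon>"
  have "(\<lambda>n. b * \<theta> ^ n) \<longlonglongrightarrow> b * 0" using theta by (intro tendsto_mult tendsto_const LIMSEQ_power_zero) auto
  then have "\<forall>\<^sub>F n in sequentially. b * \<theta> ^ n < \<epsilon>" using e by (intro order_tendstoD(2)) auto
  then have "\<exists>n\<ge>1. b * \<theta> ^ n < \<epsilon>" unfolding eventually_sequentially by (metis le_add1 le_add2 add.commute)
  then obtain n where n: "1 \<le> n" "b * \<theta> ^ n < \<epsilon>" by blast
  define U where "U = (\<Inter>i<n. (\<lambda>y::seq. y i) -` {x i})"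
  have "open U" unfolding U_def
    by (intro open_INT ballI open_vimage continuous_on_product_coordinates open_discrete) auto
  moreover have "x \<in> U" by (simp add: U_def)
  moreover have "dist (f y) (f x) < \<epsilon>" if "y \<in> U" "y \<in> E" for y
  proof -
    have "norm (f y - f x) \<le> b * \<theta> ^ n"
      using that x n by (intro lipD[OF assms]) (auto simp: U_def agree_def)
    then show ?thesis using n by (simp add: dist_norm)
  qed
  ultimately show "\<forall>\<^sub>F y in at x within E. dist (f y) (f x) < \<epsilon>"
    unfolding eventually_at_topological by blast
qed

text \<open>
  Together with the elimination rule below, this reduces membership and the norm of the
  function space to a sup bound and a Lipschitz bound. Continuity is automatic from the latter.
\<close>

lemma Fb_memI:
  assumes 0: "\<And>x. x \<notin> E \<Longrightarrow> f x = 0" and a: "\<And>x. x \<in> E \<Longrightarrow> cmod (f x) \<le> a" and b: "lip f b" "0 \<le> b"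
  shows "f \<in> V" "N f \<le> a + b"
proof -
  have th: "theta_norm I A \<theta> f \<le> ennreal b" using b by (simp add: theta_norm_le_iff)
  then show "f \<in> V" unfolding Fb_theta_def
    using 0 a continuous_on_lip[OF b(1)] by (auto simp: bounded_iff le_less_trans)
  have "(SUP x\<in>E. cmod (f x)) \<le> a" using E_nonempty a by (intro cSUP_least) auto
  moreover have "enn2real (theta_norm I A \<theta> f) \<le> b" using th b by (simp add: enn2real_leI)
  ultimately show "N f \<le> a + b" unfolding Fb_norm_def by linarith
qed

lemma Fb_memE:
  assumes "f \<in> V"
  obtains a b where "N f = a + b" "0 \<le> a" "0 \<le> b" "lip f b" "\<And>x. cmod (f x) \<le> a"
proof -
  have sup: "cmod (f x) \<le> (SUP x\<in>E. cmod (f x))" if "x \<in> E" for x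
    using assms that unfolding Fb_theta_def
    by (intro cSUP_upper) (auto simp: bounded_iff bdd_above_def)
  obtain x0 where "x0 \<in> E" using E_nonempty by blast
  from sup[OF this] have pos: "0 \<le> (SUP x\<in>E. cmod (f x))" using norm_ge_zero order_trans by blast
  show ?thesis
  proof (rule that[of "SUP x\<in>E. cmod (f x)" "enn2real (theta_norm I A \<theta> f)"])
    show "lip f (enn2real (theta_norm I A \<theta> f))"
      using assms by (intro lip_theta_norm) (simp add: Fb_theta_def)
    show "cmod (f x) \<le> (SUP x\<in>E. cmod (f x))" for x
      using sup[of x] pos assms by (cases "x \<in> E") (auto simp: Fb_theta_def)
  qed (use pos in \<open>auto simp: Fb_norm_def\<close>)
qed

lemma Fb_zero: "f \<in> V \<Longrightarrow> x \<notin> E \<Longrightarrow> f x = 0"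
  by (simp add: Fb_theta_def)

lemma Fb_bound: "f \<in> V \<Longrightarrow> cmod (f x) \<le> N f"
  by (erule Fb_memE) (smt (verit))

lemma Fb_lip: "f \<in> V \<Longrightarrow> lip f (N f)"
  by (erule Fb_memE) (auto elim: lip_mono)

lemma Fb_add: assumes f: "f \<in> V" and g: "g \<in> V" shows "f + g \<in> V" "N (f + g) \<le> N f + N g"
proof -
  obtain a b where ab: "N f = a + b" "0 \<le> a" "0 \<le> b" "lip f b" "\<And>x. cmod (f x) \<le> a"
    using Fb_memE[OF f] by metis
  obtain c d where cd: "N g = c + d" "0 \<le> c" "0 \<le> d" "lip g d" "\<And>x. cmod (g x) \<le> c"
    using Fb_memE[OF g] by metis
  have *: "lip (f + g) (b + d)"
  proof (rule lipI)
    fix n :: nat and x y assume "1 \<le> n" "x \<in> E" "y \<in> E" "agree n x y"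
    note L = lipD[OF ab(4) this] lipD[OF cd(4) this]
    have "(f + g) x - (f + g) y = (f x - f y) + (g x - g y)" by simp
    then have "norm ((f + g) x - (f + g) y) \<le> norm (f x - f y) + norm (g x - g y)"
      by (simp only: norm_triangle_ineq)
    with L show "norm ((f + g) x - (f + g) y) \<le> (b + d) * \<theta> ^ n"
      unfolding distrib_right by linarith
  qed
  have **: "cmod ((f + g) x) \<le> a + c" for x
    using ab(5)[of x] cd(5)[of x] norm_triangle_ineq[of "f x" "g x"] by simp
  show "f + g \<in> V" "N (f + g) \<le> N f + N g"
    using Fb_memI[of "f + g" "a + c" "b + d", OF _ ** *] ab cd Fb_zero[OF f] Fb_zero[OF g] by auto
qed

lemma Fb_cscale_le: assumes f: "f \<in> V" shows "c *\<^sub>C f \<in> V" "N (c *\<^sub>C f) \<le> cmod c * N f"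
proof -
  obtain a b where ab: "N f = a + b" "0 \<le> a" "0 \<le> b" "lip f b" "\<And>x. cmod (f x) \<le> a"
    using Fb_memE[OF f] by metis
  have eq: "(c *\<^sub>C f) x = c * f x" for x by (simp add: cscale_fun_def cscale_complex_def)
  have *: "lip (c *\<^sub>C f) (cmod c * b)"
  proof (rule lipI)
    fix n :: nat and x y assume "1 \<le> n" "x \<in> E" "y \<in> E" "agree n x y"
    from mult_left_mono[OF lipD[OF ab(4) this] norm_ge_zero[of c]]
    show "norm ((c *\<^sub>C f) x - (c *\<^sub>C f) y) \<le> cmod c * b * \<theta> ^ n"
      unfolding eq by (simp add: norm_mult right_diff_distrib[symmetric] mult.assoc)
  qed
  have **: "cmod ((c *\<^sub>C f) x) \<le> cmod c * a" for x
    unfolding eq using ab(5)[of x] by (simp add: norm_mult mult_left_mono)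
  show "c *\<^sub>C f \<in> V" "N (c *\<^sub>C f) \<le> cmod c * N f"
    using Fb_memI[of "c *\<^sub>C f" "cmod c * a" "cmod c * b", OF _ ** *] ab Fb_zero[OF f]
    by (auto simp: eq distrib_left)
qed

lemma Fb_nonneg: "f \<in> V \<Longrightarrow> 0 \<le> N f"
  using Fb_bound[of f] norm_ge_zero order_trans by blast

text \<open>
  The series is summed pointwise. Sup and Lipschitz bounds of a tail are at most the tail of the series of norms.
\<close>

lemma Fb_complete:
  assumes F: "\<And>n. F n \<in> V" and sm: "summable (\<lambda>n. N (F n))"
  shows "\<exists>s\<in>V. (\<lambda>k. N (s - (\<Sum>n<k. F n))) \<longlonglongrightarrow> 0"
proof -
  have nsm: "summable (\<lambda>n. norm (F n x))" for x
    by (rule summable_comparison_test'[OF sm, of 0]) (simp add: Fb_bound[OF F])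
  have pt: "summable (\<lambda>n. F n x)" for x using nsm by (rule summable_norm_cancel)
  have tail: "(\<lambda>x. \<Sum>n. F (n + k) x) \<in> V \<and> N (\<lambda>x. \<Sum>n. F (n + k) x) \<le> 2 * (\<Sum>n. N (F (n + k)))" for k
  proof -
    let ?T = "\<Sum>n. N (F (n + k))"
    have smk: "summable (\<lambda>n. N (F (n + k)))" by (rule summable_ignore_initial_segment[OF sm])
    have nsmk: "summable (\<lambda>n. norm (F (n + k) x))" for x using summable_ignore_initial_segment[OF nsm] .
    have ptk: "summable (\<lambda>n. F (n + k) x)" for x using summable_ignore_initial_segment[OF pt] .
    have "norm (\<Sum>n. F (n + k) x) \<le> ?T" for x
      by (rule order_trans[OF summable_norm[OF nsmk] suminf_le[OF _ nsmk smk]]) (simp add: Fb_bound[OF F])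
    moreover have "lip (\<lambda>x. \<Sum>n. F (n + k) x) ?T"
    proof (rule lipI)
      fix n :: nat and x y assume a: "1 \<le> n" "x \<in> E" "y \<in> E" "agree n x y"
      have le: "norm (F (j + k) x - F (j + k) y) \<le> N (F (j + k)) * \<theta> ^ n" for j
        by (rule lipD[OF Fb_lip[OF F] a])
      have smd: "summable (\<lambda>j. norm (F (j + k) x - F (j + k) y))"
        by (rule summable_comparison_test'[OF summable_mult2[OF smk, of "\<theta> ^ n"], of 0]) (simp add: le)
      have "(\<Sum>j. F (j + k) x) - (\<Sum>j. F (j + k) y) = (\<Sum>j. F (j + k) x - F (j + k) y)"
        by (rule suminf_diff[OF ptk ptk])
      also have "norm \<dots> \<le> (\<Sum>j. norm (F (j + k) x - F (j + k) y))" by (rule summable_norm[OF smd])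
      also have "\<dots> \<le> (\<Sum>j. N (F (j + k)) * \<theta> ^ n)" by (rule suminf_le[OF le smd summable_mult2[OF smk]])
      also have "\<dots> = ?T * \<theta> ^ n" using suminf_mult2[OF smk] by simp
      finally show "norm ((\<Sum>j. F (j + k) x) - (\<Sum>j. F (j + k) y)) \<le> ?T * \<theta> ^ n" .
    qed
    moreover have "0 \<le> ?T" by (intro suminf_nonneg smk Fb_nonneg F)
    ultimately show ?thesis
      using Fb_memI[of "\<lambda>x. \<Sum>n. F (n + k) x" ?T ?T] Fb_zero[OF F] by auto
  qed
  let ?s = "\<lambda>x. \<Sum>n. F n x"
  have eq: "?s - (\<Sum>n<k. F n) = (\<lambda>x. \<Sum>n. F (n + k) x)" for k
  proof
    fix x
    have "(\<Sum>n<k. F n) x = (\<Sum>n<k. F n x)" by (induction k) auto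
    then show "(?s - (\<Sum>n<k. F n)) x = (\<Sum>n. F (n + k) x)"
      using suminf_split_initial_segment[OF pt[of x], of k] by simp
  qed
  have "(\<lambda>k. N (?s - (\<Sum>n<k. F n))) \<longlonglongrightarrow> 0"
    unfolding eq
  proof (rule null_sequence_squeeze)
    have "(\<lambda>k. (\<Sum>n. N (F n)) - (\<Sum>n<k. N (F n))) \<longlonglongrightarrow> (\<Sum>n. N (F n)) - (\<Sum>n. N (F n))"
      by (intro tendsto_diff tendsto_const summable_LIMSEQ sm)
    moreover have "(\<Sum>n. N (F n)) - (\<Sum>n<k. N (F n)) = (\<Sum>n. N (F (n + k)))" for k
      using suminf_split_initial_segment[OF sm, of k] by simp
    ultimately show "(\<lambda>k. 2 * (\<Sum>n. N (F (n + k)))) \<longlonglongrightarrow> 0"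
      by (intro tendsto_mult_right_zero) simp
  qed (use tail Fb_nonneg in auto)
  moreover have "?s \<in> V" using tail[of 0] by simp
  ultimately show ?thesis by blast
qed

sublocale carrier_banach V N
proof
  show "0 \<in> V" by (rule Fb_memI[where a=0 and b=0]) (auto simp: lip_def)
  fix f assume f: "f \<in> V"
  show "N (c *\<^sub>C f) = cmod c * N f" for c
  proof (rule antisym)
    show "N (c *\<^sub>C f) \<le> cmod c * N f" by (rule Fb_cscale_le[OF f])
    show "cmod c * N f \<le> N (c *\<^sub>C f)"
    proof (cases "c = 0")
      case False
      have "N ((1/c) *\<^sub>C c *\<^sub>C f) \<le> cmod (1/c) * N (c *\<^sub>C f)"
        by (rule Fb_cscale_le(2)[OF Fb_cscale_le(1)[OF f]])
      then show ?thesis using False by (simp add: cscale_cscale cscale_one norm_divide field_simps)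
    qed (use Fb_nonneg[OF Fb_cscale_le(1)[OF f, of c]] in simp)
  qed
  show "f = 0" if "N f = 0" using Fb_bound[OF f] that by (auto simp: fun_eq_iff)
qed (use Fb_add Fb_cscale_le Fb_nonneg Fb_complete in auto)

text \<open>
  The weight is dominated, together with its Hoelder seminorm on each cylinder of length one, by a
  summable sequence indexed by the letters. This is what makes the operator bounded for an infinite alphabet;
  the weight itself may come from unbounded potentials.
\<close>

definition kernel :: "(seq \<Rightarrow> 'a::{real_normed_algebra,banach}) \<Rightarrow> (nat \<Rightarrow> real) \<Rightarrow> bool" where
  "kernel W M \<longleftrightarrow> summable M \<and> (\<forall>i. 0 \<le> M i) \<and> (\<forall>y. y \<notin> E \<longrightarrow> W y = 0) \<and>
     (\<forall>y\<in>E. norm (W y) \<le> M (y 0)) \<and>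
     (\<forall>n\<ge>1. \<forall>x\<in>E. \<forall>y\<in>E. agree n x y \<longrightarrow> norm (W x - W y) \<le> M (x 0) * \<theta> ^ n)"

lemma kernelD:
  assumes "kernel W M"
  shows "summable M" "0 \<le> M i" "y \<notin> E \<Longrightarrow> W y = 0" "norm (W y) \<le> M (y 0)"
    "1 \<le> n \<Longrightarrow> x \<in> E \<Longrightarrow> y \<in> E \<Longrightarrow> agree n x y \<Longrightarrow> norm (W x - W y) \<le> M (x 0) * \<theta> ^ n"
  using assms unfolding kernel_def by (blast, blast, blast, cases "y \<in> E", auto)

lemma kernel_summable:
  assumes "kernel W M" and g: "\<And>y. norm (g y) \<le> B"
  shows "summable (\<lambda>i. norm (W (cons_seq i x) * g (cons_seq i x)))"
proof (rule summable_comparison_test'[OF summable_mult2[OF kernelD(1)[OF assms(1)], of B], of 0])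
  fix i
  have "norm (W (cons_seq i x) * g (cons_seq i x)) \<le> norm (W (cons_seq i x)) * norm (g (cons_seq i x))"
    by (rule norm_mult_ineq)
  also have "\<dots> \<le> M i * B"
    using kernelD(4)[OF assms(1), of "cons_seq i x"] kernelD(2)[OF assms(1)] g
    by (intro mult_mono) auto
  finally show "norm (norm (W (cons_seq i x) * g (cons_seq i x))) \<le> M i * B" by simp
qed

lemma ker_op_off_E: "kernel W M \<Longrightarrow> x \<notin> E \<Longrightarrow> ker_op W g x = 0"
  by (simp add: ker_op_def kernelD(3) cons_in_E)

lemma ker_op_norm_le:
  assumes "kernel W M" and g: "\<And>y. norm (g y) \<le> B"
  shows "norm (ker_op W g x) \<le> suminf M * B"
proof -
  have "norm (ker_op W g x) \<le> (\<Sum>i. norm (W (cons_seq i x) * g (cons_seq i x)))"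
    unfolding ker_op_def by (rule summable_norm[OF kernel_summable[OF assms]])
  also have "\<dots> \<le> (\<Sum>i. M i * B)"
  proof (rule suminf_le[OF _ kernel_summable[OF assms] summable_mult2[OF kernelD(1)[OF assms(1)]]])
    fix i
    have "norm (W (cons_seq i x) * g (cons_seq i x)) \<le> norm (W (cons_seq i x)) * norm (g (cons_seq i x))"
      by (rule norm_mult_ineq)
    also have "\<dots> \<le> M i * B"
      using kernelD(4)[OF assms(1), of "cons_seq i x"] kernelD(2)[OF assms(1)] g
      by (intro mult_mono) auto
    finally show "norm (W (cons_seq i x) * g (cons_seq i x)) \<le> M i * B" .
  qed
  also have "\<dots> = suminf M * B" using suminf_mult2[OF kernelD(1)[OF assms(1)]] by simp
  finally show ?thesis .
qed

lemma ker_op_in_Fb: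
  assumes W: "kernel W M" and g: "g \<in> V"
  shows "ker_op W g \<in> V" "N (ker_op W g) \<le> 3 * suminf M * N g"
proof -
  note k = kernelD[OF W]
  have B: "norm (g y) \<le> N g" for y by (rule Fb_bound[OF g])
  have Mpos: "0 \<le> suminf M" using k by (intro suminf_nonneg) auto
  have lip: "lip (ker_op W g) (2 * suminf M * N g)"
  proof (rule lipI)
    fix n :: nat and x y assume a: "1 \<le> n" "x \<in> E" "y \<in> E" "agree n x y"
    let ?d = "\<lambda>i. W (cons_seq i x) * g (cons_seq i x) - W (cons_seq i y) * g (cons_seq i y)"
    have le: "norm (?d i) \<le> M i * (2 * N g * \<theta> ^ n)" for i
    proof (cases "cons_seq i x \<in> E")
      case True
      then have y: "cons_seq i y \<in> E" using cons_in_E_agree a by blast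
      have ag: "agree (Suc n) (cons_seq i x) (cons_seq i y)" using a by simp
      have t: "\<theta> ^ Suc n \<le> \<theta> ^ n" using theta by (intro power_decreasing) auto
      have "?d i = (W (cons_seq i x) - W (cons_seq i y)) * g (cons_seq i x)
          + W (cons_seq i y) * (g (cons_seq i x) - g (cons_seq i y))" by (simp add: algebra_simps)
      then have "norm (?d i) \<le> norm (W (cons_seq i x) - W (cons_seq i y)) * norm (g (cons_seq i x))
          + norm (W (cons_seq i y)) * norm (g (cons_seq i x) - g (cons_seq i y))"
        by (metis norm_mult norm_triangle_ineq)
      also have "\<dots> \<le> (M i * \<theta> ^ n) * N g + M i * (N g * \<theta> ^ n)"
      proof (intro add_mono mult_mono B)
        show "norm (W (cons_seq i x) - W (cons_seq i y)) \<le> M i * \<theta> ^ n"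
          using k(5)[OF _ True y ag] mult_left_mono[OF t k(2)[of i]] by simp
        show "norm (W (cons_seq i y)) \<le> M i" using k(4)[of "cons_seq i y"] by simp
        show "norm (g (cons_seq i x) - g (cons_seq i y)) \<le> N g * \<theta> ^ n"
          using lipD[OF Fb_lip[OF g] _ True y ag] mult_left_mono[OF t Fb_nonneg[OF g]] by simp
      qed (use k theta_power(1)[of n] in auto)
      finally show ?thesis by (simp add: algebra_simps)
    next
      case False
      then have "cons_seq i y \<notin> E" using cons_in_E_agree a by blast
      then show ?thesis using False k(2,3) Fb_nonneg[OF g] theta_power(1)[of n] by simp
    qed
    have smd: "summable (\<lambda>i. norm (?d i))"
      by (rule summable_comparison_test'[OF summable_mult2[OF k(1), of "2 * N g * \<theta> ^ n"], of 0])
        (simp add: le)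
    note s = summable_norm_cancel[OF kernel_summable[OF W B]]
    have "ker_op W g x - ker_op W g y = (\<Sum>i. ?d i)"
      unfolding ker_op_def by (rule suminf_diff[OF s s])
    then have "norm (ker_op W g x - ker_op W g y) \<le> (\<Sum>i. norm (?d i))"
      by (simp only: summable_norm[OF smd])
    also have "\<dots> \<le> (\<Sum>i. M i * (2 * N g * \<theta> ^ n))" 
      by (rule suminf_le[OF le smd summable_mult2[OF k(1)]])
    also have "\<dots> = suminf M * (2 * N g * \<theta> ^ n)" using suminf_mult2[OF k(1)] by simp
    finally show "norm (ker_op W g x - ker_op W g y) \<le> 2 * suminf M * N g * \<theta> ^ n"
      by (simp add: ac_simps)
  qed
  have "0 \<le> 2 * suminf M * N g" using Mpos Fb_nonneg[OF g] by simp
  from Fb_memI[OF _ _ lip this, of "suminf M * N g"]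
  show "ker_op W g \<in> V" "N (ker_op W g) \<le> 3 * suminf M * N g"
    using ker_op_norm_le[OF W B] ker_op_off_E[OF W] by auto
qed

lemma ker_op_add:
  assumes "kernel W M" "\<And>y. norm (f y) \<le> B" "\<And>y. norm (g y) \<le> C"
  shows "ker_op W (\<lambda>y. f y + g y) x = ker_op W f x + ker_op W g x"
  using suminf_add[OF summable_norm_cancel[OF kernel_summable[where x=x and g=f, OF assms(1,2)]]
      summable_norm_cancel[OF kernel_summable[where x=x and g=g, OF assms(1,3)]]]
  by (simp add: ker_op_def distrib_left)

lemma ker_op_cmult:
  fixes W :: "seq \<Rightarrow> 'a::{real_normed_field,banach}"
  assumes "kernel W M" "\<And>y. norm (f y) \<le> B"
  shows "ker_op W (\<lambda>y. c * f y) x = c * ker_op W f x"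
  using suminf_mult[OF summable_norm_cancel[OF kernel_summable[where x=x and g=f, OF assms]], of c]
  by (simp add: ker_op_def mult.left_commute)

lemma ker_op_in_ops:
  assumes "kernel W M" shows "ker_op W \<in> ops"
proof (rule opsI[OF ker_op_in_Fb(1)[OF assms] _ _ ker_op_in_Fb(2)[OF assms]])
  show "ker_op W (f + g) = ker_op W f + ker_op W g" if "f \<in> V" "g \<in> V" for f g
    using ker_op_add[OF assms Fb_bound[OF that(1)] Fb_bound[OF that(2)]]
    by (auto simp: fun_eq_iff plus_fun_def)
  show "ker_op W (c *\<^sub>C f) = c *\<^sub>C ker_op W f" if "f \<in> V" for f c
    using ker_op_cmult[OF assms Fb_bound[OF that]]
    by (auto simp: fun_eq_iff cscale_fun_def cscale_complex_def)
qed

text \<open>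
  For fixed \<open>x\<close>, \<open>y\<close> both \<open>W z y\<close> and \<open>W z x - W z y\<close> are holomorphic in \<open>z\<close> and uniformly bounded by the kernel
  estimates, so their Taylor remainders satisfy the same estimates times \<open>\<bar>w - z\<bar>\<^sup>2\<close>: the remainder weight
  is a kernel with majorant of that size, and the operator bound for kernels applies to it.
\<close>

lemma kernel_family_has_op_deriv:
  fixes W :: "complex \<Rightarrow> seq \<Rightarrow> complex"
  assumes W: "\<And>z. z \<in> ball z0 \<rho> \<Longrightarrow> kernel (W z) M"
    and hol: "\<And>y. y \<in> E \<Longrightarrow> (\<lambda>z. W z y) holomorphic_on ball z0 \<rho>"
    and z: "z \<in> ball z0 (\<rho> / 2)"
  shows "has_op_deriv (\<lambda>z. ker_op (W z)) (ker_op (\<lambda>y. deriv (\<lambda>z. W z y) z)) z"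
    and "\<exists>M'. kernel (\<lambda>y. deriv (\<lambda>z. W z y) z) M'"
proof -
  have \<rho>: "0 < \<rho>" using z zero_le_dist[of z0 z] unfolding mem_ball by linarith
  \<comment> \<open>Discs of radius \<open>\<rho> / 2\<close> around \<open>z\<close> stay in the domain of the family.\<close>
  define r where "r = \<rho> / 2"
  have r: "0 < r" using \<rho> by (simp add: r_def)
  have sub: "ball z r \<subseteq> ball z0 \<rho>"
  proof
    fix w assume "w \<in> ball z r"
    then show "w \<in> ball z0 \<rho>" using z dist_triangle[of z0 w z] by (simp add: r_def)
  qed
  have zr: "z \<in> ball z r" using r by simp
  have zz: "z \<in> ball z r" "z \<in> ball z0 \<rho>" using zr subsetD[OF sub zr] .
  note k = kernelD[OF W]
  define c where "c = 32 / r\<^sup>2"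
  have c: "0 \<le> c" by (simp add: c_def)
  let ?W' = "\<lambda>y. deriv (\<lambda>z. W z y) z"
  have W'0: "?W' y = 0" if "y \<notin> E" for y
  proof -
    have "((\<lambda>z. W z y) has_field_derivative 0) (at z)"
      by (rule has_field_derivative_transform_within[where f="\<lambda>_. 0" and d=r and S=UNIV])
        (use r sub k(3)[OF _ that] in \<open>auto simp: dist_commute subset_iff\<close>)
    then show ?thesis by (rule DERIV_imp_deriv)
  qed
  have deriv_diff: "deriv (\<lambda>z. W z x - W z y) z = ?W' x - ?W' y" if "x \<in> E" "y \<in> E" for x y
    using that hol zz holomorphic_on_imp_differentiable_at[OF _ open_ball]
    by (intro deriv_diff) blast+
  have holr: "(\<lambda>z. W z y) holomorphic_on ball z r" if "y \<in> E" for y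
    using hol[OF that] sub by (rule holomorphic_on_subset)
  have deriv_bound: "cmod (deriv \<phi> z) \<le> 2 / r * B"
    if "\<phi> holomorphic_on ball z r" "\<And>w. w \<in> ball z r \<Longrightarrow> cmod (\<phi> w) \<le> B" for \<phi> B
  proof -
    have "cmod ((deriv ^^ 1) \<phi> z) \<le> fact 1 * B / (r/2) ^ 1"
    proof (rule Cauchy_inequality)
      show "\<phi> holomorphic_on ball z (r/2)" using that(1) r by (elim holomorphic_on_subset) auto
      show "continuous_on (cball z (r/2)) \<phi>"
        using that(1) r by (intro holomorphic_on_imp_continuous_on) (auto elim!: holomorphic_on_subset)
    qed (use r that(2) in \<open>auto simp: dist_norm\<close>)
    then show ?thesis by (simp add: mult.commute)
  qed
  have M0: "summable M" "\<And>i. 0 \<le> M i" using k(1,2)[OF zz(2)] .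
  have W': "kernel ?W' (\<lambda>i. 2 / r * M i)"
    unfolding kernel_def
  proof (intro conjI allI ballI impI)
    fix y assume y: "y \<in> E"
    show "cmod (?W' y) \<le> 2 / r * M (y 0)"
      using k(4) sub by (intro deriv_bound holr y) blast
  next
    fix n :: nat and x y assume a: "1 \<le> n" "x \<in> E" "y \<in> E" "agree n x y"
    have "cmod (deriv (\<lambda>z. W z x - W z y) z) \<le> 2 / r * (M (x 0) * \<theta> ^ n)"
      using k(5)[OF _ a] sub by (intro deriv_bound holomorphic_on_diff holr a) blast
    then show "cmod (?W' x - ?W' y) \<le> 2 / r * M (x 0) * \<theta> ^ n"
      unfolding deriv_diff[OF a(2,3)] by (simp add: mult.assoc)
  qed (use M0 r W'0 in \<open>auto intro: summable_mult\<close>)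
  have rem: "kernel (\<lambda>y. W w y - W z y - (w - z) * ?W' y) (\<lambda>i. c * (cmod (w - z))\<^sup>2 * M i)"
    if w: "w \<in> ball z (r/2)" for w
  proof -
    have w': "w \<in> ball z0 \<rho>" using w r sub by (auto simp: subset_iff)
    show ?thesis
      unfolding kernel_def
    proof (intro conjI allI ballI impI)
      fix y assume y: "y \<in> E"
      have "cmod (W w y - W z y - (w - z) * ?W' y) \<le> 32 * M (y 0) / r\<^sup>2 * (cmod (w - z))\<^sup>2"
        using k(4) sub by (intro holomorphic_quadratic_remainder[OF holr[OF y] r _ w]) blast
      then show "cmod (W w y - W z y - (w - z) * ?W' y) \<le> c * (cmod (w - z))\<^sup>2 * M (y 0)"
        by (simp add: c_def ac_simps)
    next
      fix n :: nat and x y assume a: "1 \<le> n" "x \<in> E" "y \<in> E" "agree n x y"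
      have "cmod ((W w x - W w y) - (W z x - W z y) - (w - z) * deriv (\<lambda>z. W z x - W z y) z)
          \<le> 32 * (M (x 0) * \<theta> ^ n) / r\<^sup>2 * (cmod (w - z))\<^sup>2"
        using k(5)[OF _ a] sub
        by (intro holomorphic_quadratic_remainder[OF holomorphic_on_diff[OF holr[OF a(2)] holr[OF a(3)]] r _ w]) blast
      moreover have "(W w x - W w y) - (W z x - W z y) - (w - z) * (?W' x - ?W' y)
          = (W w x - W z x - (w - z) * ?W' x) - (W w y - W z y - (w - z) * ?W' y)"
        by (simp add: algebra_simps)
      ultimately show "cmod ((W w x - W z x - (w - z) * ?W' x) - (W w y - W z y - (w - z) * ?W' y))
          \<le> c * (cmod (w - z))\<^sup>2 * M (x 0) * \<theta> ^ n"
        unfolding deriv_diff[OF a(2,3)] by (simp add: c_def ac_simps)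
    qed (use M0 c W'0 k(3)[OF w'] k(3)[OF zz(2)] in \<open>auto intro: summable_mult\<close>)
  qed
  show "\<exists>M'. kernel ?W' M'" using W' by blast
  show "has_op_deriv (\<lambda>z. ker_op (W z)) (ker_op ?W') z"
  proof (rule has_op_derivI[where r="r/2" and C="3 * c * suminf M"])
    show "ker_op ?W' \<in> ops" by (rule ker_op_in_ops[OF W'])
    fix w assume w: "w \<in> ball z (r/2)"
    then have w': "w \<in> ball z0 \<rho>" using r sub by (auto simp: subset_iff)
    show "ker_op (W w) \<in> ops" by (rule ker_op_in_ops[OF W[OF w']])
    fix f assume f: "f \<in> V"
    have s: "summable (\<lambda>i. W w (cons_seq i x) * f (cons_seq i x))"
      "summable (\<lambda>i. W z (cons_seq i x) * f (cons_seq i x))"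
      "summable (\<lambda>i. ?W' (cons_seq i x) * f (cons_seq i x))" for x
      by (rule summable_norm_cancel, rule kernel_summable[where g=f, OF W[OF w'] Fb_bound[OF f]])
        (rule summable_norm_cancel, rule kernel_summable[where g=f, OF W[OF zz(2)] Fb_bound[OF f]],
          rule summable_norm_cancel, rule kernel_summable[where g=f, OF W' Fb_bound[OF f]])
    have eq: "ker_op (W w) f - ker_op (W z) f - (w - z) *\<^sub>C ker_op ?W' f
        = ker_op (\<lambda>y. W w y - W z y - (w - z) * ?W' y) f"
    proof
      fix x
      have "(\<Sum>i. (W w (cons_seq i x) - W z (cons_seq i x) - (w - z) * ?W' (cons_seq i x)) * f (cons_seq i x))
        = (\<Sum>i. W w (cons_seq i x) * f (cons_seq i x) - W z (cons_seq i x) * f (cons_seq i x)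
            - (w - z) * (?W' (cons_seq i x) * f (cons_seq i x)))"
        by (simp add: left_diff_distrib mult.assoc)
      also have "\<dots> = (\<Sum>i. W w (cons_seq i x) * f (cons_seq i x)) - (\<Sum>i. W z (cons_seq i x) * f (cons_seq i x))
            - (w - z) * (\<Sum>i. ?W' (cons_seq i x) * f (cons_seq i x))"
        by (rule sums_unique[symmetric]) (intro sums_diff sums_mult summable_sums s)
      finally show "(ker_op (W w) f - ker_op (W z) f - (w - z) *\<^sub>C ker_op ?W' f) x
        = ker_op (\<lambda>y. W w y - W z y - (w - z) * ?W' y) f x"
        by (simp add: ker_op_def cscale_fun_def cscale_complex_def)
    qed
    have "N (ker_op (\<lambda>y. W w y - W z y - (w - z) * ?W' y) f)
        \<le> 3 * (\<Sum>i. c * (cmod (w - z))\<^sup>2 * M i) * N f"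
      by (rule ker_op_in_Fb(2)[OF rem[OF w] f])
    also have "(\<Sum>i. c * (cmod (w - z))\<^sup>2 * M i) = c * (cmod (w - z))\<^sup>2 * suminf M"
      by (rule suminf_mult[OF M0(1)])
    finally show "N (ker_op (W w) f - ker_op (W z) f - (w - z) *\<^sub>C ker_op ?W' f)
        \<le> 3 * c * suminf M * (cmod (w - z))\<^sup>2 * N f"
      unfolding eq by (simp add: ac_simps)
  qed (use r in simp)
qed

end

section \<open>Cones of log-Lipschitz functions and the averaged operator\<close>

fun prepend :: "nat list \<Rightarrow> seq \<Rightarrow> seq" where
  "prepend [] x = x"
| "prepend (i # v) x = cons_seq i (prepend v x)"

lemma prepend_snoc: "prepend (v @ [i]) x = prepend v (cons_seq i x)"
  by (induction v) auto

lemma (in shift_space) prepend_word: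
  assumes x: "x \<in> E" and y: "y \<in> E" "y 0 = x (j + n)"
  shows "prepend (map x [j..<j + n]) y \<in> E"
    and "agree (Suc n) (\<lambda>i. x (j + i)) (prepend (map x [j..<j + n]) y)"
proof -
  have "prepend (map x [j..<j + n]) y \<in> E \<and> agree (Suc n) (\<lambda>i. x (j + i)) (prepend (map x [j..<j + n]) y)"
    using y
  proof (induction n arbitrary: j)
    case 0 then show ?case by (simp add: agree_1_iff)
  next
    case (Suc n)
    let ?z = "prepend (map x [Suc j..<Suc j + n]) y"
    have IH: "?z \<in> E" "agree (Suc n) (\<lambda>i. x (Suc j + i)) ?z" using Suc.IH[of "Suc j"] Suc.prems by auto
    have eq: "map x [j..<j + Suc n] = x j # map x [Suc j..<Suc j + n]"
      by (simp add: upt_conv_Cons del: upt_Suc)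
    have "?z 0 = x (Suc j)" using IH(2) unfolding agree_def by (metis add_0_right zero_less_Suc)
    then have "cons_seq (x j) ?z \<in> E" using IH(1) x unfolding cons_in_E by (simp add: E_inf_def)
    moreover have "agree (Suc (Suc n)) (\<lambda>i. x (j + i)) (cons_seq (x j) ?z)"
      using IH(2) by (auto simp: agree_def less_Suc_eq_0_disj)
    ultimately show ?case unfolding eq by simp
  qed
  then show "prepend (map x [j..<j + n]) y \<in> E"
    and "agree (Suc n) (\<lambda>i. x (j + i)) (prepend (map x [j..<j + n]) y)" by auto
qed

text \<open>
  A real potential \<open>u\<close> with summable weight on an irreducible shift. \<open>\<Lambda>\<close> is the finite set of connecting
  words; only the consequence of irreducibility that is used for sums over preimages is recorded, namely that from
  every letter some word of \<open>\<Lambda>\<close> leads to any given point.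
\<close>

locale transfer_system = shift_space +
  fixes u :: "seq \<Rightarrow> real" and a :: real and M :: "nat \<Rightarrow> real" and \<Lambda> :: "nat list set"
  assumes u_lip: "lip u a" and a_nonneg: "0 \<le> a"
    and exp_kernel: "kernel (\<lambda>y. if y \<in> E then exp (u y) else 0) M"
    and finite_\<Lambda>: "finite \<Lambda>" and \<Lambda>_letters: "\<omega> \<in> \<Lambda> \<Longrightarrow> set \<omega> \<subseteq> I"
    and connect: "i \<in> I \<Longrightarrow> x \<in> E \<Longrightarrow> \<exists>\<omega>\<in>\<Lambda>. cons_seq i (prepend \<omega> x) \<in> E"
begin

definition w :: "seq \<Rightarrow> real" where "w y = (if y \<in> E then exp (u y) else 0)"

definition L :: "(seq \<Rightarrow> real) \<Rightarrow> seq \<Rightarrow> real" where "L = ker_op w"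

definition bdd :: "(seq \<Rightarrow> real) \<Rightarrow> bool" where
  "bdd g \<longleftrightarrow> (\<forall>x. x \<notin> E \<longrightarrow> g x = 0) \<and> (\<exists>B. \<forall>x. \<bar>g x\<bar> \<le> B)"

text \<open>
  The constant function 1, cut off outside the shift space like all functions here.
\<close>

definition unit :: "seq \<Rightarrow> real" where "unit x = (if x \<in> E then 1 else 0)"

lemma w_kernel: "kernel w M"
  using exp_kernel unfolding w_def[abs_def] .

lemma w_nonneg: "0 \<le> w y" by (simp add: w_def)

lemma w_pos: "y \<in> E \<Longrightarrow> 0 < w y" by (simp add: w_def)

lemma w_off: "y \<notin> E \<Longrightarrow> w y = 0" by (simp add: w_def)

lemma bddI: "(\<And>x. x \<notin> E \<Longrightarrow> g x = 0) \<Longrightarrow> (\<And>x. x \<in> E \<Longrightarrow> \<bar>g x\<bar> \<le> B) \<Longrightarrow> bdd g"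
  unfolding bdd_def by (metis abs_ge_zero abs_zero order_trans linear)

lemma bddE:
  assumes "bdd g" obtains B where "0 \<le> B" "\<And>x. \<bar>g x\<bar> \<le> B"
  using assms unfolding bdd_def by (meson abs_ge_zero order_trans)

lemma bdd_off: "bdd g \<Longrightarrow> x \<notin> E \<Longrightarrow> g x = 0"
  by (simp add: bdd_def)

lemma unit_nonneg: "0 \<le> unit x" by (simp add: unit_def)

lemma bdd_unit: "bdd unit"
  by (rule bddI[where B=1]) (auto simp: unit_def)

lemma bdd_add: assumes "bdd f" "bdd g" shows "bdd (\<lambda>x. f x + g x)"
proof -
  obtain B C where "\<And>x. \<bar>f x\<bar> \<le> B" "\<And>x. \<bar>g x\<bar> \<le> C" using assms by (metis bddE)
  then show ?thesis using assms
    by (intro bddI[where B="B + C"]) (auto simp: bdd_off intro: order_trans[OF abs_triangle_ineq] add_mono)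
qed

lemma bdd_cmult: assumes "bdd f" shows "bdd (\<lambda>x. c * f x)"
proof -
  obtain B where "\<And>x. \<bar>f x\<bar> \<le> B" using assms by (metis bddE)
  then show ?thesis using assms
    by (intro bddI[where B="\<bar>c\<bar> * B"]) (auto simp: bdd_off abs_mult mult_left_mono)
qed

lemma bdd_uminus: "bdd f \<Longrightarrow> bdd (\<lambda>x. - f x)"
  using bdd_cmult[of f "-1"] by simp

lemma bdd_diff: "bdd f \<Longrightarrow> bdd g \<Longrightarrow> bdd (\<lambda>x. f x - g x)"
  using bdd_add[of f "\<lambda>x. - g x"] bdd_uminus[of g] by simp

lemma bdd_sum: "(\<And>i. i \<in> S \<Longrightarrow> bdd (F i)) \<Longrightarrow> bdd (\<lambda>x. \<Sum>i\<in>S. F i x)"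
  by (induction S rule: infinite_finite_induct) (auto intro: bdd_add bddI[where B=0])

lemma L_bdd: assumes "bdd g" shows "bdd (L g)"
proof -
  obtain B where "\<And>x. norm (g x) \<le> B" using bddE[OF assms] by (metis real_norm_def)
  from ker_op_norm_le[OF w_kernel this] show ?thesis unfolding L_def
    by (intro bddI[where B="suminf M * B"]) (auto simp: ker_op_off_E[OF w_kernel])
qed

lemma L_summable:
  assumes "bdd g" shows "summable (\<lambda>i. w (cons_seq i x) * g (cons_seq i x))"
proof -
  obtain B where "\<And>x. norm (g x) \<le> B" using bddE[OF assms] by (metis real_norm_def)
  from kernel_summable[OF w_kernel this] show ?thesis by (rule summable_norm_cancel)
qed

lemma L_add: "bdd f \<Longrightarrow> bdd g \<Longrightarrow> L (\<lambda>x. f x + g x) = (\<lambda>x. L f x + L g x)"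
  by (rule ext) (simp add: L_def ker_op_def distrib_left suminf_add[OF L_summable L_summable])

lemma L_cmult: "bdd f \<Longrightarrow> L (\<lambda>x. c * f x) = (\<lambda>x. c * L f x)"
  by (rule ext) (simp add: L_def ker_op_def mult.left_commute suminf_mult[OF L_summable])

lemma L_mono:
  assumes "bdd f" "bdd g" "\<And>x. x \<in> E \<Longrightarrow> f x \<le> g x" shows "L f x \<le> L g x"
  unfolding L_def ker_op_def
proof (rule suminf_le[OF _ L_summable[OF assms(1)] L_summable[OF assms(2)]])
  show "w (cons_seq i x) * f (cons_seq i x) \<le> w (cons_seq i x) * g (cons_seq i x)" for i
    using assms(3) w_nonneg w_off by (cases "cons_seq i x \<in> E") (auto intro: mult_left_mono)
qed

text \<open>
  Positive linear operators on bounded functions. Order arguments in the real setting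
  replace norm estimates in this part of the proof.
\<close>

definition linear_positive :: "((seq \<Rightarrow> real) \<Rightarrow> seq \<Rightarrow> real) \<Rightarrow> bool" where
  "linear_positive T \<longleftrightarrow> (\<forall>g. bdd g \<longrightarrow> bdd (T g)) \<and>
     (\<forall>f g. bdd f \<longrightarrow> bdd g \<longrightarrow> T (\<lambda>x. f x + g x) = (\<lambda>x. T f x + T g x)) \<and>
     (\<forall>c f. bdd f \<longrightarrow> T (\<lambda>x. c * f x) = (\<lambda>x. c * T f x)) \<and>
     (\<forall>f. bdd f \<longrightarrow> (\<forall>x. 0 \<le> f x) \<longrightarrow> (\<forall>x. 0 \<le> T f x))"

lemma linear_positiveD:
  assumes "linear_positive T"
  shows "bdd g \<Longrightarrow> bdd (T g)"
    "bdd f \<Longrightarrow> bdd g \<Longrightarrow> T (\<lambda>x. f x + g x) = (\<lambda>x. T f x + T g x)"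
    "bdd f \<Longrightarrow> T (\<lambda>x. c * f x) = (\<lambda>x. c * T f x)"
    "bdd f \<Longrightarrow> (\<And>x. 0 \<le> f x) \<Longrightarrow> 0 \<le> T f x"
  using assms unfolding linear_positive_def by auto

lemma lp_diff:
  assumes "linear_positive T" "bdd f" "bdd g" shows "T (\<lambda>x. f x - g x) = (\<lambda>x. T f x - T g x)"
proof -
  have "T (\<lambda>x. f x + (-1) * g x) = (\<lambda>x. T f x + (-1) * T g x)"
    by (simp only: linear_positiveD(2)[OF assms(1,2) bdd_cmult[OF assms(3)]] linear_positiveD(3)[OF assms(1,3)])
  then show ?thesis by simp
qed

lemma lp_mono:
  assumes "linear_positive T" "bdd f" "bdd g" "\<And>x. f x \<le> g x" shows "T f x \<le> T g x"
  using linear_positiveD(4)[OF assms(1) bdd_diff[OF assms(3,2)], of x] assms(4) lp_diff[OF assms(1,3,2)] by simp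

lemma lp_zero: "linear_positive T \<Longrightarrow> T (\<lambda>x. 0) = (\<lambda>x. 0)"
  using linear_positiveD(3)[of T unit 0] bdd_unit by simp

lemma lp_sum:
  assumes "linear_positive T" "\<And>i. i \<in> S \<Longrightarrow> bdd (F i)"
  shows "T (\<lambda>x. \<Sum>i\<in>S. F i x) = (\<lambda>x. \<Sum>i\<in>S. T (F i) x)"
  using assms(2)
proof (induction S rule: infinite_finite_induct)
  case (insert j S)
  then show ?case using linear_positiveD(2)[OF assms(1), of "F j" "\<lambda>x. \<Sum>i\<in>S. F i x"] bdd_sum[of S F]
    by simp
qed (simp_all add: lp_zero[OF assms(1)])

lemma lp_L: "linear_positive L"
  unfolding linear_positive_def
proof (intro conjI allI impI)
  fix f :: "seq \<Rightarrow> real" and x assume "bdd f" "\<forall>x. 0 \<le> f x"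
  then show "0 \<le> L f x" unfolding L_def ker_op_def
    by (intro suminf_nonneg L_summable) (auto intro: mult_nonneg_nonneg w_nonneg)
qed (auto simp: L_bdd L_add L_cmult)

lemma lp_id: "linear_positive (\<lambda>g. g)"
  by (simp add: linear_positive_def)

lemma lp_comp:
  assumes "linear_positive S" "linear_positive T" shows "linear_positive (\<lambda>g. S (T g))"
  unfolding linear_positive_def using linear_positiveD[OF assms(1)] linear_positiveD[OF assms(2)] by auto

lemma lp_power: "linear_positive T \<Longrightarrow> linear_positive (T ^^ n)"
proof (induction n)
  case 0 show ?case using lp_id by (simp add: id_def)
next
  case (Suc n) then show ?case using lp_comp[of T "T ^^ n"] by (simp add: o_def)
qed

lemma lp_average:
  assumes "\<And>k. k < n \<Longrightarrow> linear_positive (T k)" "0 \<le> c"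
  shows "linear_positive (\<lambda>g x. c * (\<Sum>k<n. T k g x))"
  unfolding linear_positive_def
proof (intro conjI allI impI)
  fix f g :: "seq \<Rightarrow> real" and b x
  note D = linear_positiveD[OF assms(1)]
  show "bdd (\<lambda>x. c * (\<Sum>k<n. T k g x))" if "bdd g"
    using that by (intro bdd_cmult bdd_sum D(1)) auto
  show "(\<lambda>x. c * (\<Sum>k<n. T k (\<lambda>x. f x + g x) x)) =
      (\<lambda>x. c * (\<Sum>k<n. T k f x) + c * (\<Sum>k<n. T k g x))" if "bdd f" "bdd g"
    using that by (simp add: D(2) sum.distrib distrib_left)
  show "(\<lambda>x. c * (\<Sum>k<n. T k (\<lambda>x. b * f x) x)) = (\<lambda>x. b * (c * (\<Sum>k<n. T k f x)))" if "bdd f"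
    using that by (simp add: D(3) sum_distrib_left ac_simps)
  show "0 \<le> c * (\<Sum>k<n. T k f x)" if "bdd f" "\<forall>x. 0 \<le> f x"
    using that assms(2) by (intro mult_nonneg_nonneg sum_nonneg D(4)) auto
qed

subsection \<open>Words connecting letters\<close>

definition m :: nat where "m = Suc (Max (insert 0 (length ` \<Lambda>)))"

lemma m_pos: "0 < m" by (simp add: m_def)

lemma length_less_m: "\<omega> \<in> \<Lambda> \<Longrightarrow> length \<omega> < m"
  using finite_\<Lambda> by (auto simp: m_def less_Suc_eq_le)

lemma ex_letter: "i \<in> I \<Longrightarrow> \<exists>x\<in>E. x 0 = i"
  using connect[of i] E_nonempty by force

lemma head_in_I: "x \<in> E \<Longrightarrow> x 0 \<in> I"
  by (simp add: E_inf_def)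

lemma \<Lambda>_nonempty: "\<Lambda> \<noteq> {}"
  using E_nonempty head_in_I connect by blast

definition rp :: "nat \<Rightarrow> seq" where "rp i = (SOME x. x \<in> E \<and> x 0 = i)"

lemma rp: "i \<in> I \<Longrightarrow> rp i \<in> E" "i \<in> I \<Longrightarrow> rp i 0 = i"
  using someI_ex[of "\<lambda>x. x \<in> E \<and> x 0 = i"] ex_letter[of i] unfolding rp_def by auto

definition wt :: "nat \<Rightarrow> real" where "wt i = (if i \<in> I then w (rp i) else 0)"

lemma wt_nonneg: "0 \<le> wt i" by (simp add: wt_def w_nonneg)

lemma wt_pos: "i \<in> I \<Longrightarrow> 0 < wt i" by (simp add: wt_def w_pos rp)

lemma wt_summable: "summable wt"
proof (rule summable_comparison_test'[OF kernelD(1)[OF w_kernel], of 0])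
  show "norm (wt i) \<le> M i" for i
    using kernelD(4)[OF w_kernel, of "rp i"] kernelD(2)[OF w_kernel, of i] rp[of i] by (cases "i \<in> I") (auto simp: wt_def)
qed

text \<open>
  Evaluation at one reference point per letter, weighted by the potential. On functions in a cone
  it is comparable to the value of \<open>L g\<close> at a point all of whose preimages are admissible.
\<close>

definition \<Phi> :: "(seq \<Rightarrow> real) \<Rightarrow> real" where "\<Phi> g = (\<Sum>i. wt i * g (rp i))"

lemma \<Phi>_summable: assumes "bdd g" shows "summable (\<lambda>i. wt i * g (rp i))"
proof -
  obtain B where B: "\<And>x. \<bar>g x\<bar> \<le> B" using bddE[OF assms] by metis
  show ?thesis
    by (rule summable_comparison_test'[OF summable_mult2[OF wt_summable, of B], of 0])
      (simp add: abs_mult wt_nonneg B mult_left_mono)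
qed

lemma \<Phi>_add: "bdd f \<Longrightarrow> bdd g \<Longrightarrow> \<Phi> (\<lambda>x. f x + g x) = \<Phi> f + \<Phi> g"
  by (simp add: \<Phi>_def distrib_left suminf_add[OF \<Phi>_summable \<Phi>_summable])

lemma \<Phi>_cmult: "bdd f \<Longrightarrow> \<Phi> (\<lambda>x. c * f x) = c * \<Phi> f"
  by (simp add: \<Phi>_def mult.left_commute suminf_mult[OF \<Phi>_summable])

lemma \<Phi>_mono: 
  assumes "bdd f" "bdd g" "\<And>x. x \<in> E \<Longrightarrow> f x \<le> g x" shows "\<Phi> f \<le> \<Phi> g"
  unfolding \<Phi>_def
proof (rule suminf_le[OF _ \<Phi>_summable[OF assms(1)] \<Phi>_summable[OF assms(2)]])
  show "wt i * f (rp i) \<le> wt i * g (rp i)" for i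
    using assms(3)[OF rp(1)] wt_nonneg[of i] by (cases "i \<in> I") (auto simp: wt_def intro: mult_left_mono)
qed

lemma \<Phi>_nonneg: "bdd f \<Longrightarrow> (\<And>x. 0 \<le> f x) \<Longrightarrow> 0 \<le> \<Phi> f"
  unfolding \<Phi>_def by (intro suminf_nonneg \<Phi>_summable) (auto intro: mult_nonneg_nonneg wt_nonneg)

lemma \<Phi>_unit_pos: "0 < \<Phi> unit"
proof -
  obtain x where x: "x \<in> E" using E_nonempty by blast
  have i: "x 0 \<in> I" by (rule head_in_I[OF x])
  have "0 < wt (x 0) * unit (rp (x 0))" using i wt_pos rp by (simp add: unit_def)
  then show ?thesis unfolding \<Phi>_def
    by (intro suminf_pos2[OF \<Phi>_summable[OF bdd_unit], of "x 0"])
      (auto simp: unit_def wt_nonneg)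
qed

subsection \<open>Cones of log-Lipschitz functions\<close>

text \<open>
  Functions whose logarithm is \<open>b\<close>-Lipschitz. Positivity of an operator on such functions carries
  regularity with it, so that sup bounds in the cone are bounds for the Hoelder norm.
\<close>

definition cone :: "real \<Rightarrow> (seq \<Rightarrow> real) \<Rightarrow> bool" where
  "cone b g \<longleftrightarrow> bdd g \<and> (\<forall>x. 0 \<le> g x) \<and>
     (\<forall>n\<ge>1. \<forall>x\<in>E. \<forall>y\<in>E. agree n x y \<longrightarrow> g x \<le> exp (b * \<theta> ^ n) * g y)"

lemma coneI:
  assumes "bdd g" "\<And>x. x \<in> E \<Longrightarrow> 0 \<le> g x"
    and "\<And>n x y. 1 \<le> n \<Longrightarrow> x \<in> E \<Longrightarrow> y \<in> E \<Longrightarrow> agree n x y \<Longrightarrow> g x \<le> exp (b * \<theta> ^ n) * g y"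
  shows "cone b g"
proof -
  have "0 \<le> g x" for x using assms(2) bdd_off[OF assms(1)] by (cases "x \<in> E") auto
  then show ?thesis using assms unfolding cone_def by blast
qed

lemma coneD:
  assumes "cone b g"
  shows "bdd g" "0 \<le> g x"
    "1 \<le> n \<Longrightarrow> x \<in> E \<Longrightarrow> y \<in> E \<Longrightarrow> agree n x y \<Longrightarrow> g x \<le> exp (b * \<theta> ^ n) * g y"
  using assms unfolding cone_def by blast+

lemma cone_mono: assumes "cone b g" "b \<le> c" shows "cone c g"
proof (rule coneI)
  fix n :: nat and x y assume a: "1 \<le> n" "x \<in> E" "y \<in> E" "agree n x y"
  have "exp (b * \<theta> ^ n) * g y \<le> exp (c * \<theta> ^ n) * g y"
    using assms(2) theta_power(1)[of n] coneD(2)[OF assms(1), of y] by (intro mult_right_mono) auto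
  with coneD(3)[OF assms(1) a] show "g x \<le> exp (c * \<theta> ^ n) * g y" by linarith
qed (use coneD[OF assms(1)] in auto)

lemma cone_cmult: "cone b g \<Longrightarrow> 0 \<le> c \<Longrightarrow> cone b (\<lambda>x. c * g x)"
  by (rule coneI) (auto intro!: bdd_cmult mult_nonneg_nonneg dest: coneD
      simp: mult.left_commute[of "exp _" c] intro: mult_left_mono[OF coneD(3)])

lemma cone_add: 
  assumes "cone b f" "cone b g" shows "cone b (\<lambda>x. f x + g x)"
proof (rule coneI)
  fix n :: nat and x y assume a: "1 \<le> n" "x \<in> E" "y \<in> E" "agree n x y"
  show "f x + g x \<le> exp (b * \<theta> ^ n) * (f y + g y)"
    using coneD(3)[OF assms(1) a] coneD(3)[OF assms(2) a] by (simp add: distrib_left)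
qed (use coneD(1,2)[OF assms(1)] coneD(1,2)[OF assms(2)] in \<open>auto intro: bdd_add\<close>)

lemma cone_unit: "0 \<le> b \<Longrightarrow> cone b unit"
  by (rule coneI) (use theta_power in \<open>auto simp: unit_def bdd_unit less_imp_le\<close>)

lemma cone_zero: "cone b (\<lambda>x. 0)"
  by (rule coneI) (auto intro: bddI[where B=0])

lemma cone_sum: "(\<And>i. i \<in> S \<Longrightarrow> cone b (F i)) \<Longrightarrow> cone b (\<lambda>x. \<Sum>i\<in>S. F i x)"
  by (induction S rule: infinite_finite_induct) (simp_all add: cone_zero cone_add)

lemma w_compare:
  assumes "1 \<le> n" "agree n x y" "x \<in> E" "y \<in> E" shows "w x \<le> exp (a * \<theta> ^ n) * w y"
proof -
  have "u x \<le> a * \<theta> ^ n + u y" using lipD[OF u_lip assms(1,3,4,2)] by simp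
  then show ?thesis using assms by (simp add: w_def exp_add[symmetric])
qed

lemma w_cone_compare:
  assumes g: "cone b g" and n: "1 \<le> n" and "agree n x y" "x \<in> E" "y \<in> E"
  shows "w x * g x \<le> exp ((a + b) * \<theta> ^ n) * (w y * g y)"
proof -
  have "w x * g x \<le> (exp (a * \<theta> ^ n) * w y) * (exp (b * \<theta> ^ n) * g y)"
    using assms w_nonneg coneD(2)[OF g] by (intro mult_mono w_compare coneD(3)[OF g]) auto
  then show ?thesis by (simp add: exp_add distrib_right ac_simps)
qed

text \<open>
  Two points that agree on \<open>n\<close> letters have preimages that agree on \<open>n + 1\<close> letters, so each preimage
  contributes a factor \<open>\<theta>\<close> to the log-Lipschitz constant.
\<close>

lemma cone_L:
  assumes g: "cone b g" shows "cone (\<theta> * (a + b)) (L g)"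
proof (rule coneI)
  note b = coneD(1)[OF g]
  fix n :: nat and x y assume a: "1 \<le> n" "x \<in> E" "y \<in> E" "agree n x y"
  let ?c = "exp (\<theta> * (a + b) * \<theta> ^ n)"
  have "w (cons_seq i x) * g (cons_seq i x) \<le> ?c * (w (cons_seq i y) * g (cons_seq i y))" for i
  proof (cases "cons_seq i x \<in> E")
    case True
    then have "cons_seq i y \<in> E" using cons_in_E_agree a by blast
    with True a have "w (cons_seq i x) * g (cons_seq i x)
        \<le> exp ((a + b) * \<theta> ^ Suc n) * (w (cons_seq i y) * g (cons_seq i y))"
      by (intro w_cone_compare[OF g]) auto
    then show ?thesis by (simp add: ac_simps)
  qed (simp add: w_off w_nonneg coneD(2)[OF g])
  then have "L g x \<le> (\<Sum>i. ?c * (w (cons_seq i y) * g (cons_seq i y)))"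
    unfolding L_def ker_op_def by (intro suminf_le L_summable summable_mult b)
  then show "L g x \<le> ?c * L g y"
    unfolding L_def ker_op_def suminf_mult[OF L_summable[OF b]] .
qed (use linear_positiveD[OF lp_L] coneD(1,2)[OF g] in auto)

text \<open>
  Chosen so that \<open>\<theta> * (a + \<beta>) = \<beta> - 1\<close>: the operator maps the cone of aperture \<open>\<beta>\<close> into the strictly
  smaller one of aperture \<open>\<beta> - 1\<close>, which leaves room for subtracting a small constant later.
\<close>

definition \<beta> :: real where "\<beta> = (\<theta> * a + 1) / (1 - \<theta>)"

lemma \<beta>_eq: "\<theta> * (a + \<beta>) = \<beta> - 1"
  using theta by (simp add: \<beta>_def field_simps)

lemma \<beta>_ge_1: "1 \<le> \<beta>"
  using theta mult_nonneg_nonneg[OF less_imp_le[OF theta(1)] a_nonneg]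
  by (simp add: \<beta>_def pos_le_divide_eq del: mult_nonneg_nonneg)

lemma cone_L_\<beta>: "cone \<beta> g \<Longrightarrow> cone (\<beta> - 1) (L g)"
  using cone_L[of \<beta> g] by (simp add: \<beta>_eq)

lemma cone_L_power: "cone \<beta> g \<Longrightarrow> cone \<beta> ((L ^^ n) g)"
  by (induction n) (auto intro: cone_mono[OF cone_L_\<beta>])

lemma cone_L_power_Suc: "cone \<beta> g \<Longrightarrow> cone (\<beta> - 1) ((L ^^ Suc n) g)"
  using cone_L_power[of g n] by (simp add: cone_L_\<beta>)

text \<open>
  Each preimage of \<open>x\<close> shares its first letter with the reference point of that letter, so the two terms differ at
  most by the distortion at distance \<open>\<theta>\<close>.
\<close>

lemma L_upper:
  assumes g: "cone \<beta> g" shows "L g x \<le> exp (\<beta> - 1) * \<Phi> g"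
proof -
  note b = coneD(1)[OF g]
  have "w (cons_seq i x) * g (cons_seq i x) \<le> exp (\<beta> - 1) * (wt i * g (rp i))" for i
  proof (cases "cons_seq i x \<in> E")
    case True
    then have i: "i \<in> I" by (simp add: cons_in_E)
    have "w (cons_seq i x) * g (cons_seq i x) \<le> exp ((a + \<beta>) * \<theta> ^ 1) * (w (rp i) * g (rp i))"
      using True rp[OF i] by (intro w_cone_compare[OF g]) (auto simp: agree_1_iff)
    moreover have "(a + \<beta>) * \<theta> ^ 1 = \<beta> - 1" using \<beta>_eq by (simp add: mult.commute)
    ultimately show ?thesis using i by (simp add: wt_def)
  qed (simp add: w_off wt_nonneg coneD(2)[OF g])
  then have "L g x \<le> (\<Sum>i. exp (\<beta> - 1) * (wt i * g (rp i)))"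
    unfolding L_def ker_op_def by (intro suminf_le L_summable summable_mult \<Phi>_summable b)
  then show ?thesis unfolding \<Phi>_def suminf_mult[OF \<Phi>_summable[OF b]] .
qed

text \<open>
  A lower bound for the weight along the word \<open>v\<close> that holds whatever sequence follows \<open>v\<close>.
\<close>

definition path_weight :: "nat list \<Rightarrow> real" where
  "path_weight v = (\<Prod>i\<leftarrow>v. exp (- a * \<theta>) * wt i)"

lemma path_weight_simps [simp]: "path_weight [] = 1"
  "path_weight (i # v) = exp (- a * \<theta>) * wt i * path_weight v"
  by (simp_all add: path_weight_def)

lemma path_weight_pos: "set v \<subseteq> I \<Longrightarrow> 0 < path_weight v"
  by (induction v) (auto simp: wt_pos)

lemma w_lower: "y \<in> E \<Longrightarrow> exp (- a * \<theta>) * wt (y 0) \<le> w y"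
proof -
  assume y: "y \<in> E"
  then have i: "y 0 \<in> I" by (rule head_in_I)
  have "w (rp (y 0)) \<le> exp (a * \<theta> ^ 1) * w y"
    using y rp[OF i] by (intro w_compare) (auto simp: agree_1_iff)
  then have "exp (- a * \<theta>) * w (rp (y 0)) \<le> exp (- a * \<theta>) * (exp (a * \<theta> ^ 1) * w y)"
    by (intro mult_left_mono) auto
  then show ?thesis using i by (simp add: wt_def mult.assoc[symmetric] exp_add[symmetric])
qed

lemma L_term_le:
  assumes "bdd g" "\<And>x. 0 \<le> g x" shows "w (cons_seq i x) * g (cons_seq i x) \<le> L g x"
  using sum_le_suminf[OF L_summable[OF assms(1)], of "{i}" x] assms(2) w_nonneg
  by (simp add: L_def ker_op_def)

text \<open>
  A single word already bounds the iterate from below, uniformly in the point that it is attached to.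
\<close>

lemma L_power_path:
  assumes "bdd g" "\<And>x. 0 \<le> g x"
  shows "path_weight v * g (prepend v x) \<le> (L ^^ length v) g x"
  using assms
proof (induction v arbitrary: g)
  case (Cons i v)
  let ?y = "cons_seq i (prepend v x)"
  have Lg: "bdd (L g)" "0 \<le> L g y" for y using linear_positiveD[OF lp_L] Cons.prems by auto
  have pw: "0 \<le> path_weight v"
    by (induction v) (auto intro!: mult_nonneg_nonneg simp: wt_nonneg)
  have "exp (- a * \<theta>) * wt i * g ?y \<le> w ?y * g ?y"
    using w_lower[of ?y] Cons.prems(2)[of ?y] bdd_off[OF Cons.prems(1), of ?y]
    by (cases "?y \<in> E") (auto intro: mult_right_mono)
  also have "\<dots> \<le> L g (prepend v x)" by (rule L_term_le[OF Cons.prems])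
  finally have "path_weight v * (exp (- a * \<theta>) * wt i * g ?y) \<le> path_weight v * L g (prepend v x)"
    using pw by (rule mult_left_mono)
  also have "\<dots> \<le> (L ^^ length v) (L g) x" by (rule Cons.IH[OF Lg])
  finally show ?case by (simp add: funpow_swap1 ac_simps)
qed simp

definition \<kappa> :: real where "\<kappa> = Min (insert 1 (path_weight ` \<Lambda>))"

lemma \<kappa>_pos: "0 < \<kappa>"
  unfolding \<kappa>_def using finite_\<Lambda> path_weight_pos[OF \<Lambda>_letters] by (subst Min_gr_iff) auto

lemma \<kappa>_le: "\<omega> \<in> \<Lambda> \<Longrightarrow> \<kappa> \<le> path_weight \<omega>"
  unfolding \<kappa>_def using finite_\<Lambda> by (intro Min_le) auto

lemma reach_lower:
  assumes g: "bdd g" "\<And>x. 0 \<le> g x" and \<omega>: "\<omega> \<in> \<Lambda>"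
  shows "\<kappa> * g (prepend \<omega> x) \<le> (\<Sum>k<m. (L ^^ k) g x)"
proof -
  have nn: "0 \<le> (L ^^ k) g x" for k using linear_positiveD(4)[OF lp_power[OF lp_L]] g by blast
  have "\<kappa> * g (prepend \<omega> x) \<le> path_weight \<omega> * g (prepend \<omega> x)"
    using \<kappa>_le[OF \<omega>] g(2) by (rule mult_right_mono)
  also have "\<dots> \<le> (L ^^ length \<omega>) g x" by (rule L_power_path[OF g])
  also have "\<dots> \<le> (\<Sum>k<m. (L ^^ k) g x)"
    using length_less_m[OF \<omega>] nn by (intro member_le_sum) auto
  finally show ?thesis .
qed

text \<open>
  The average starts at the first power: one application of \<open>L\<close> evaluates a function in the cone on all
  letters, and up to \<open>m - 1\<close> further ones lead from there to an arbitrary point.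
\<close>

definition Q :: "(seq \<Rightarrow> real) \<Rightarrow> seq \<Rightarrow> real" where
  "Q g x = 1 / real m * (\<Sum>k<m. (L ^^ Suc k) g x)"

lemma lp_Q: "linear_positive Q"
  unfolding Q_def[abs_def] by (intro lp_average lp_power lp_L) auto

lemma cone_Q: "cone \<beta> g \<Longrightarrow> cone (\<beta> - 1) (Q g)"
  unfolding Q_def[abs_def] by (intro cone_cmult cone_sum cone_L_power_Suc) auto

definition c_low :: real where "c_low = \<kappa> * exp (1 - \<beta>) / (real m * real (card \<Lambda>))"

lemma c_low_pos: "0 < c_low"
  using \<kappa>_pos m_pos finite_\<Lambda> \<Lambda>_nonempty by (simp add: c_low_def card_gt_0_iff)

text \<open>
  Every letter \<open>i\<close> is joined to \<open>x\<close> by some word of \<open>\<Lambda>\<close>. Summing the lower bounds along these words over all of \<open>\<Lambda>\<close>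
  counts each letter at least once, at the cost of the factor \<open>card \<Lambda>\<close>.
\<close>

lemma Q_lower:
  assumes g: "cone \<beta> g" and x: "x \<in> E" shows "c_low * \<Phi> g \<le> Q g x"
proof -
  note b = coneD(1)[OF g] and nn = coneD(2)[OF g]
  have Lb: "bdd (L g)" and Lnn: "0 \<le> L g y" for y using linear_positiveD[OF lp_L] b nn by auto
  let ?S = "\<Sum>k<m. (L ^^ k) (L g) x"
  have card: "0 < real (card \<Lambda>)" using finite_\<Lambda> \<Lambda>_nonempty by (simp add: card_gt_0_iff)
  have "exp (1 - \<beta>) * \<Phi> g = (\<Sum>i. exp (1 - \<beta>) * (wt i * g (rp i)))"
    unfolding \<Phi>_def suminf_mult[OF \<Phi>_summable[OF b]] ..
  also have "\<dots> \<le> (\<Sum>i. \<Sum>\<omega>\<in>\<Lambda>. w (cons_seq i (prepend \<omega> x)) * g (cons_seq i (prepend \<omega> x)))"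
  proof (rule suminf_le)
    fix i
    have nnt: "0 \<le> w (cons_seq i (prepend \<omega> x)) * g (cons_seq i (prepend \<omega> x))" for \<omega>
      using w_nonneg nn by (rule mult_nonneg_nonneg)
    show "exp (1 - \<beta>) * (wt i * g (rp i))
        \<le> (\<Sum>\<omega>\<in>\<Lambda>. w (cons_seq i (prepend \<omega> x)) * g (cons_seq i (prepend \<omega> x)))"
    proof (cases "i \<in> I")
      case True
      then obtain \<omega> where \<omega>: "\<omega> \<in> \<Lambda>" "cons_seq i (prepend \<omega> x) \<in> E" using connect x by blast
      let ?y = "cons_seq i (prepend \<omega> x)"
      have "w (rp i) * g (rp i) \<le> exp ((a + \<beta>) * \<theta> ^ 1) * (w ?y * g ?y)"
        using \<omega> rp[OF True] by (intro w_cone_compare[OF g]) (auto simp: agree_1_iff)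
      also have "(a + \<beta>) * \<theta> ^ 1 = \<beta> - 1" using \<beta>_eq by (simp add: mult.commute)
      finally have "exp (1 - \<beta>) * (wt i * g (rp i)) \<le> exp (1 - \<beta>) * (exp (\<beta> - 1) * (w ?y * g ?y))"
        using True by (intro mult_left_mono) (auto simp: wt_def)
      also have "\<dots> = w ?y * g ?y" by (simp add: mult.assoc[symmetric] exp_add[symmetric])
      also have "\<dots> \<le> (\<Sum>\<omega>\<in>\<Lambda>. w (cons_seq i (prepend \<omega> x)) * g (cons_seq i (prepend \<omega> x)))"
        using \<omega>(1) finite_\<Lambda> nnt
        by (intro member_le_sum[of \<omega> \<Lambda> "\<lambda>\<omega>. w (cons_seq i (prepend \<omega> x)) * g (cons_seq i (prepend \<omega> x))"]) auto
      finally show ?thesis .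
    next
      case False
      then show ?thesis using nnt by (simp add: wt_def sum_nonneg)
    qed
  qed (intro summable_mult \<Phi>_summable summable_sum L_summable b)+
  also have "\<dots> = (\<Sum>\<omega>\<in>\<Lambda>. L g (prepend \<omega> x))"
    unfolding L_def ker_op_def by (intro suminf_sum L_summable b)
  also have "\<dots> \<le> (\<Sum>\<omega>\<in>\<Lambda>. ?S / \<kappa>)"
    using reach_lower[OF Lb Lnn] \<kappa>_pos by (intro sum_mono) (simp add: pos_le_divide_eq mult.commute)
  also have "\<dots> = real (card \<Lambda>) * ?S / \<kappa>" by simp
  finally have "\<kappa> * exp (1 - \<beta>) * \<Phi> g \<le> real (card \<Lambda>) * ?S"
    using \<kappa>_pos by (simp add: pos_le_divide_eq ac_simps)
  then have "\<kappa> * exp (1 - \<beta>) * \<Phi> g / (real m * real (card \<Lambda>)) \<le> 1 / real m * ?S"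
    using m_pos card by (simp add: field_simps)
  moreover have "?S = (\<Sum>k<m. (L ^^ Suc k) g x)" by (simp add: funpow_swap1)
  ultimately show ?thesis unfolding c_low_def Q_def by simp
qed

lemma L_power_Q:
  assumes "bdd g" shows "(L ^^ k) (Q g) = (\<lambda>x. 1 / real m * (\<Sum>j<m. (L ^^ (k + Suc j)) g x))"
proof -
  note P = linear_positiveD[OF lp_power[OF lp_L]]
  have "(L ^^ k) (Q g) = (\<lambda>x. 1 / real m * (L ^^ k) (\<lambda>x. \<Sum>j<m. (L ^^ Suc j) g x) x)"
    unfolding Q_def[abs_def] by (intro P(3) bdd_sum P(1) assms)
  also have "(L ^^ k) (\<lambda>x. \<Sum>j<m. (L ^^ Suc j) g x) = (\<lambda>x. \<Sum>j<m. (L ^^ k) ((L ^^ Suc j) g) x)"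
    by (intro lp_sum[OF lp_power[OF lp_L]] P(1) assms)
  finally show ?thesis by (simp only: funpow_add o_def)
qed

lemma average_le: "(\<And>j. j < m \<Longrightarrow> f j \<le> B) \<Longrightarrow> 1 / real m * (\<Sum>j<m. f j) \<le> B"
proof -
  assume "\<And>j. j < m \<Longrightarrow> f j \<le> B"
  then have "(\<Sum>j<m. f j) \<le> (\<Sum>j<m. B)" by (intro sum_mono) auto
  then show ?thesis using m_pos by (simp add: field_simps)
qed

lemma average_ge: "(\<And>j. j < m \<Longrightarrow> B \<le> f j) \<Longrightarrow> B \<le> 1 / real m * (\<Sum>j<m. f j)"
proof -
  assume "\<And>j. j < m \<Longrightarrow> B \<le> f j"
  then have "(\<Sum>j<m. B) \<le> (\<Sum>j<m. f j)" by (intro sum_mono) auto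
  then show ?thesis using m_pos by (simp add: field_simps)
qed

end

section \<open>Spectral gap of the averaged operator\<close>

lemma sum_fun_apply: "(\<Sum>i\<in>S. F i) x = (\<Sum>i\<in>S. (F i x :: 'b::comm_monoid_add))"
  by (induction S rule: infinite_finite_induct) simp_all

lemma exp_minus_one_le: "0 \<le> p \<Longrightarrow> exp p - 1 \<le> p * exp (p::real)"
proof -
  have "exp p * (1 - p) \<le> exp p * exp (- p)"
    using exp_ge_add_one_self[of "-p"] by (intro mult_left_mono) auto
  then show ?thesis by (simp add: exp_minus algebra_simps)
qed

text \<open>
  Growth bounds that express that the leading eigenvalue of \<open>L\<close> is 1. They are derived from zero pressure
  further below.
\<close>

locale normalized_system = transfer_system +
  fixes C0 c0 :: real
  assumes L_power_upper: "(L ^^ n) unit x \<le> C0"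
    and Q_L_power_lower: "x \<in> E \<Longrightarrow> c0 \<le> Q ((L ^^ n) unit) x"
    and c0_pos: "0 < c0"
begin

lemma C0_ge_1: "1 \<le> C0"
proof -
  obtain x where "x \<in> E" using E_nonempty by blast
  then show ?thesis using L_power_upper[of 0 x] by (simp add: unit_def)
qed

definition Cup :: real where "Cup = exp (\<beta> - 1) * C0"

lemma Cup_pos: "0 < Cup" using C0_ge_1 by (simp add: Cup_def)

lemma Q_upper:
  assumes g: "cone \<beta> g" shows "Q g x \<le> Cup * \<Phi> g"
proof -
  note b = coneD(1)[OF g]
  let ?c = "exp (\<beta> - 1) * \<Phi> g"
  have c: "0 \<le> ?c" using \<Phi>_nonneg[OF b] coneD(2)[OF g] by simp
  have Lg: "L g y \<le> ?c * unit y" for y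
    using L_upper[OF g, of y] bdd_off[OF L_bdd[OF b], of y] by (simp add: unit_def)
  have "(L ^^ Suc k) g x \<le> ?c * C0" for k
  proof -
    have "(L ^^ Suc k) g x = (L ^^ k) (L g) x" by (simp add: funpow_swap1)
    also have "\<dots> \<le> (L ^^ k) (\<lambda>y. ?c * unit y) x"
      by (intro lp_mono[OF lp_power[OF lp_L]] L_bdd b bdd_cmult bdd_unit Lg)
    also have "\<dots> = ?c * (L ^^ k) unit x"
      using linear_positiveD(3)[OF lp_power[OF lp_L] bdd_unit] by metis
    also have "\<dots> \<le> ?c * C0" by (intro mult_left_mono L_power_upper c)
    finally show ?thesis .
  qed
  then have "(\<Sum>k<m. (L ^^ Suc k) g x) \<le> (\<Sum>k<m. ?c * C0)" by (intro sum_mono)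
  then have "Q g x \<le> 1 / real m * (\<Sum>k<m. ?c * C0)" unfolding Q_def by (intro mult_left_mono) auto
  also have "\<dots> = Cup * \<Phi> g" using m_pos by (simp add: Cup_def)
  finally show ?thesis .
qed

subsection \<open>Iterates of the averaged operator\<close>

definition q :: "nat \<Rightarrow> seq \<Rightarrow> real" where "q n = (Q ^^ n) unit"

lemma q_simps: "q 0 = unit" "q (Suc n) = Q (q n)" by (simp_all add: q_def)

lemma bdd_q: "bdd (q n)" unfolding q_def by (rule linear_positiveD(1)[OF lp_power[OF lp_Q] bdd_unit])

lemma L_power_q_upper: "(L ^^ k) (q n) x \<le> C0"
proof (induction n arbitrary: k)
  case 0 show ?case using L_power_upper by (simp add: q_simps)
next
  case (Suc n)
  show ?case unfolding q_simps L_power_Q[OF bdd_q] by (intro average_le Suc)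
qed

lemma Q_L_power_q_lower: "x \<in> E \<Longrightarrow> c0 \<le> Q ((L ^^ k) (q n)) x"
proof (induction n arbitrary: k)
  case 0 then show ?case using Q_L_power_lower by (simp add: q_simps)
next
  case (Suc n)
  note P = linear_positiveD(1)[OF lp_power[OF lp_L] bdd_q]
  have "Q ((L ^^ k) (q (Suc n))) x = 1 / real m * (\<Sum>j<m. Q ((L ^^ (k + Suc j)) (q n)) x)"
    unfolding q_simps L_power_Q[OF bdd_q]
    by (simp only: linear_positiveD(3)[OF lp_Q bdd_sum[OF P]] lp_sum[OF lp_Q P])
  then show ?case by (simp only:) (intro average_ge Suc)
qed

definition c1 :: real where "c1 = min 1 c0"

lemma c1_pos: "0 < c1" using c0_pos by (simp add: c1_def)

lemma q_upper: "q n x \<le> C0" using L_power_q_upper[of 0 n x] by simp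

lemma q_lower: "x \<in> E \<Longrightarrow> c1 \<le> q n x"
  using Q_L_power_q_lower[of x 0 "n - 1"] by (cases n) (auto simp: q_simps c1_def unit_def)

text \<open>
  The sums of \<open>Q ^^ j\<close> applied to \<open>G - Q G\<close> telescope and stay bounded, whereas those of a function above \<open>c\<close> grow
  at least linearly. This single obstruction yields both that 1 is an eigenvalue of \<open>Q\<close> and that the
  eigenfunctional charges every nonzero nonnegative function.
\<close>

lemma no_positive_coboundary:
  assumes G: "bdd G" and c: "0 < c" and le: "\<And>x. x \<in> E \<Longrightarrow> c \<le> G x - Q G x"
  shows False
proof -
  obtain x where x: "x \<in> E" using E_nonempty by blast
  obtain B where B: "0 \<le> B" "\<And>y. \<bar>G y\<bar> \<le> B" using bddE[OF G] by metis
  note P = linear_positiveD[OF lp_power[OF lp_Q]]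
  have Gu: "\<bar>G y\<bar> \<le> B * unit y" for y using B bdd_off[OF G, of y] by (auto simp: unit_def)
  have QG: "bdd (Q G)" by (rule linear_positiveD(1)[OF lp_Q G])
  have step: "c * c1 \<le> (Q ^^ j) G x - (Q ^^ Suc j) G x" for j
  proof -
    have "c * unit y \<le> G y - Q G y" for y
      using le[of y] bdd_off[OF G, of y] bdd_off[OF QG, of y] by (cases "y \<in> E") (auto simp: unit_def)
    then have "(Q ^^ j) (\<lambda>y. c * unit y) x \<le> (Q ^^ j) (\<lambda>y. G y - Q G y) x"
      by (intro lp_mono[OF lp_power[OF lp_Q]] bdd_cmult bdd_unit bdd_diff G QG)
    also have "\<dots> = (Q ^^ j) G x - (Q ^^ Suc j) G x"
      using lp_diff[OF lp_power[OF lp_Q] G QG, of j] by (simp add: funpow_swap1)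
    finally have "c * q j x \<le> (Q ^^ j) G x - (Q ^^ Suc j) G x"
      using P(3)[OF bdd_unit, of j c] by (simp add: q_def)
    moreover have "c * c1 \<le> c * q j x" using q_lower[OF x] c by (intro mult_left_mono) auto
    ultimately show ?thesis by linarith
  qed
  have "real n * (c * c1) \<le> G x - (Q ^^ n) G x" for n
  proof (induction n)
    case (Suc n) then show ?case using step[of n] by (simp add: distrib_right del: funpow.simps)
  qed simp
  moreover have "- ((Q ^^ n) G x) \<le> B * C0" for n
  proof -
    have "- ((Q ^^ n) G x) = (Q ^^ n) (\<lambda>y. - 1 * G y) x" using P(3)[OF G, of n "-1"] by simp
    also have "\<dots> \<le> (Q ^^ n) (\<lambda>y. B * unit y) x"
      using Gu by (intro lp_mono[OF lp_power[OF lp_Q]] bdd_cmult bdd_unit G) (simp add: abs_le_iff)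
    also have "\<dots> = B * q n x" using P(3)[OF bdd_unit, of n B] by (simp add: q_def)
    also have "\<dots> \<le> B * C0" using B(1) q_upper by (intro mult_left_mono)
    finally show ?thesis .
  qed
  ultimately have bound: "real n * (c * c1) \<le> B + B * C0" for n
    using B(2)[of x] by (smt (verit))
  have "0 < c * c1" using c c1_pos by simp
  then obtain n where "B + B * C0 < real n * (c * c1)" using reals_Archimedean3 by blast
  with bound[of n] show False by simp
qed

subsection \<open>Removing a rank one part\<close>

text \<open>
  Small enough for the rank one part \<open>\<epsilon> \<Phi>(.) 1\<close> to be subtracted from \<open>Q\<close> without leaving the cone.
\<close>

definition \<epsilon> :: real where "\<epsilon> = c_low / (2 * \<beta> * exp \<beta>)"

lemma \<epsilon>_pos: "0 < \<epsilon>" using c_low_pos \<beta>_ge_1 by (simp add: \<epsilon>_def)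

lemma \<epsilon>_le: "\<epsilon> * (\<beta> * exp \<beta>) = c_low / 2" "\<epsilon> \<le> c_low / 2"
proof -
  show eq: "\<epsilon> * (\<beta> * exp \<beta>) = c_low / 2" using \<beta>_ge_1 by (simp add: \<epsilon>_def)
  have "1 * 1 \<le> \<beta> * exp \<beta>" using \<beta>_ge_1 by (intro mult_mono) auto
  then have "\<epsilon> * 1 \<le> \<epsilon> * (\<beta> * exp \<beta>)" using \<epsilon>_pos by (intro mult_left_mono) auto
  then show "\<epsilon> \<le> c_low / 2" using eq by simp
qed

definition K :: "(seq \<Rightarrow> real) \<Rightarrow> seq \<Rightarrow> real" where
  "K g x = Q g x - \<epsilon> * \<Phi> g * unit x"

lemma K_bdd: "bdd g \<Longrightarrow> bdd (K g)"
  unfolding K_def[abs_def] by (intro bdd_diff linear_positiveD(1)[OF lp_Q] bdd_cmult bdd_unit)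

lemma K_add: "bdd f \<Longrightarrow> bdd g \<Longrightarrow> K (\<lambda>x. f x + g x) = (\<lambda>x. K f x + K g x)"
  by (rule ext) (simp add: K_def linear_positiveD(2)[OF lp_Q] \<Phi>_add algebra_simps)

lemma K_cmult: "bdd f \<Longrightarrow> K (\<lambda>x. c * f x) = (\<lambda>x. c * K f x)"
  by (rule ext) (simp add: K_def linear_positiveD(3)[OF lp_Q] \<Phi>_cmult algebra_simps)

lemma K_zero: "K (\<lambda>x. 0) = (\<lambda>x. 0)"
  using K_cmult[OF bdd_unit, of 0] by simp

lemma K_sum: "(\<And>i. i \<in> S \<Longrightarrow> bdd (F i)) \<Longrightarrow> K (\<lambda>x. \<Sum>i\<in>S. F i x) = (\<lambda>x. \<Sum>i\<in>S. K (F i) x)"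
proof (induction S rule: infinite_finite_induct)
  case (insert j S)
  then show ?case using K_add[of "F j" "\<lambda>x. \<Sum>i\<in>S. F i x"] bdd_sum[of S F] by simp
qed (simp_all add: K_zero)

lemma K_power_bdd: "bdd g \<Longrightarrow> bdd ((K ^^ n) g)"
  by (induction n) (auto intro: K_bdd)

lemma K_power_add: "bdd f \<Longrightarrow> bdd g \<Longrightarrow> (K ^^ n) (\<lambda>x. f x + g x) = (\<lambda>x. (K ^^ n) f x + (K ^^ n) g x)"
  by (induction n) (simp_all add: K_add K_power_bdd)

lemma K_power_cmult: "bdd f \<Longrightarrow> (K ^^ n) (\<lambda>x. c * f x) = (\<lambda>x. c * (K ^^ n) f x)"
  by (induction n) (simp_all add: K_cmult K_power_bdd)

lemma K_lower:
  assumes g: "cone \<beta> g" and x: "x \<in> E" shows "c_low / 2 * \<Phi> g \<le> K g x"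
proof -
  have "\<epsilon> * \<Phi> g \<le> c_low / 2 * \<Phi> g"
    using \<epsilon>_le(2) \<Phi>_nonneg[OF coneD(1)[OF g] coneD(2)[OF g]] by (rule mult_right_mono)
  then show ?thesis using Q_lower[OF g x] x by (simp add: K_def unit_def)
qed

lemma K_upper:
  assumes g: "cone \<beta> g" shows "K g x \<le> Cup * \<Phi> g"
  using Q_upper[OF g, of x] mult_nonneg_nonneg[OF less_imp_le[OF \<epsilon>_pos]
      \<Phi>_nonneg[OF coneD(1)[OF g] coneD(2)[OF g]]]
  by (auto simp add: K_def unit_def simp del: mult_nonneg_nonneg)

text \<open>
  \<open>Q g\<close> lies in the cone of aperture \<open>\<beta> - 1\<close> and is at least \<open>c_low * \<Phi> g\<close>, so enlarging the aperture to \<open>\<beta>\<close> gains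
  \<open>t * Q g\<close> at distance \<open>t\<close>, which dominates the loss \<open>\<epsilon> * \<Phi> g * (exp (\<beta> * t) - 1)\<close> from the constant.
\<close>

lemma cone_K:
  assumes g: "cone \<beta> g" shows "cone \<beta> (K g)"
proof (rule coneI)
  have \<Phi>0: "0 \<le> \<Phi> g" using \<Phi>_nonneg[OF coneD(1)[OF g] coneD(2)[OF g]] .
  show "bdd (K g)" by (rule K_bdd[OF coneD(1)[OF g]])
  show "0 \<le> K g x" if "x \<in> E" for x
    using K_lower[OF g that] c_low_pos \<Phi>0 by (smt (verit) mult_nonneg_nonneg half_gt_zero)
  fix n :: nat and x y assume a: "1 \<le> n" "x \<in> E" "y \<in> E" "agree n x y"
  define t where "t = \<theta> ^ n"
  have t: "0 < t" "t \<le> 1" using theta_power[of n] by (auto simp: t_def)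
  define s where "s = \<epsilon> * \<Phi> g"
  have s: "0 \<le> s" using \<epsilon>_pos \<Phi>0 by (simp add: s_def)
  have b: "0 \<le> \<beta>" using \<beta>_ge_1 by simp
  have "s * (exp (\<beta> * t) - 1) \<le> s * (\<beta> * t * exp \<beta>)"
  proof (rule mult_left_mono[OF _ s])
    have "exp (\<beta> * t) - 1 \<le> \<beta> * t * exp (\<beta> * t)" using b t by (intro exp_minus_one_le) auto
    also have "\<dots> \<le> \<beta> * t * exp \<beta>" using b t by (intro mult_left_mono) (auto simp: mult_left_le)
    finally show "exp (\<beta> * t) - 1 \<le> \<beta> * t * exp \<beta>" .
  qed
  also have "\<dots> = t * (\<epsilon> * (\<beta> * exp \<beta>)) * \<Phi> g" by (simp add: s_def ac_simps)
  also have "\<dots> = t * (c_low / 2 * \<Phi> g)" by (simp add: \<epsilon>_le(1))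
  also have "\<dots> \<le> t * Q g y"
  proof -
    have "0 \<le> c_low * \<Phi> g" using c_low_pos \<Phi>0 by simp
    then show ?thesis using Q_lower[OF g a(3)] t by (intro mult_left_mono) auto
  qed
  also have "\<dots> \<le> (exp (\<beta> * t) - exp ((\<beta> - 1) * t)) * Q g y"
  proof (rule mult_right_mono)
    have "t \<le> exp t - 1" using exp_ge_add_one_self[of t] by linarith
    then have "1 * t \<le> exp ((\<beta> - 1) * t) * (exp t - 1)"
      using t \<beta>_ge_1 by (intro mult_mono) auto
    also have "\<dots> = exp (\<beta> * t) - exp ((\<beta> - 1) * t)"
      by (simp add: algebra_simps exp_add[symmetric])
    finally show "t \<le> exp (\<beta> * t) - exp ((\<beta> - 1) * t)" by simp
    show "0 \<le> Q g y" using linear_positiveD(4)[OF lp_Q coneD(1)[OF g] coneD(2)[OF g]] .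
  qed
  finally have "exp ((\<beta> - 1) * t) * Q g y - s \<le> exp (\<beta> * t) * (Q g y - s)"
    by (simp add: algebra_simps)
  moreover have "Q g x \<le> exp ((\<beta> - 1) * t) * Q g y"
    using coneD(3)[OF cone_Q[OF g] a] by (simp add: t_def)
  ultimately show "K g x \<le> exp (\<beta> * \<theta> ^ n) * K g y"
    using a by (simp add: K_def unit_def s_def[symmetric] t_def[symmetric])
qed

lemma cone_K_power: "cone \<beta> g \<Longrightarrow> cone \<beta> ((K ^^ n) g)"
  by (induction n) (auto intro: cone_K)

definition k :: "nat \<Rightarrow> seq \<Rightarrow> real" where "k n = (K ^^ n) unit"

lemma cone_k: "cone \<beta> (k n)"
  unfolding k_def using \<beta>_ge_1 by (intro cone_K_power cone_unit) auto

lemma k_simps: "k 0 = unit" "k (Suc n) = K (k n)" by (simp_all add: k_def)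

lemmas bdd_k = coneD(1)[OF cone_k] and k_nonneg = coneD(2)[OF cone_k]

definition H :: real where "H = max 1 (2 * Cup / c_low)"

lemma k_oscillation: "y \<in> E \<Longrightarrow> k n x \<le> H * k n y"
proof (cases n)
  case 0
  assume "y \<in> E" then show ?thesis using 0 by (auto simp: k_simps unit_def H_def)
next
  case (Suc j)
  assume y: "y \<in> E"
  have "k n x \<le> Cup * \<Phi> (k j)" using K_upper[OF cone_k] Suc by (simp add: k_simps)
  also have "\<dots> = 2 * Cup / c_low * (c_low / 2 * \<Phi> (k j))" using c_low_pos by simp
  also have "\<dots> \<le> 2 * Cup / c_low * k n y"
    using K_lower[OF cone_k y, of j] Suc Cup_pos c_low_pos by (intro mult_left_mono) (auto simp: k_simps)
  also have "\<dots> \<le> H * k n y" using k_nonneg by (intro mult_right_mono) (auto simp: H_def)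
  finally show ?thesis .
qed

text \<open>
  Expansion of \<open>Q ^^ n = (K + \<epsilon> \<Phi>(.) 1) ^^ n\<close> according to the last occurrence of the rank one part.
\<close>

lemma renewal: "q n x = k n x + (\<Sum>j<n. \<epsilon> * \<Phi> (q (n - Suc j)) * k j x)"
proof (induction n arbitrary: x)
  case 0 show ?case by (simp add: q_simps k_simps)
next
  case (Suc n)
  have q: "q n = (\<lambda>x. k n x + (\<Sum>j<n. \<epsilon> * \<Phi> (q (n - Suc j)) * k j x))" using Suc by auto
  have "q (Suc n) x = K (q n) x + \<epsilon> * \<Phi> (q n) * unit x" by (simp add: q_simps K_def)
  also have "K (q n) x = k (Suc n) x + (\<Sum>j<n. \<epsilon> * \<Phi> (q (n - Suc j)) * k (Suc j) x)"
    by (subst q) (simp only: K_add[OF bdd_k bdd_sum[OF bdd_cmult[OF bdd_k]]]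
        K_sum[OF bdd_cmult[OF bdd_k]] K_cmult[OF bdd_k] k_simps)
  finally show ?case by (simp add: sum.lessThan_Suc_shift k_simps(1) del: sum.lessThan_Suc)
qed

text \<open>
  In the renewal expansion the coefficients \<open>\<Phi> (q i)\<close> are bounded below while the left side is bounded
  above. So the iterates of \<open>K\<close>, unlike those of \<open>Q\<close>, are summable: this is the spectral gap.
\<close>

lemma k_partial_sums: 
  assumes x: "x \<in> E" shows "(\<Sum>j<n. k j x) \<le> C0 / (\<epsilon> * (c1 * \<Phi> unit))"
proof -
  have pos: "0 < \<epsilon> * (c1 * \<Phi> unit)" using \<epsilon>_pos c1_pos \<Phi>_unit_pos by simp
  have "\<epsilon> * (c1 * \<Phi> unit) * (\<Sum>j<n. k j x) = (\<Sum>j<n. \<epsilon> * (c1 * \<Phi> unit) * k j x)"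
    by (rule sum_distrib_left)
  also have "\<dots> \<le> (\<Sum>j<n. \<epsilon> * \<Phi> (q (n - Suc j)) * k j x)"
  proof (intro sum_mono mult_right_mono mult_left_mono k_nonneg)
    fix i
    have "c1 * \<Phi> unit = \<Phi> (\<lambda>x. c1 * unit x)" by (rule \<Phi>_cmult[OF bdd_unit, symmetric])
    also have "\<dots> \<le> \<Phi> (q i)"
      using q_lower by (intro \<Phi>_mono bdd_cmult bdd_unit bdd_q) (simp add: unit_def)
    finally show "c1 * \<Phi> unit \<le> \<Phi> (q i)" .
  qed (use \<epsilon>_pos in simp)
  also have "\<dots> \<le> q n x" using renewal[of n x] k_nonneg[of n x] by simp
  also have "\<dots> \<le> C0" by (rule q_upper)
  finally show ?thesis using pos by (simp add: pos_le_divide_eq mult.commute)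
qed

lemma k_summable: "summable (\<lambda>n. k n x)"
proof (cases "x \<in> E")
  case True
  then show ?thesis using k_partial_sums k_nonneg by (intro summableI_nonneg_bounded) auto
next
  case False
  then show ?thesis using bdd_off[OF bdd_k] by simp
qed

definition base :: seq where "base = (SOME x. x \<in> E)"

lemma base: "base \<in> E" unfolding base_def using E_nonempty by (rule some_in_eq[THEN iffD2])

lemma k_le_base: "k n x \<le> H * k n base" using k_oscillation[OF base] .

definition h :: "seq \<Rightarrow> real" where "h x = (\<Sum>n. k n x)"

lemma h_ge_unit: "unit x \<le> h x"
proof -
  have "(\<Sum>n\<in>{0}. k n x) \<le> h x" unfolding h_def
    by (rule sum_le_suminf[OF k_summable]) (auto simp: k_nonneg)
  then show ?thesis by (simp add: k_simps)
qed

subsection \<open>The complex operators\<close>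

definition ofr :: "(seq \<Rightarrow> real) \<Rightarrow> seq \<Rightarrow> complex" where "ofr g x = complex_of_real (g x)"

definition Lc :: "(seq \<Rightarrow> complex) \<Rightarrow> seq \<Rightarrow> complex" where
  "Lc = ker_op (\<lambda>y. complex_of_real (w y))"

definition \<phi> :: "(seq \<Rightarrow> complex) \<Rightarrow> complex" where
  "\<phi> f = complex_of_real \<epsilon> * (\<Sum>i. complex_of_real (wt i) * f (rp i))"

definition e :: "seq \<Rightarrow> complex" where "e = ofr unit"

lemma kernel_c: "kernel (\<lambda>y. complex_of_real (w y)) M"
  using w_kernel unfolding kernel_def
  by (simp add: of_real_diff[symmetric] norm_of_real del: of_real_diff)

lemma Lc_ops: "Lc \<in> ops" unfolding Lc_def by (rule ker_op_in_ops[OF kernel_c])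

lemma ofr_in_V:
  assumes "bdd g" "\<And>x. \<bar>g x\<bar> \<le> B" "lip g b" "0 \<le> b"
  shows "ofr g \<in> V" "N (ofr g) \<le> B + b"
proof -
  have "lip (ofr g) b" using assms(3) unfolding lip_def ofr_def
    by (simp add: of_real_diff[symmetric] norm_of_real del: of_real_diff)
  then show "ofr g \<in> V" "N (ofr g) \<le> B + b"
    using Fb_memI[of "ofr g" B b] assms bdd_off[OF assms(1)] by (auto simp: ofr_def)
qed

lemma e_in_V: "e \<in> V"
  unfolding e_def by (rule ofr_in_V[where B=1 and b=0]) (auto simp: bdd_unit unit_def lip_def)

lemma Lc_ofr: "bdd g \<Longrightarrow> Lc (ofr g) = ofr (L g)"
proof
  fix x assume "bdd g"
  from summable_sums[OF L_summable[OF this, of x]]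
  have "(\<lambda>i. complex_of_real (w (cons_seq i x) * g (cons_seq i x))) sums complex_of_real (L g x)"
    unfolding L_def ker_op_def by (simp only: sums_of_real_iff)
  then show "Lc (ofr g) x = ofr (L g) x"
    unfolding Lc_def ker_op_def ofr_def by (simp add: sums_unique[symmetric])
qed

lemma Lc_power_ofr: "bdd g \<Longrightarrow> (Lc ^^ n) (ofr g) = ofr ((L ^^ n) g)"
  by (induction n) (simp_all add: Lc_ofr linear_positiveD(1)[OF lp_power[OF lp_L]])

lemma average_ofr: "bdd g \<Longrightarrow> power_average m Lc (ofr g) = ofr (Q g)"
  by (rule ext) (simp only: power_average_def cscale_fun_def cscale_complex_def sum_fun_apply
      Lc_power_ofr, simp add: ofr_def Q_def)

lemma \<phi>_summable: assumes "f \<in> V" shows "summable (\<lambda>i. complex_of_real (wt i) * f (rp i))"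
proof (rule summable_comparison_test'[OF summable_mult2[OF wt_summable, of "N f"], of 0])
  show "norm (complex_of_real (wt i) * f (rp i)) \<le> wt i * N f" for i
    using Fb_bound[OF assms, of "rp i"] wt_nonneg[of i] by (simp add: norm_mult mult_left_mono)
qed

lemma \<phi>_ofr: "bdd g \<Longrightarrow> \<phi> (ofr g) = complex_of_real (\<epsilon> * \<Phi> g)"
proof -
  assume "bdd g"
  from summable_sums[OF \<Phi>_summable[OF this]]
  have "(\<lambda>i. complex_of_real (wt i * g (rp i))) sums complex_of_real (\<Phi> g)"
    unfolding \<Phi>_def by (simp only: sums_of_real_iff)
  then show ?thesis unfolding \<phi>_def ofr_def by (simp add: sums_unique[symmetric])
qed

lemma \<phi>_dual: "\<phi> \<in> dual_space V N"
  unfolding bounded_maps_def mem_Collect_eq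
proof (intro conjI ballI allI)
  show "\<phi> (f + g) = \<phi> f + \<phi> g" if "f \<in> V" "g \<in> V" for f g
    by (simp add: \<phi>_def distrib_left suminf_add[OF \<phi>_summable[OF that(1)] \<phi>_summable[OF that(2)], symmetric])
  show "\<phi> (c *\<^sub>C f) = c *\<^sub>C \<phi> f" if "f \<in> V" for c f
    using suminf_mult[OF \<phi>_summable[OF that], of c]
    by (simp add: \<phi>_def cscale_fun_def cscale_complex_def mult.left_commute)
  have "cmod (\<phi> f) \<le> \<epsilon> * suminf wt * N f" if f: "f \<in> V" for f
  proof -
    have le: "cmod (complex_of_real (wt i) * f (rp i)) \<le> wt i * N f" for i
      using Fb_bound[OF f, of "rp i"] wt_nonneg[of i] by (simp add: norm_mult mult_left_mono)
    have sm: "summable (\<lambda>i. cmod (complex_of_real (wt i) * f (rp i)))"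
      by (rule summable_comparison_test'[OF summable_mult2[OF wt_summable, of "N f"], of 0])
        (use le in simp)
    have "cmod (\<Sum>i. complex_of_real (wt i) * f (rp i)) \<le> (\<Sum>i. wt i * N f)"
      by (rule order_trans[OF summable_norm[OF sm] suminf_le[OF le sm summable_mult2[OF wt_summable]]])
    also have "\<dots> = suminf wt * N f" using suminf_mult2[OF wt_summable] by simp
    finally show ?thesis using \<epsilon>_pos by (simp add: \<phi>_def norm_mult mult_left_mono mult.assoc)
  qed
  then show "\<exists>C. \<forall>f\<in>V. cmod (\<phi> f) \<le> C * N f" by blast
qed simp

definition Kc :: "(seq \<Rightarrow> complex) \<Rightarrow> seq \<Rightarrow> complex" where
  "Kc f = power_average m Lc f - \<phi> f *\<^sub>C e"

lemma Kc_ops: "Kc \<in> ops"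
  unfolding Kc_def[abs_def]
  by (rule diff_in_ops[OF power_average_in_ops[OF Lc_ops] rank_one_in_ops[OF \<phi>_dual e_in_V]])

lemma Kc_ofr: "bdd g \<Longrightarrow> Kc (ofr g) = ofr (K g)"
  by (rule ext) (simp add: Kc_def average_ofr \<phi>_ofr, simp add: ofr_def K_def cscale_fun_def cscale_complex_def e_def)

lemma Kc_power_ofr: "bdd g \<Longrightarrow> (Kc ^^ n) (ofr g) = ofr ((K ^^ n) g)"
  by (induction n) (simp_all add: Kc_ofr K_power_bdd)

text \<open>
  Adding a constant brings every Lipschitz function into the cone, so that cone estimates control \<open>K\<close> on the whole space.
\<close>

lemma cone_translate:
  assumes g: "bdd g" "\<And>x. \<bar>g x\<bar> \<le> B" "lip g B" and B: "0 \<le> B"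
  shows "cone \<beta> (\<lambda>x. g x + 2 * B * unit x)"
proof (rule coneI)
  show "bdd (\<lambda>x. g x + 2 * B * unit x)" by (intro bdd_add g bdd_cmult bdd_unit)
  show "0 \<le> g x + 2 * B * unit x" if "x \<in> E" for x
    using g(2)[of x] that B by (simp add: unit_def abs_le_iff)
  fix n :: nat and x y assume a: "1 \<le> n" "x \<in> E" "y \<in> E" "agree n x y"
  define t where "t = \<theta> ^ n"
  have t: "0 < t" using theta_power[of n] by (auto simp: t_def)
  have gy: "B \<le> g y + 2 * B" using g(2)[of y] by (simp add: abs_le_iff)
  have "g x - g y \<le> B * t" using lipD[OF g(3) a] by (simp add: t_def abs_le_iff)
  also have "\<dots> \<le> (g y + 2 * B) * t" using gy t by (intro mult_right_mono) auto
  finally have "g x + 2 * B \<le> (1 + t) * (g y + 2 * B)" by (simp add: algebra_simps)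
  also have "\<dots> \<le> exp (\<beta> * t) * (g y + 2 * B)"
  proof (rule mult_right_mono)
    have "1 * t \<le> \<beta> * t" using \<beta>_ge_1 t by (intro mult_right_mono) auto
    then show "1 + t \<le> exp (\<beta> * t)" using exp_ge_add_one_self[of "\<beta> * t"] by linarith
  qed (use gy B in simp)
  finally show "g x + 2 * B * unit x \<le> exp (\<beta> * \<theta> ^ n) * (g y + 2 * B * unit y)"
    using a by (simp add: unit_def t_def)
qed

lemma cone_lip:
  assumes P: "cone \<beta> P" and S: "\<And>x. P x \<le> S" shows "lip P (\<beta> * exp \<beta> * S)"
proof (rule lipI)
  fix n :: nat and x y assume a: "1 \<le> n" "x \<in> E" "y \<in> E" "agree n x y"
  define t where "t = \<theta> ^ n"
  have t: "0 < t" "t \<le> 1" using theta_power[of n] by (auto simp: t_def)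
  have b: "0 \<le> \<beta>" using \<beta>_ge_1 by simp
  have *: "P x - P y \<le> \<beta> * exp \<beta> * S * t" if "P x \<le> exp (\<beta> * t) * P y" for x y
  proof -
    have "P x - P y \<le> (exp (\<beta> * t) - 1) * P y" using that by (simp add: algebra_simps)
    also have "\<dots> \<le> (\<beta> * t * exp \<beta>) * S"
    proof (rule mult_mono)
      have "exp (\<beta> * t) - 1 \<le> \<beta> * t * exp (\<beta> * t)" using b t by (intro exp_minus_one_le) auto
      also have "\<dots> \<le> \<beta> * t * exp \<beta>" using b t by (intro mult_left_mono) (auto simp: mult_left_le)
      finally show "exp (\<beta> * t) - 1 \<le> \<beta> * t * exp \<beta>" .
    qed (use S coneD(2)[OF P] b t in auto)
    finally show ?thesis by (simp add: ac_simps)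
  qed
  show "norm (P x - P y) \<le> \<beta> * exp \<beta> * S * \<theta> ^ n"
    using *[OF coneD(3)[OF P a, folded t_def]] *[OF coneD(3)[OF P a(1,3,2) agree_sym[OF a(4)], folded t_def]]
    by (simp add: t_def abs_le_iff)
qed

definition Kconst :: real where "Kconst = 2 * H + 6 * \<beta> * exp \<beta> * H"

text \<open>
  Both \<open>g + 2 B\<close> and \<open>2 B - g\<close> are in the cone. Positivity of \<open>K ^^ n\<close> there bounds \<open>K ^^ n g\<close>
  by \<open>2 B * k n\<close>, and the cone condition bounds its variation.
\<close>

lemma K_power_bound:
  assumes g: "bdd g" "\<And>x. \<bar>g x\<bar> \<le> B" "lip g B" and B: "0 \<le> B"
  shows "ofr ((K ^^ n) g) \<in> V" "N (ofr ((K ^^ n) g)) \<le> Kconst * k n base * B"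
proof -
  let ?s = "2 * B"
  note bu = bdd_cmult[OF bdd_unit]
  have plus: "(K ^^ n) (\<lambda>x. g x + ?s * unit x) = (\<lambda>x. (K ^^ n) g x + ?s * k n x)"
    by (simp add: K_power_add[OF g(1) bu] K_power_cmult[OF bdd_unit] k_def)
  have minus: "(K ^^ n) (\<lambda>x. - g x + ?s * unit x) = (\<lambda>x. - (K ^^ n) g x + ?s * k n x)"
    using K_power_cmult[OF g(1), of n "-1"]
    by (simp only: K_power_add[OF bdd_uminus[OF g(1)] bu] K_power_cmult[OF bdd_unit] k_def
        mult_minus_left mult_1)
  have ng: "lip (\<lambda>x. - g x) B" using g(3) by (simp add: lip_def abs_minus_commute)
  have ng': "\<bar>- g x\<bar> \<le> B" for x using g(2) by simp
  have c1: "cone \<beta> (\<lambda>x. (K ^^ n) g x + ?s * k n x)"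
    using cone_K_power[OF cone_translate[OF g B], of n] by (simp add: plus)
  have c2: "cone \<beta> (\<lambda>x. - (K ^^ n) g x + ?s * k n x)"
    using cone_K_power[OF cone_translate[OF bdd_uminus[OF g(1)] ng' ng B], of n] unfolding minus .
  have abs: "\<bar>(K ^^ n) g x\<bar> \<le> ?s * k n x" for x
    using coneD(2)[OF c1, of x] coneD(2)[OF c2, of x] by (simp add: abs_le_iff)
  define S where "S = H * k n base"
  have S: "k n x \<le> S" for x unfolding S_def by (rule k_le_base)
  have S0: "0 \<le> S" using S[of base] k_nonneg[of n base] by linarith
  have sS: "?s * k n x \<le> ?s * S" for x using B S by (intro mult_left_mono) auto
  have le: "(K ^^ n) g x + ?s * k n x \<le> 4 * B * S" for x
    using abs[of x] sS[of x] by (simp add: abs_le_iff)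
  have lip1: "lip (\<lambda>x. (K ^^ n) g x + ?s * k n x) (\<beta> * exp \<beta> * (4 * B * S))"
    by (rule cone_lip[OF c1 le])
  have lip2: "lip (k n) (\<beta> * exp \<beta> * S)" by (rule cone_lip[OF cone_k S])
  define l where "l = \<beta> * exp \<beta> * (6 * B * S)"
  have l0: "0 \<le> l" using \<beta>_ge_1 B S0 by (simp add: l_def)
  have lip: "lip ((K ^^ n) g) l"
  proof (rule lipI)
    fix j :: nat and x y assume a: "1 \<le> j" "x \<in> E" "y \<in> E" "agree j x y"
    have "?s * \<bar>k n x - k n y\<bar> \<le> ?s * (\<beta> * exp \<beta> * S * \<theta> ^ j)"
      using lipD[OF lip2 a] B by (intro mult_left_mono) auto
    moreover have "\<bar>((K ^^ n) g x + ?s * k n x) - ((K ^^ n) g y + ?s * k n y)\<bar> \<le> \<beta> * exp \<beta> * (4 * B * S) * \<theta> ^ j"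
      using lipD[OF lip1 a] by simp
    moreover have "\<bar>(K ^^ n) g x - (K ^^ n) g y\<bar> \<le>
      \<bar>((K ^^ n) g x + ?s * k n x) - ((K ^^ n) g y + ?s * k n y)\<bar> + ?s * \<bar>k n x - k n y\<bar>"
    proof -
      have "?s * \<bar>k n x - k n y\<bar> = \<bar>?s * k n x - ?s * k n y\<bar>" using B by (simp add: abs_mult right_diff_distrib[symmetric])
      then show ?thesis by linarith
    qed
    ultimately show "norm ((K ^^ n) g x - (K ^^ n) g y) \<le> l * \<theta> ^ j"
      by (simp add: l_def algebra_simps)
  qed
  have sup: "\<bar>(K ^^ n) g x\<bar> \<le> ?s * S" for x using abs[of x] sS[of x] by linarith
  show "ofr ((K ^^ n) g) \<in> V" using ofr_in_V(1)[OF K_power_bdd[OF g(1)] sup lip l0] .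
  have "N (ofr ((K ^^ n) g)) \<le> ?s * S + l" using ofr_in_V(2)[OF K_power_bdd[OF g(1)] sup lip l0] .
  then show "N (ofr ((K ^^ n) g)) \<le> Kconst * k n base * B"
    by (simp add: Kconst_def S_def l_def algebra_simps)
qed

lemma real_component:
  assumes f: "f \<in> V" and T: "\<And>z. \<bar>T z\<bar> \<le> cmod z" "\<And>z z'. T (z - z') = T z - T z'" "T 0 = 0"
  shows "bdd (\<lambda>x. T (f x))" "\<bar>T (f x)\<bar> \<le> N f" "lip (\<lambda>x. T (f x)) (N f)"
proof -
  have B: "\<bar>T (f x)\<bar> \<le> N f" for x using T(1)[of "f x"] Fb_bound[OF f, of x] by linarith
  then show "\<bar>T (f x)\<bar> \<le> N f" .
  show "bdd (\<lambda>x. T (f x))" using B by (intro bddI[where B="N f"]) (auto simp: Fb_zero[OF f] T(3))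
  show "lip (\<lambda>x. T (f x)) (N f)"
  proof (rule lipI)
    fix n :: nat and x y assume "1 \<le> n" "x \<in> E" "y \<in> E" "agree n x y"
    from lipD[OF Fb_lip[OF f] this] T(1)[of "f x - f y"]
    show "norm (T (f x) - T (f y)) \<le> N f * \<theta> ^ n" by (simp add: T(2))
  qed
qed

lemma Kc_power_bound:
  assumes f: "f \<in> V" shows "N ((Kc ^^ n) f) \<le> 2 * Kconst * k n base * N f"
proof -
  have re: "bdd (\<lambda>x. Re (f x))" "\<And>x. \<bar>Re (f x)\<bar> \<le> N f" "lip (\<lambda>x. Re (f x)) (N f)"
    using real_component[OF f, of Re] by (auto simp: abs_Re_le_cmod)
  have im: "bdd (\<lambda>x. Im (f x))" "\<And>x. \<bar>Im (f x)\<bar> \<le> N f" "lip (\<lambda>x. Im (f x)) (N f)"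
    using real_component[OF f, of Im] by (auto simp: abs_Im_le_cmod)
  have N0: "0 \<le> N f" by (rule Fb_nonneg[OF f])
  note RV = ofr_in_V(1)[OF re N0] and IV = ofr_in_V(1)[OF im N0]
  note Rb = K_power_bound[OF re N0, of n] and Ib = K_power_bound[OF im N0, of n]
  have split: "f = ofr (\<lambda>x. Re (f x)) + \<i> *\<^sub>C ofr (\<lambda>x. Im (f x))"
    by (rule ext) (simp add: ofr_def cscale_fun_def cscale_complex_def complex_eq[symmetric] mult.commute)
  note P = funpow_in_ops[OF Kc_ops, of n]
  have "(Kc ^^ n) f = (Kc ^^ n) (ofr (\<lambda>x. Re (f x))) + \<i> *\<^sub>C (Kc ^^ n) (ofr (\<lambda>x. Im (f x)))"
    by (subst split) (simp only: ops_add[OF P RV cscale_mem[OF IV]] ops_cscale[OF P IV])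
  then have eq: "(Kc ^^ n) f = ofr ((K ^^ n) (\<lambda>x. Re (f x))) + \<i> *\<^sub>C ofr ((K ^^ n) (\<lambda>x. Im (f x)))"
    by (simp only: Kc_power_ofr[OF re(1)] Kc_power_ofr[OF im(1)])
  have "N ((Kc ^^ n) f) \<le> N (ofr ((K ^^ n) (\<lambda>x. Re (f x)))) + N (\<i> *\<^sub>C ofr ((K ^^ n) (\<lambda>x. Im (f x))))"
    unfolding eq by (rule N_triangle[OF Rb(1) cscale_mem[OF Ib(1)]])
  moreover have "N (\<i> *\<^sub>C ofr ((K ^^ n) (\<lambda>x. Im (f x)))) = N (ofr ((K ^^ n) (\<lambda>x. Im (f x))))"
    by (simp add: N_cscale[OF Ib(1)])
  ultimately show ?thesis using Rb(2) Ib(2) by linarith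
qed

lemma N_limit_pointwise:
  assumes s: "s \<in> V" and F: "\<And>n. F n \<in> V" and lim: "(\<lambda>n. N (s - F n)) \<longlonglongrightarrow> 0"
  shows "(\<lambda>n. F n x) \<longlonglongrightarrow> s x"
proof -
  have "(\<lambda>n. norm (s x - F n x)) \<longlonglongrightarrow> 0"
  proof (rule null_sequence_squeeze[OF lim])
    show "norm (s x - F n x) \<le> N (s - F n)" for n
      using Fb_bound[OF diff_mem[OF s F[of n]], of x] by simp
  qed simp
  then have "(\<lambda>n. s x - F n x) \<longlonglongrightarrow> 0" by (rule tendsto_norm_zero_cancel)
  from tendsto_diff[OF tendsto_const[of "s x"] this] show ?thesis by simp
qed

text \<open>
  The Neumann series of \<open>K\<close> converges, and its value at the constant function is \<open>h\<close>.
\<close>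

lemma spectral_gap:
  obtains R0 where "two_sided_inverse (\<lambda>f. f - power_average m Lc f + \<phi> f *\<^sub>C e) R0"
    and "R0 e = ofr h" and "bdd h"
proof -
  have sm: "summable (\<lambda>n. 2 * Kconst * k n base)" by (rule summable_mult[OF k_summable])
  obtain R0 where R0: "two_sided_inverse (\<lambda>f. f - Kc f) R0"
    and lim: "\<And>f. f \<in> V \<Longrightarrow> (\<lambda>j. N (R0 f - (\<Sum>n<j. (Kc ^^ n) f))) \<longlonglongrightarrow> 0"
    by (rule neumann_series[OF Kc_ops sm Kc_power_bound]) blast+
  have eq: "(\<lambda>f. f - Kc f) = (\<lambda>f. f - power_average m Lc f + \<phi> f *\<^sub>C e)"
    by (rule ext) (simp add: Kc_def)
  note D = two_sided_inverseD[OF R0]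
  have Re: "R0 e \<in> V" by (rule ops_mem[OF D(2) e_in_V])
  have partial: "(\<Sum>n<j. (Kc ^^ n) e) x = complex_of_real (\<Sum>n<j. k n x)" for j x
    by (simp add: sum_fun_apply e_def Kc_power_ofr bdd_unit) (simp add: ofr_def k_def)
  have "R0 e x = ofr h x" for x
  proof -
    have mem: "(\<Sum>n<j. (Kc ^^ n) e) \<in> V" for j
      by (intro sum_mem ops_mem[OF funpow_in_ops[OF Kc_ops]] e_in_V)
    have "(\<lambda>j. complex_of_real (\<Sum>n<j. k n x)) \<longlonglongrightarrow> R0 e x"
      using N_limit_pointwise[OF Re mem lim[OF e_in_V], of x] unfolding partial .
    moreover have "(\<lambda>j. complex_of_real (\<Sum>n<j. k n x)) \<longlonglongrightarrow> complex_of_real (h x)"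
      unfolding h_def by (intro tendsto_of_real summable_LIMSEQ k_summable)
    ultimately show ?thesis unfolding ofr_def by (rule LIMSEQ_unique)
  qed
  then have R0e: "R0 e = ofr h" by auto
  have "bdd h"
  proof (rule bddI[where B="N (R0 e)"])
    show "\<bar>h x\<bar> \<le> N (R0 e)" for x
      using Fb_bound[OF Re, of x] unfolding R0e by (simp add: ofr_def)
    show "h x = 0" if "x \<notin> E" for x using Fb_zero[OF Re that] by (simp add: R0e ofr_def)
  qed
  then show ?thesis using that R0 R0e unfolding eq by blast
qed

text \<open>
  By construction \<open>h - Q h = (1 - F) * 1\<close> with \<open>F = \<epsilon> * \<Phi> h\<close>. For \<open>F < 1\<close> the function \<open>h\<close>, for \<open>F > 1\<close> the function \<open>- h\<close>,
  would give a positive coboundary. So \<open>F = 1\<close>, and \<open>h\<close> is a fixed point of \<open>Q\<close>.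
\<close>

lemma \<phi>_h:
  assumes R0: "two_sided_inverse (\<lambda>f. f - power_average m Lc f + \<phi> f *\<^sub>C e) R0"
    and R0e: "R0 e = ofr h" and h: "bdd h"
  shows "\<phi> (R0 e) = 1"
proof -
  define F where "F = \<epsilon> * \<Phi> h"
  have \<phi>: "\<phi> (R0 e) = complex_of_real F" unfolding R0e F_def by (rule \<phi>_ofr[OF h])
  have "R0 e - power_average m Lc (R0 e) + \<phi> (R0 e) *\<^sub>C e = e"
    using two_sided_inverseD(3)[OF R0 e_in_V] .
  then have "(ofr h - ofr (Q h) + complex_of_real F *\<^sub>C e) x = e x" for x
    unfolding \<phi> unfolding R0e average_ofr[OF h] by simp
  then have "complex_of_real (h x - Q h x + F * unit x) = complex_of_real (unit x)" for x
    by (simp add: ofr_def e_def cscale_fun_def cscale_complex_def)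
  then have eq: "h x - Q h x = (1 - F) * unit x" for x
    unfolding of_real_eq_iff by (simp add: algebra_simps)
  have "\<not> F < 1"
    using no_positive_coboundary[OF h, of "1 - F"] eq by (auto simp: unit_def)
  moreover have "\<not> 1 < F"
  proof
    assume F: "1 < F"
    have "Q (\<lambda>x. - h x) = (\<lambda>x. - Q h x)" using linear_positiveD(3)[OF lp_Q h, of "-1"] by simp
    then have "F - 1 \<le> - h x - Q (\<lambda>x. - h x) x" if "x \<in> E" for x
      using eq[of x] that by (simp add: unit_def)
    then show False using no_positive_coboundary[OF bdd_uminus[OF h], of "F - 1"] F by auto
  qed
  ultimately show ?thesis unfolding \<phi> by simp
qed

text \<open>
  A function that is positive at \<open>x0\<close> is bounded below on a cylinder around \<open>x0\<close>, and every point has a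
  preimage in this cylinder, reached through the word of the cylinder and a connecting word.
\<close>

lemma eventually_positive:
  assumes g: "bdd g" "\<And>x. 0 \<le> g x" and l: "lip g b" and x0: "x0 \<in> E" "0 < g x0"
  obtains n c where "0 < c" "\<And>x. x \<in> E \<Longrightarrow> c \<le> (Q ^^ n) g x"
proof -
  have "(\<lambda>n. \<bar>b\<bar> * \<theta> ^ n) \<longlonglongrightarrow> \<bar>b\<bar> * 0" using theta by (intro tendsto_mult tendsto_const LIMSEQ_power_zero) auto
  then have "\<forall>\<^sub>F n in sequentially. \<bar>b\<bar> * \<theta> ^ n < g x0 / 2" using x0 by (intro order_tendstoD(2)) auto
  then have "\<exists>l. \<bar>b\<bar> * \<theta> ^ Suc l < g x0 / 2" unfolding eventually_sequentially by (metis le_SucI order_refl)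
  then obtain l where l': "\<bar>b\<bar> * \<theta> ^ Suc l < g x0 / 2" by blast
  define v where "v = map x0 [0..<l]"
  have near: "g x0 / 2 \<le> g y" if y: "y \<in> E" "agree (Suc l) x0 y" for y
  proof -
    have "\<bar>g x0 - g y\<bar> \<le> \<bar>b\<bar> * \<theta> ^ Suc l"
      using lipD[OF lip_mono[OF l, of "\<bar>b\<bar>"] _ x0(1) y] by simp
    then show ?thesis using l' by linarith
  qed
  let ?i = "x0 l"
  have iI: "?i \<in> I" using x0(1) by (simp add: E_inf_def)
  have vI: "set (v @ [?i]) \<subseteq> I" using x0(1) by (auto simp: v_def E_inf_def)
  define c where "c = (1 / real m) ^ Suc l * (path_weight (v @ [?i]) * \<kappa>) * (g x0 / 2)"
  have cpos: "0 < c" using m_pos path_weight_pos[OF vI] \<kappa>_pos x0(2) by (simp add: c_def)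
  have Lg: "bdd ((L ^^ n) g)" "0 \<le> (L ^^ n) g y" for n y
    using linear_positiveD[OF lp_power[OF lp_L]] g by auto
  have QL: "(1 / real m) * (L f) y \<le> Q f y" if f: "bdd f" "\<And>x. 0 \<le> f x" for f y
  proof -
    have "(L ^^ Suc 0) f y \<le> (\<Sum>k<m. (L ^^ Suc k) f y)"
      using m_pos linear_positiveD(4)[OF lp_power[OF lp_L] f] by (intro member_le_sum) (auto simp del: funpow.simps)
    then show ?thesis unfolding Q_def using m_pos by (intro mult_left_mono) auto
  qed
  note Qg = linear_positiveD[OF lp_power[OF lp_Q]]
  have QnL: "(1 / real m) ^ n * (L ^^ n) f y \<le> (Q ^^ n) f y" if f: "bdd f" "\<And>x. 0 \<le> f x" for f n y
  proof (induction n arbitrary: y)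
    case (Suc n)
    have Ln: "bdd ((L ^^ n) f)" by (rule linear_positiveD(1)[OF lp_power[OF lp_L] f(1)])
    have "(1 / real m) ^ Suc n * (L ^^ Suc n) f y = 1 / real m * L (\<lambda>y. (1 / real m) ^ n * (L ^^ n) f y) y"
      by (simp add: L_cmult[OF Ln])
    also have "\<dots> \<le> 1 / real m * L ((Q ^^ n) f) y"
      by (intro mult_left_mono L_mono bdd_cmult Ln Qg(1) f Suc.IH) auto
    also have "\<dots> \<le> Q ((Q ^^ n) f) y"
      using Qg(1)[OF f(1)] Qg(4)[OF f] by (intro QL) auto
    finally show ?case by simp
  qed simp
  show ?thesis
  proof (rule that[OF cpos, of "Suc l"])
    fix x assume x: "x \<in> E"
    obtain \<omega> where \<omega>: "\<omega> \<in> \<Lambda>" "cons_seq ?i (prepend \<omega> x) \<in> E" using connect[OF iI x] by blast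
    let ?y = "cons_seq ?i (prepend \<omega> x)"
    have py: "prepend v ?y \<in> E" "agree (Suc l) x0 (prepend v ?y)"
      using prepend_word[OF x0(1) \<omega>(2), of 0 l] by (auto simp: v_def)
    have "g x0 / 2 \<le> g (prepend (v @ [?i]) (prepend \<omega> x))" using near[OF py] by (simp add: prepend_snoc)
    then have "path_weight (v @ [?i]) * (g x0 / 2) \<le> path_weight (v @ [?i]) * g (prepend (v @ [?i]) (prepend \<omega> x))"
      using path_weight_pos[OF vI] by (intro mult_left_mono) auto
    also have "\<dots> \<le> (L ^^ length (v @ [?i])) g (prepend \<omega> x)" by (rule L_power_path[OF g])
    also have "\<dots> = (L ^^ Suc l) g (prepend \<omega> x)" by (simp add: v_def)
    finally have "\<kappa> * (path_weight (v @ [?i]) * (g x0 / 2)) \<le> \<kappa> * (L ^^ Suc l) g (prepend \<omega> x)"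
      using \<kappa>_pos by (intro mult_left_mono) auto
    also have "\<dots> \<le> (\<Sum>k<m. (L ^^ k) ((L ^^ Suc l) g) x)" by (rule reach_lower[OF Lg \<omega>(1)])
    \<comment> \<open>Regrouping: one power goes into each summand of \<open>Q\<close>, the other \<open>l\<close> are left outside.\<close>
    also have "\<dots> = (\<Sum>k<m. (L ^^ l) ((L ^^ Suc k) g) x)"
    proof (rule sum.cong[OF refl])
      fix k
      have "(L ^^ k) ((L ^^ Suc l) g) = (L ^^ (k + Suc l)) g" by (simp only: funpow_add o_def)
      moreover have "(L ^^ l) ((L ^^ Suc k) g) = (L ^^ (l + Suc k)) g" by (simp only: funpow_add o_def)
      moreover have "k + Suc l = l + Suc k" by simp
      ultimately show "(L ^^ k) ((L ^^ Suc l) g) x = (L ^^ l) ((L ^^ Suc k) g) x" by (simp only:)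
    qed
    finally have "(1 / real m) ^ l * (1 / real m * (\<kappa> * (path_weight (v @ [?i]) * (g x0 / 2))))
        \<le> (1 / real m) ^ l * (1 / real m * (\<Sum>k<m. (L ^^ l) ((L ^^ Suc k) g) x))"
      by (intro mult_left_mono) auto
    also have "1 / real m * (\<Sum>k<m. (L ^^ l) ((L ^^ Suc k) g) x) = (L ^^ l) (Q g) x"
      unfolding L_power_Q[OF g(1)] by (simp only: funpow_add o_def)
    also have "(1 / real m) ^ l * (L ^^ l) (Q g) x \<le> (Q ^^ l) (Q g) x"
      using linear_positiveD[OF lp_Q] g by (intro QnL) auto
    also have "(Q ^^ l) (Q g) x = (Q ^^ Suc l) g x" by (simp add: funpow_swap1)
    finally show "c \<le> (Q ^^ Suc l) g x" by (simp add: c_def ac_simps)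
  qed
qed

text \<open>
  The functional \<open>f \<mapsto> \<phi> (R0 f)\<close> is the eigenfunctional of \<open>Q\<close>. If it vanishes at \<open>f\<close>, then \<open>f\<close> is the
  coboundary of \<open>R0 f\<close>; applying \<open>Q\<close> often enough makes it bounded below by a positive constant.
\<close>

lemma functional_nonzero:
  assumes R0: "two_sided_inverse (\<lambda>f. f - power_average m Lc f + \<phi> f *\<^sub>C e) R0"
    and f: "f \<in> V" "\<And>x. f x \<in> \<real> \<and> 0 \<le> Re (f x)" and x0: "f x0 \<noteq> 0"
  shows "\<phi> (R0 f) \<noteq> 0"
proof
  assume 0: "\<phi> (R0 f) = 0"
  note D = two_sided_inverseD[OF R0]
  define g where "g x = Re (f x)" for x
  have g: "bdd g" "lip g (N f)" unfolding g_def[abs_def]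
    using real_component[OF f(1), of Re] by (auto simp: abs_Re_le_cmod)
  have gnn: "0 \<le> g x" for x using f(2) by (simp add: g_def)
  have RV: "R0 f \<in> V" by (rule ops_mem[OF D(2) f(1)])
  define G where "G x = Re (R0 f x)" for x
  have re: "bdd G" "\<And>x. \<bar>G x\<bar> \<le> N (R0 f)" "lip G (N (R0 f))" unfolding G_def[abs_def]
    using real_component[OF RV, of Re] by (auto simp: abs_Re_le_cmod)
  have im: "bdd (\<lambda>x. Im (R0 f x))" "\<And>x. \<bar>Im (R0 f x)\<bar> \<le> N (R0 f)" "lip (\<lambda>x. Im (R0 f x)) (N (R0 f))"
    using real_component[OF RV, of Im] by (auto simp: abs_Im_le_cmod)
  note VV = ofr_in_V(1)[OF re Fb_nonneg[OF RV]] ofr_in_V(1)[OF im Fb_nonneg[OF RV]]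
  note A = power_average_in_ops[OF Lc_ops, of m]
  have split: "R0 f = ofr G + \<i> *\<^sub>C ofr (\<lambda>x. Im (R0 f x))"
    by (rule ext) (simp add: ofr_def G_def cscale_fun_def cscale_complex_def complex_eq[symmetric] mult.commute)
  have avg: "power_average m Lc (R0 f) = ofr (Q G) + \<i> *\<^sub>C ofr (Q (\<lambda>x. Im (R0 f x)))"
    by (subst split) (simp only: ops_add[OF A VV(1) cscale_mem[OF VV(2)]] ops_cscale[OF A VV(2)]
        average_ofr[OF re(1)] average_ofr[OF im(1)])
  have "R0 f - power_average m Lc (R0 f) = f" using D(3)[OF f(1)] 0 by simp
  then have "Re ((R0 f - power_average m Lc (R0 f)) x) = g x" for x by (simp add: g_def)
  then have eq: "G x - Q G x = g x" for x
    unfolding avg by (simp add: ofr_def cscale_fun_def cscale_complex_def G_def)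
  have "g x0 \<noteq> 0" using f(2)[of x0] x0 by (auto simp: g_def complex_is_Real_iff complex_eq_iff)
  then have x0': "x0 \<in> E" "0 < g x0" using bdd_off[OF g(1)] gnn[of x0] by force+
  obtain n c where c: "0 < c" "\<And>x. x \<in> E \<Longrightarrow> c \<le> (Q ^^ n) g x"
    by (rule eventually_positive[OF g(1) gnn g(2) x0']) blast
  have QG: "bdd (Q G)" by (rule linear_positiveD(1)[OF lp_Q re(1)])
  have "g = (\<lambda>x. G x - Q G x)" using eq by auto
  then have "(Q ^^ n) g x = (Q ^^ n) G x - Q ((Q ^^ n) G) x" for x
    using lp_diff[OF lp_power[OF lp_Q] re(1) QG, of n] by (simp add: funpow_swap1)
  then show False
    using no_positive_coboundary[OF linear_positiveD(1)[OF lp_power[OF lp_Q] re(1)] c(1), of n] c(2) by auto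
qed

end

section \<open>Zero pressure and the growth of iterates\<close>

text \<open>
  Comparing \<open>s (n * l)\<close> with \<open>l * s n\<close> and with \<open>n * s l\<close> shows \<open>s n / n\<close> and \<open>s l / l\<close> to be within \<open>C / n + C / l\<close>. So
  the averages are Cauchy, and letting \<open>l\<close> tend to infinity gives the error bound.
\<close>

lemma quasi_additive:
  fixes s :: "nat \<Rightarrow> real"
  assumes qa: "\<And>n l. 1 \<le> n \<Longrightarrow> 1 \<le> l \<Longrightarrow> \<bar>s (n + l) - s n - s l\<bar> \<le> C"
  obtains p where "\<And>n. 1 \<le> n \<Longrightarrow> \<bar>s n - real n * p\<bar> \<le> C"
proof -
  have C: "0 \<le> C" using qa[of 1 1] by simp
  have mult: "\<bar>s (n * l) - real l * s n\<bar> \<le> real l * C" if n: "1 \<le> n" and l: "1 \<le> l" for n l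
    using l
  proof (induction l rule: nat_induct_at_least)
    case base show ?case using C by simp
  next
    case (Suc l)
    have "1 \<le> n * l" using n Suc.hyps by simp
    then have "\<bar>s (n * l + n) - s (n * l) - s n\<bar> \<le> C" using qa n by blast
    moreover have "n * Suc l = n * l + n" "real (Suc l) * s n = real l * s n + s n"
      "real (Suc l) * C = real l * C + C" by (simp_all add: distrib_right)
    ultimately show ?case using Suc.IH by (simp only:)
  qed
  have close: "\<bar>s n / real n - s l / real l\<bar> \<le> C / real n + C / real l" if "1 \<le> n" "1 \<le> l" for n l
  proof -
    have "\<bar>real l * s n - real n * s l\<bar> \<le> real l * C + real n * C"
      using mult[OF that] mult[OF that(2,1)] by (simp add: mult.commute[of l n])
    then have "\<bar>real l * s n - real n * s l\<bar> / (real n * real l) \<le> (real l * C + real n * C) / (real n * real l)"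
      using that by (intro divide_right_mono) auto
    moreover have "s n / real n - s l / real l = (real l * s n - real n * s l) / (real n * real l)"
      using that by (simp add: field_simps)
    moreover have "(real l * C + real n * C) / (real n * real l) = C / real n + C / real l"
      using that by (simp add: field_simps)
    ultimately show ?thesis by (simp add: abs_mult)
  qed
  have "Cauchy (\<lambda>n. s n / real n)"
  proof (rule CauchyI)
    fix \<epsilon> :: real assume e: "0 < \<epsilon>"
    obtain M :: nat where M: "2 * C / \<epsilon> < real M" using reals_Archimedean2 by blast
    have small: "C / real n < \<epsilon> / 2" if "n \<ge> Suc M" for n
    proof -
      have "2 * C / \<epsilon> < real n" using M that by linarith
      then have "2 * C < \<epsilon> * real n" using e by (simp add: pos_divide_less_eq mult.commute)
      then show ?thesis using that by (simp add: pos_divide_less_eq)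
    qed
    show "\<exists>M. \<forall>n\<ge>M. \<forall>l\<ge>M. norm (s n / real n - s l / real l) < \<epsilon>"
    proof (intro exI[of _ "Suc M"] allI impI)
      fix n l assume nl: "Suc M \<le> n" "Suc M \<le> l"
      have "\<bar>s n / real n - s l / real l\<bar> \<le> C / real n + C / real l" using nl by (intro close) auto
      also have "\<dots> < \<epsilon> / 2 + \<epsilon> / 2" using nl by (intro add_strict_mono small)
      finally show "norm (s n / real n - s l / real l) < \<epsilon>" by simp
    qed
  qed
  then obtain p where p: "(\<lambda>n. s n / real n) \<longlonglongrightarrow> p" using Cauchy_convergent_iff convergent_def by blast
  show ?thesis
  proof (rule that)
    fix n :: nat assume n: "1 \<le> n"
    have "(\<lambda>l. \<bar>s n / real n - s l / real l\<bar>) \<longlonglongrightarrow> \<bar>s n / real n - p\<bar>"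
      by (intro tendsto_rabs tendsto_diff tendsto_const p)
    moreover have "(\<lambda>l. C / real n + C / real l) \<longlonglongrightarrow> C / real n + 0"
      by (intro tendsto_add tendsto_const lim_const_over_n)
    ultimately have "\<bar>s n / real n - p\<bar> \<le> C / real n + 0"
      by (rule LIMSEQ_le) (use close[OF n] in blast)
    moreover have "\<bar>s n - real n * p\<bar> = real n * \<bar>s n / real n - p\<bar>"
    proof -
      have "s n - real n * p = real n * (s n / real n - p)" using n by (simp add: field_simps)
      then show ?thesis by (simp add: abs_mult)
    qed
    ultimately show "\<bar>s n - real n * p\<bar> \<le> C" using n by (simp add: pos_le_divide_eq mult.commute)
  qed
qed

lemma shift_power: "(shift ^^ j) x i = x (i + j)"
  by (induction j arbitrary: i) (simp_all add: shift_def)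

lemma shift_power_prepend: "length v = n \<Longrightarrow> (shift ^^ n) (prepend v x) = x"
  by (induction v arbitrary: n) (auto simp: funpow_swap1)

lemma prepend_nth: "i < length v \<Longrightarrow> prepend v x i = v ! i"
  by (induction v arbitrary: i) (auto simp: nth_Cons split: nat.split)

lemma birkhoff_sum_Suc: "birkhoff_sum (Suc n) u x = birkhoff_sum n u x + u ((shift ^^ n) x)"
  by (simp add: birkhoff_sum_def)

context transfer_system
begin

lemma shift_power_in_E: "x \<in> E \<Longrightarrow> (shift ^^ n) x \<in> E"
  by (induction n) (auto intro: shift_in_E)

lemma prepend_in_E_suffix: "prepend v x \<in> E \<Longrightarrow> x \<in> E"
  by (induction v) (auto simp: cons_in_E)

text \<open>
  After \<open>j\<close> shifts, points that agree on \<open>n\<close> letters still agree on \<open>n - j\<close> letters, so the differences form a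
  geometric series, whatever \<open>n\<close> is.
\<close>

lemma birkhoff_distortion:
  assumes "x \<in> E" "y \<in> E" "agree n x y"
  shows "birkhoff_sum n u x \<le> birkhoff_sum n u y + a / (1 - \<theta>)"
proof -
  have "birkhoff_sum n u x - birkhoff_sum n u y = (\<Sum>j<n. u ((shift ^^ j) x) - u ((shift ^^ j) y))"
    by (simp add: birkhoff_sum_def sum_subtractf)
  also have "\<dots> \<le> (\<Sum>j<n. a * \<theta> ^ (n - Suc j))"
  proof (rule sum_mono)
    fix j assume "j \<in> {..<n}"
    then have j: "j < n" by simp
    have "agree (n - j) ((shift ^^ j) x) ((shift ^^ j) y)"
      using assms(3) j by (auto simp: agree_def shift_power)
    then have "norm (u ((shift ^^ j) x) - u ((shift ^^ j) y)) \<le> a * \<theta> ^ (n - j)"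
      using j assms by (intro lipD[OF u_lip] shift_power_in_E) auto
    also have "\<dots> \<le> a * \<theta> ^ (n - Suc j)"
      using theta a_nonneg j by (intro mult_left_mono power_decreasing) auto
    finally show "u ((shift ^^ j) x) - u ((shift ^^ j) y) \<le> a * \<theta> ^ (n - Suc j)" by simp
  qed
  also have "\<dots> = a * (\<Sum>j<n. \<theta> ^ j)"
    by (simp add: sum_distrib_left[symmetric] sum.nat_diff_reindex)
  also have "\<dots> \<le> a * (1 / (1 - \<theta>))"
  proof (rule mult_left_mono[OF _ a_nonneg])
    have "(\<Sum>j<n. \<theta> ^ j) \<le> (\<Sum>j. \<theta> ^ j)"
      using theta by (intro sum_le_suminf summable_geometric) auto
    also have "\<dots> = 1 / (1 - \<theta>)" using theta by (intro suminf_geometric) auto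
    finally show "(\<Sum>j<n. \<theta> ^ j) \<le> 1 / (1 - \<theta>)" .
  qed
  finally show ?thesis by simp
qed

subsection \<open>Growth of the iterates of the constant function\<close>

lemma bdd_L_unit: "bdd ((L ^^ n) unit)"
  by (rule linear_positiveD(1)[OF lp_power[OF lp_L] bdd_unit])

lemma L_unit_nonneg: "0 \<le> (L ^^ n) unit x"
  by (rule linear_positiveD(4)[OF lp_power[OF lp_L] bdd_unit unit_nonneg])

definition r :: "nat \<Rightarrow> real" where "r n = (SUP x\<in>E. (L ^^ n) unit x)"

lemma r_upper: "(L ^^ n) unit x \<le> r n * unit x"
proof (cases "x \<in> E")
  case True
  obtain B where "\<And>x. \<bar>(L ^^ n) unit x\<bar> \<le> B" using bddE[OF bdd_L_unit] by metis
  then have "bdd_above ((\<lambda>x. (L ^^ n) unit x) ` E)" by (intro bdd_aboveI2[where M=B]) (simp add: abs_le_iff)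
  then show ?thesis using True unfolding r_def by (simp add: cSUP_upper unit_def)
next
  case False
  then show ?thesis using bdd_off[OF bdd_L_unit] by (simp add: unit_def)
qed

lemma r_least: "(\<And>x. x \<in> E \<Longrightarrow> (L ^^ n) unit x \<le> B) \<Longrightarrow> r n \<le> B"
  unfolding r_def using E_nonempty by (rule cSUP_least)

lemma r_pos: "0 < r n"
proof -
  have "\<exists>x\<in>E. 0 < (L ^^ n) unit x"
  proof (induction n)
    case 0 then show ?case using E_nonempty by (auto simp: unit_def)
  next
    case (Suc n)
    then obtain y where y: "y \<in> E" "0 < (L ^^ n) unit y" by blast
    have "w (cons_seq (y 0) (shift y)) * (L ^^ n) unit (cons_seq (y 0) (shift y)) \<le> L ((L ^^ n) unit) (shift y)"
      by (rule L_term_le[OF bdd_L_unit L_unit_nonneg])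
    then have "w y * (L ^^ n) unit y \<le> (L ^^ Suc n) unit (shift y)" by (simp add: cons_seq_shift)
    moreover have "0 < w y * (L ^^ n) unit y" using y w_pos by simp
    ultimately show ?case using shift_in_E[OF y(1)] by (intro bexI[of _ "shift y"]) auto
  qed
  then obtain x where "x \<in> E" "0 < (L ^^ n) unit x" by blast
  then show ?thesis using r_upper[of n x] by (simp add: unit_def)
qed

lemma L_power_bound: "(L ^^ (n + l)) unit x \<le> r n * r l"
proof -
  have "(L ^^ (n + l)) unit x = (L ^^ n) ((L ^^ l) unit) x" by (simp add: funpow_add)
  also have "\<dots> \<le> (L ^^ n) (\<lambda>x. r l * unit x) x"
    by (intro lp_mono[OF lp_power[OF lp_L]] bdd_L_unit bdd_cmult bdd_unit r_upper)
  also have "\<dots> = r l * (L ^^ n) unit x"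
    using linear_positiveD(3)[OF lp_power[OF lp_L] bdd_unit] by metis
  also have "\<dots> \<le> r l * r n"
    using r_upper[of n x] r_pos[of l] r_pos[of n]
    by (intro mult_left_mono) (auto simp: unit_def split: if_splits)
  finally show ?thesis by (simp add: mult.commute)
qed

lemma r_submultiplicative: "r (n + l) \<le> r n * r l"
  by (rule r_least) (rule L_power_bound)

definition c_r :: real where "c_r = c_low * exp (1 - \<beta>)"

lemma c_r_pos: "0 < c_r" using c_low_pos by (simp add: c_r_def)

lemma cone_L_unit: "cone \<beta> ((L ^^ n) unit)"
  using \<beta>_ge_1 by (intro cone_L_power cone_unit) auto

lemma Q_L_unit_lower: "x \<in> E \<Longrightarrow> c_r * r (Suc n) \<le> Q ((L ^^ n) unit) x"
proof -
  assume x: "x \<in> E"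
  have "r (Suc n) \<le> exp (\<beta> - 1) * \<Phi> ((L ^^ n) unit)"
    using L_upper[OF cone_L_unit] by (intro r_least) simp
  then have "c_r * r (Suc n) \<le> c_r * (exp (\<beta> - 1) * \<Phi> ((L ^^ n) unit))"
    using c_r_pos by (intro mult_left_mono) auto
  also have "\<dots> = c_low * \<Phi> ((L ^^ n) unit)"
    by (simp add: c_r_def mult.assoc) (simp add: mult.assoc[symmetric] exp_add[symmetric])
  also have "\<dots> \<le> Q ((L ^^ n) unit) x" by (rule Q_lower[OF cone_L_unit x])
  finally show ?thesis .
qed

definition B_r :: real where "B_r = Max (r ` {..<m})"

lemma B_r: "k < m \<Longrightarrow> r k \<le> B_r" "0 < B_r"
proof -
  show le: "r k \<le> B_r" if "k < m" for k unfolding B_r_def using that by (intro Max_ge) auto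
  show "0 < B_r" using le[OF m_pos] r_pos[of 0] by linarith
qed

lemma Q_L_unit_upper: "Q ((L ^^ n) unit) x \<le> B_r * r (Suc n)"
  unfolding Q_def
proof (rule average_le)
  fix j assume j: "j < m"
  have "(L ^^ Suc j) ((L ^^ n) unit) x = (L ^^ (Suc j + n)) unit x" by (simp only: funpow_add o_def)
  also have "\<dots> = (L ^^ (j + Suc n)) unit x" by simp
  also have "\<dots> \<le> r j * r (Suc n)" by (rule L_power_bound)
  also have "\<dots> \<le> B_r * r (Suc n)" using B_r(1)[OF j] r_pos[of "Suc n"] by (intro mult_right_mono) auto
  finally show "(L ^^ Suc j) ((L ^^ n) unit) x \<le> B_r * r (Suc n)" .
qed

text \<open>
  The lower bound for \<open>Q\<close> holds at every point and hence can be iterated, unlike the supremum \<open>r\<close>. Expanding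
  the averages afterwards returns to powers of \<open>L\<close>, whose exponents exceed the intended one by less than \<open>2 m\<close>.
\<close>

lemma r_supermultiplicative: "c_r * c_r * r (Suc n) * r (Suc l) \<le> B_r * B_r * r (Suc n + Suc l)"
proof -
  obtain x where x: "x \<in> E" using E_nonempty by blast
  note P = linear_positiveD[OF lp_power[OF lp_L]]
  have Qn: "bdd (Q ((L ^^ n) unit))" by (rule linear_positiveD(1)[OF lp_Q bdd_L_unit])
  have lo: "c_r * r (Suc n) * unit y \<le> Q ((L ^^ n) unit) y" for y
    using Q_L_unit_lower[of y n] bdd_off[OF Qn, of y] by (cases "y \<in> E") (auto simp: unit_def)
  have pos: "0 \<le> c_r * r (Suc n)" using c_r_pos r_pos[of "Suc n"] by simp
  have "c_r * r (Suc n) * (c_r * r (Suc l)) \<le> c_r * r (Suc n) * Q ((L ^^ l) unit) x"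
    using Q_L_unit_lower[OF x] pos by (intro mult_left_mono)
  also have "\<dots> = Q ((L ^^ l) (\<lambda>y. c_r * r (Suc n) * unit y)) x"
    by (simp only: P(3)[OF bdd_unit] linear_positiveD(3)[OF lp_Q bdd_L_unit])
  also have "\<dots> \<le> Q ((L ^^ l) (Q ((L ^^ n) unit))) x"
    by (intro lp_mono[OF lp_Q] lp_mono[OF lp_power[OF lp_L]] P(1) bdd_cmult bdd_unit Qn lo)
  also have "\<dots> = 1 / real m * (\<Sum>j<m. Q ((L ^^ (l + Suc j)) ((L ^^ n) unit)) x)"
    unfolding L_power_Q[OF bdd_L_unit]
    by (simp only: linear_positiveD(3)[OF lp_Q bdd_sum[OF P(1)[OF bdd_L_unit]]] lp_sum[OF lp_Q P(1)[OF bdd_L_unit]])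
  also have "\<dots> \<le> B_r * (B_r * r (Suc n + Suc l))"
  proof (rule average_le)
    fix j assume j: "j < m"
    have "(L ^^ (l + Suc j)) ((L ^^ n) unit) = (L ^^ (l + Suc j + n)) unit" by (simp only: funpow_add o_def)
    then have "Q ((L ^^ (l + Suc j)) ((L ^^ n) unit)) x \<le> B_r * r (Suc (l + Suc j + n))"
      by (simp only: Q_L_unit_upper)
    also have "r (Suc (l + Suc j + n)) \<le> r j * r (Suc n + Suc l)"
      using r_submultiplicative[of j "Suc n + Suc l"] by (simp add: add_ac)
    also have "r j * r (Suc n + Suc l) \<le> B_r * r (Suc n + Suc l)"
      using B_r(1)[OF j] r_pos[of "Suc n + Suc l"] by (intro mult_right_mono) auto
    finally show "Q ((L ^^ (l + Suc j)) ((L ^^ n) unit)) x \<le> B_r * (B_r * r (Suc n + Suc l))"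
      using B_r(2) by (simp add: mult_left_mono)
  qed
  finally show ?thesis by (simp add: ac_simps)
qed

subsection \<open>The partition sums\<close>

definition word_weight :: "nat \<Rightarrow> seq \<Rightarrow> real" where
  "word_weight n y = (if y \<in> E then exp (birkhoff_sum n u y) else 0)"

lemma word_weight_nonneg: "0 \<le> word_weight n y" by (simp add: word_weight_def)

lemma word_weight_Suc:
  "length v = n \<Longrightarrow> word_weight (Suc n) (prepend v y) = w y * word_weight n (prepend v y)"
  using prepend_in_E_suffix[of v y]
  by (auto simp: word_weight_def w_def birkhoff_sum_Suc shift_power_prepend exp_add)

lemma bij_snoc: "bij_betw (\<lambda>(i, v). v @ [i]) (UNIV \<times> {v. length v = n}) {v. length v = Suc n}"
proof (rule bij_betw_byWitness[where f'="\<lambda>v. (last v, butlast v)"])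
  show "\<forall>v\<in>{v. length v = Suc n}. (case (last v, butlast v) of (i, v) \<Rightarrow> v @ [i]) = v"
    by (auto simp: append_butlast_last_id length_Suc_conv)
qed auto

lemma nonneg_has_sum_nat:
  fixes f :: "nat \<Rightarrow> real"
  assumes "summable f" "\<And>i. 0 \<le> f i" shows "(f has_sum suminf f) UNIV"
  using assms by (intro norm_summable_imp_has_sum) (auto simp: summable_sums)

lemma has_sum_words:
  "((\<lambda>v. word_weight n (prepend v x)) has_sum (L ^^ n) unit x) {v. length v = n}"
proof (induction n arbitrary: x)
  case 0
  have "{v::nat list. length v = 0} = {[]}" by auto
  moreover have "word_weight 0 x = unit x" by (simp add: word_weight_def unit_def birkhoff_sum_def)
  ultimately show ?case using has_sum_finite[of "{[]}" "\<lambda>v. word_weight 0 (prepend v x)"] by simp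
next
  case (Suc n)
  let ?g = "\<lambda>i. w (cons_seq i x) * (L ^^ n) unit (cons_seq i x)"
  let ?f = "\<lambda>(i, v). word_weight (Suc n) (prepend (v @ [i]) x)"
  have inner: "((\<lambda>v. ?f (i, v)) has_sum ?g i) {v. length v = n}" for i
  proof -
    have "((\<lambda>v. w (cons_seq i x) * word_weight n (prepend v (cons_seq i x))) has_sum ?g i) {v. length v = n}"
      by (rule has_sum_cmult_right[OF Suc])
    then show ?thesis
      by (rule has_sum_cong[THEN iffD1, rotated]) (simp add: prepend_snoc word_weight_Suc)
  qed
  have outer: "(?g has_sum (L ^^ Suc n) unit x) UNIV"
    using nonneg_has_sum_nat[OF L_summable[OF bdd_L_unit[of n], of x]] w_nonneg L_unit_nonneg
    by (simp add: L_def ker_op_def)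
  have "(?f has_sum (L ^^ Suc n) unit x) (UNIV \<times> {v. length v = n})"
    using has_sum_imp_summable[OF outer]
    by (intro has_sum_SigmaI[OF inner outer] summable_on_SigmaI[OF inner]) (auto simp: word_weight_nonneg)
  then show ?case
    by (subst has_sum_reindex_bij_betw[OF bij_snoc, symmetric]) (simp add: case_prod_unfold)
qed

text \<open>
  The last letter of a word of length \<open>n + 1\<close> is used as the reference point for \<open>\<Phi>\<close>. This
  turns the partition sum, in which no base point is distinguished, into a value of \<open>\<Phi>\<close>.
\<close>

lemma has_sum_marked_words:
  "((\<lambda>v. wt (last v) * word_weight n (prepend (butlast v) (rp (last v))))
     has_sum \<Phi> ((L ^^ n) unit)) {v. length v = Suc n}"
proof -
  let ?f = "\<lambda>(i, v). wt i * word_weight n (prepend v (rp i))"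
  have inner: "((\<lambda>v. ?f (i, v)) has_sum wt i * (L ^^ n) unit (rp i)) {v. length v = n}" for i
    using has_sum_cmult_right[OF has_sum_words, of "wt i" n "rp i"] by simp
  have outer: "((\<lambda>i. wt i * (L ^^ n) unit (rp i)) has_sum \<Phi> ((L ^^ n) unit)) UNIV"
    unfolding \<Phi>_def using wt_nonneg L_unit_nonneg by (intro nonneg_has_sum_nat \<Phi>_summable bdd_L_unit) auto
  have "(?f has_sum \<Phi> ((L ^^ n) unit)) (UNIV \<times> {v. length v = n})"
    using has_sum_imp_summable[OF outer]
    by (intro has_sum_SigmaI[OF inner outer] summable_on_SigmaI[OF inner]) (auto simp: word_weight_nonneg wt_nonneg)
  then show ?thesis
    by (subst has_sum_reindex_bij_betw[OF bij_snoc, symmetric]) (simp add: case_prod_unfold)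
qed

lemma prepend_in_cylinder: "prepend v x \<in> E \<Longrightarrow> prepend v x \<in> cylinder I A v"
  by (simp add: cylinder_def prepend_nth)

lemma prepend_in_E_words:
  assumes "prepend v x \<in> E" shows "v \<in> E_words I A (length v)"
proof -
  have "v = map (prepend v x) [0..<0 + length v]" by (rule nth_equalityI) (simp_all add: prepend_nth)
  then show ?thesis using assms unfolding E_words_def by blast
qed

lemma E_words_length: "v \<in> E_words I A n \<Longrightarrow> length v = n"
  by (auto simp: E_words_def)

lemma sum_le_partition_sum:
  assumes "finite F" "F \<subseteq> E_words I A n"
  shows "(\<Sum>v\<in>F. SUP \<tau>\<in>cylinder I A v. ennreal (exp (birkhoff_sum n u \<tau>))) \<le> partition_sum I A u n"
  unfolding partition_sum_def by (subst nonneg_infsum_complete) (use assms in \<open>auto intro: SUP_upper\<close>)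

lemma partition_sum_lower: "ennreal (r n) \<le> partition_sum I A u n"
proof (cases "partition_sum I A u n")
  case (real z)
  have "(L ^^ n) unit x \<le> z" for x
  proof (rule has_sum_le_finite_sums[OF has_sum_words])
    fix F :: "nat list set" assume F: "finite F" "F \<subseteq> {v. length v = n}"
    let ?G = "{v\<in>F. prepend v x \<in> E}"
    have "(\<Sum>v\<in>F. word_weight n (prepend v x)) = (\<Sum>v\<in>?G. word_weight n (prepend v x))"
      using F by (intro sum.mono_neutral_right) (auto simp: word_weight_def)
    then have "ennreal (\<Sum>v\<in>F. word_weight n (prepend v x)) = (\<Sum>v\<in>?G. ennreal (word_weight n (prepend v x)))"
      by (simp add: word_weight_nonneg)
    also have "\<dots> \<le> (\<Sum>v\<in>?G. SUP \<tau>\<in>cylinder I A v. ennreal (exp (birkhoff_sum n u \<tau>)))"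
    proof (rule sum_mono)
      fix v assume "v \<in> ?G"
      then show "ennreal (word_weight n (prepend v x)) \<le> (SUP \<tau>\<in>cylinder I A v. ennreal (exp (birkhoff_sum n u \<tau>)))"
        by (intro SUP_upper2[OF prepend_in_cylinder]) (auto simp: word_weight_def)
    qed
    also have "\<dots> \<le> partition_sum I A u n"
      using F prepend_in_E_words by (intro sum_le_partition_sum) auto
    finally show "(\<Sum>v\<in>F. word_weight n (prepend v x)) \<le> z" using real by simp
  qed
  then have "r n \<le> z" by (intro r_least)
  then show ?thesis using real by (simp add: ennreal_leI)
qed simp

lemma cylinder_sup_le:
  assumes v: "v \<in> E_words I A (Suc n)"
  shows "(SUP \<tau>\<in>cylinder I A v. ennreal (exp (birkhoff_sum (Suc n) u \<tau>)))
    \<le> ennreal (exp (a / (1 - \<theta>)) * (wt (last v) * word_weight n (prepend (butlast v) (rp (last v)))))"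
proof -
  obtain x j where x: "x \<in> E" "v = map x [j..<j + Suc n]" using v unfolding E_words_def by blast
  have v': "v = map x [j..<j + n] @ [x (j + n)]" using x(2) by simp
  have last: "last v = x (j + n)" and butlast: "butlast v = map x [j..<j + n]" unfolding v' by auto
  have i: "last v \<in> I" using x(1) unfolding last by (simp add: E_inf_def)
  let ?y = "prepend (butlast v) (rp (last v))"
  have y: "?y \<in> E" "agree (Suc n) (\<lambda>i. x (j + i)) ?y"
    unfolding butlast using prepend_word[OF x(1) rp(1)[OF i], of j n] rp(2)[OF i] last by auto
  have len: "length (butlast v) = n" by (simp add: butlast)
  have weight: "wt (last v) * word_weight n ?y = exp (birkhoff_sum (Suc n) u ?y)"
  proof -
    have "wt (last v) * word_weight n ?y = word_weight (Suc n) ?y"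
      using word_weight_Suc[OF len, of "rp (last v)"] i by (simp add: wt_def)
    also have "\<dots> = exp (birkhoff_sum (Suc n) u ?y)" using y(1) by (simp add: word_weight_def)
    finally show ?thesis .
  qed
  show ?thesis unfolding weight
  proof (rule SUP_least)
    fix \<tau> assume \<tau>: "\<tau> \<in> cylinder I A v"
    then have "\<tau> \<in> E" by (simp add: cylinder_def)
    moreover have "agree (Suc n) \<tau> ?y"
    proof -
      have "\<tau> i = x (j + i)" if "i < Suc n" for i
        using \<tau> that by (simp add: cylinder_def x(2) del: upt_Suc)
      then show ?thesis using y(2) by (simp add: agree_def)
    qed
    ultimately have "birkhoff_sum (Suc n) u \<tau> \<le> birkhoff_sum (Suc n) u ?y + a / (1 - \<theta>)"
      using y(1) by (intro birkhoff_distortion)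
    then show "ennreal (exp (birkhoff_sum (Suc n) u \<tau>))
        \<le> ennreal (exp (a / (1 - \<theta>)) * exp (birkhoff_sum (Suc n) u ?y))"
      by (intro ennreal_leI) (simp add: exp_add[symmetric] add.commute)
  qed
qed

lemma partition_sum_upper:
  "partition_sum I A u (Suc n) \<le> ennreal (exp (a / (1 - \<theta>)) * B_r / c_low * r (Suc n))"
proof -
  let ?D = "exp (a / (1 - \<theta>))"
  let ?t = "\<lambda>v. wt (last v) * word_weight n (prepend (butlast v) (rp (last v)))"
  have "partition_sum I A u (Suc n) \<le> ennreal (?D * \<Phi> ((L ^^ n) unit))"
    unfolding partition_sum_def
  proof (subst nonneg_infsum_complete, simp, rule SUP_least)
    fix F assume "F \<in> {F. finite F \<and> F \<subseteq> E_words I A (Suc n)}"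
    then have F: "finite F" "F \<subseteq> E_words I A (Suc n)" by auto
    have nn: "0 \<le> ?t v" for v by (simp add: wt_nonneg word_weight_nonneg)
    have "(\<Sum>v\<in>F. SUP \<tau>\<in>cylinder I A v. ennreal (exp (birkhoff_sum (Suc n) u \<tau>)))
        \<le> (\<Sum>v\<in>F. ennreal (?D * ?t v))"
      using F by (intro sum_mono cylinder_sup_le) auto
    also have "\<dots> = ennreal (?D * (\<Sum>v\<in>F. ?t v))"
      using nn by (subst sum_ennreal) (auto simp: sum_distrib_left)
    also have "\<dots> \<le> ennreal (?D * \<Phi> ((L ^^ n) unit))"
    proof (intro ennreal_leI mult_left_mono)
      show "(\<Sum>v\<in>F. ?t v) \<le> \<Phi> ((L ^^ n) unit)"
        using F E_words_length nn by (intro finite_sum_le_has_sum[OF has_sum_marked_words]) auto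
    qed simp
    finally show "(\<Sum>v\<in>F. SUP \<tau>\<in>cylinder I A v. ennreal (exp (birkhoff_sum (Suc n) u \<tau>)))
        \<le> ennreal (?D * \<Phi> ((L ^^ n) unit))" .
  qed
  also have "\<dots> \<le> ennreal (?D * (B_r / c_low * r (Suc n)))"
  proof (intro ennreal_leI mult_left_mono)
    obtain x where x: "x \<in> E" using E_nonempty by blast
    have "c_low * \<Phi> ((L ^^ n) unit) \<le> B_r * r (Suc n)"
      using Q_lower[OF cone_L_unit x] Q_L_unit_upper[of n x] by (rule order_trans)
    then show "\<Phi> ((L ^^ n) unit) \<le> B_r / c_low * r (Suc n)"
      using c_low_pos by (simp add: pos_le_divide_eq mult.commute)
  qed simp
  also have "?D * (B_r / c_low * r (Suc n)) = ?D * B_r / c_low * r (Suc n)" by simp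
  finally show ?thesis .
qed

text \<open>
  \<open>ln (r n)\<close> is quasi-additive and differs from the logarithm of the partition sum by a bounded amount. So the limit that
  defines the pressure exists, and the error is bounded, not merely sublinear in \<open>n\<close>.
\<close>

lemma r_exponential_growth:
  obtains C where "0 \<le> C" "\<And>n. 1 \<le> n \<Longrightarrow> \<bar>ln (r n) - real n * real_of_ereal (pressure I A u)\<bar> \<le> C"
proof -
  define C1 where "C1 = \<bar>ln (c_r * c_r / (B_r * B_r))\<bar>"
  have "\<bar>ln (r (n + l)) - ln (r n) - ln (r l)\<bar> \<le> C1" if nl: "1 \<le> n" "1 \<le> l" for n l
  proof -
    obtain n' l' where nl': "n = Suc n'" "l = Suc l'" using nl by (metis not0_implies_Suc not_one_le_zero)
    have pos: "0 < r n" "0 < r l" "0 < r (n + l)" "0 < c_r * c_r / (B_r * B_r)"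
      using r_pos c_r_pos B_r(2) by auto
    have "r (n + l) \<le> r n * r l" by (rule r_submultiplicative)
    then have "ln (r (n + l)) \<le> ln (r n * r l)" using pos by simp
    then have 1: "ln (r (n + l)) \<le> ln (r n) + ln (r l)" using pos by (simp add: ln_mult)
    have "c_r * c_r / (B_r * B_r) * (r n * r l) \<le> r (n + l)"
      using r_supermultiplicative[of n' l'] B_r(2) unfolding nl' by (simp add: field_simps)
    moreover have "0 < c_r * c_r / (B_r * B_r) * (r n * r l)" using pos by (intro mult_pos_pos)
    ultimately have "ln (c_r * c_r / (B_r * B_r) * (r n * r l)) \<le> ln (r (n + l))"
      using pos(3) by (simp only: ln_le_cancel_iff)
    then have "ln (c_r * c_r / (B_r * B_r)) + (ln (r n) + ln (r l)) \<le> ln (r (n + l))"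
      by (simp only: ln_mult_pos[OF pos(4) mult_pos_pos[OF pos(1,2)]] ln_mult_pos[OF pos(1,2)])
    with 1 show ?thesis unfolding C1_def by linarith
  qed
  then obtain p where p: "\<And>n. 1 \<le> n \<Longrightarrow> \<bar>ln (r n) - real n * p\<bar> \<le> C1"
    using quasi_additive[of "\<lambda>n. ln (r n)" C1] by blast
  define D where "D = exp (a / (1 - \<theta>)) * B_r / c_low"
  have D: "0 < D" using B_r(2) c_low_pos by (simp add: D_def)
  define z where "z n = enn2real (partition_sum I A u n)" for n
  have z: "partition_sum I A u n = ennreal (z n)" "r n \<le> z n" "z n \<le> D * r n" if n: "1 \<le> n" for n
  proof -
    obtain n' where n': "n = Suc n'" using n by (metis not0_implies_Suc not_one_le_zero)
    have up: "partition_sum I A u n \<le> ennreal (D * r n)"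
      using partition_sum_upper[of n'] by (simp add: n' D_def)
    then have "partition_sum I A u n < \<infinity>" by (simp add: le_less_trans)
    then show eq: "partition_sum I A u n = ennreal (z n)" by (simp add: z_def less_top)
    have z0: "0 \<le> z n" by (simp add: z_def)
    show "r n \<le> z n" using partition_sum_lower[of n] z0 unfolding eq by simp
    show "z n \<le> D * r n" using up D r_pos[of n] unfolding eq by simp
  qed
  define C2 where "C2 = C1 + \<bar>ln D\<bar>"
  have lnz: "\<bar>ln (z n) - real n * p\<bar> \<le> C2" if n: "1 \<le> n" for n
  proof -
    have zp: "0 < z n" using z(2)[OF n] r_pos[of n] by linarith
    have "ln (r n) \<le> ln (z n)" using z(2)[OF n] r_pos[of n] zp by simp
    moreover have "ln (z n) \<le> ln (D * r n)" using z(3)[OF n] zp D r_pos[of n] by simp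
    moreover have "ln (D * r n) = ln D + ln (r n)" using D r_pos[of n] by (simp add: ln_mult_pos)
    ultimately show ?thesis using p[OF n] unfolding C2_def by linarith
  qed
  have "(\<lambda>n. ln (z n) / real n) \<longlonglongrightarrow> p"
  proof -
    have "(\<lambda>n. ln (z n) / real n - p) \<longlonglongrightarrow> 0"
    proof (rule Lim_null_comparison)
      show "\<forall>\<^sub>F n in sequentially. norm (ln (z n) / real n - p) \<le> C2 / real n"
      proof (rule eventually_sequentiallyI[of 1])
        fix n :: nat assume n: "1 \<le> n"
        have "ln (z n) / real n - p = (ln (z n) - real n * p) / real n" using n by (simp add: field_simps)
        then show "norm (ln (z n) / real n - p) \<le> C2 / real n"
          using lnz[OF n] n by (simp add: divide_right_mono)
      qed
      show "(\<lambda>n. C2 / real n) \<longlonglongrightarrow> 0" by (rule lim_const_over_n)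
    qed
    then show ?thesis by (simp add: LIM_zero_iff)
  qed
  then have "(\<lambda>n. ereal (ln (z n) / real n)) \<longlonglongrightarrow> ereal p" by simp
  then have "(\<lambda>n. ext_log (partition_sum I A u n) / ereal (real n)) \<longlonglongrightarrow> ereal p"
  proof (rule Lim_transform_eventually)
    show "\<forall>\<^sub>F n in sequentially. ereal (ln (z n) / real n) = ext_log (partition_sum I A u n) / ereal (real n)"
    proof (rule eventually_sequentiallyI[of 1])
      fix n :: nat assume n: "1 \<le> n"
      have zp: "0 < z n" using z(2)[OF n] r_pos[of n] by linarith
      then show "ereal (ln (z n) / real n) = ext_log (partition_sum I A u n) / ereal (real n)"
        using n unfolding z(1)[OF n] ext_log_def by simp
    qed
  qed
  then have "pressure I A u = ereal p" unfolding pressure_def by (rule limI)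
  moreover have "0 \<le> C1" by (simp add: C1_def)
  ultimately show ?thesis using that[of C1] p by simp
qed

lemma normalized_if_pressure_zero:
  assumes "pressure I A u = 0"
  obtains C0 c0 where "normalized_system I A \<theta> u a M \<Lambda> C0 c0"
proof -
  obtain C where C: "0 \<le> C" "\<And>n. 1 \<le> n \<Longrightarrow> \<bar>ln (r n)\<bar> \<le> C"
    using r_exponential_growth assms by auto
  have up: "r n \<le> exp C" and lo: "exp (- C) \<le> r n" if n: "1 \<le> n" for n
  proof -
    have "exp (ln (r n)) \<le> exp C" "exp (- C) \<le> exp (ln (r n))" using C(2)[OF n] by auto
    then show "r n \<le> exp C" "exp (- C) \<le> r n" using r_pos[of n] by simp_all
  qed
  have "normalized_system I A \<theta> u a M \<Lambda> (exp C) (c_r * exp (- C))"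
  proof
    fix n x
    show "(L ^^ n) unit x \<le> exp C"
    proof (cases "1 \<le> n")
      case True
      have "(L ^^ n) unit x \<le> r n * unit x" by (rule r_upper)
      also have "\<dots> \<le> r n" using r_pos[of n] by (simp add: unit_def)
      finally show ?thesis using up[OF True] by linarith
    next
      case False
      then have "n = 0" by simp
      then show ?thesis using C(1) by (simp add: unit_def order_trans[of 0 1])
    qed
    show "c_r * exp (- C) \<le> Q ((L ^^ n) unit) x" if "x \<in> E"
    proof -
      have "c_r * exp (- C) \<le> c_r * r (Suc n)" using lo[of "Suc n"] c_r_pos by (intro mult_left_mono) auto
      also have "\<dots> \<le> Q ((L ^^ n) unit) x" by (rule Q_L_unit_lower[OF that])
      finally show ?thesis .
    qed
    show "0 < c_r * exp (- C)" using c_r_pos by simp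
  qed
  then show ?thesis by (rule that)
qed

end

section \<open>The perturbed transfer operators\<close>

context carrier_banach
begin

lemma ops_cong:
  assumes T: "T \<in> ops" and eq: "\<And>f. f \<in> V \<Longrightarrow> T f = T' f" shows "T' \<in> ops"
proof -
  obtain C where "\<And>f. f \<in> V \<Longrightarrow> N (T f) \<le> C * N f" using ops_bound[OF T] by metis
  then show ?thesis
    by (intro opsI[where C=C])
      (simp_all add: eq[symmetric] ops_mem[OF T] ops_add[OF T] ops_cscale[OF T] add_mem cscale_mem)
qed

lemma invertible_op_cong:
  assumes "invertible_op V N T" and eq: "\<And>f. f \<in> V \<Longrightarrow> T f = T' f"
  shows "invertible_op V N T'" and "inv_into V T' = inv_into V T"
proof -
  show inv: "inv_into V T' = inv_into V T"
    unfolding inv_into_def using eq by (intro ext arg_cong[where f=Eps]) auto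
  have "bij_betw T V V \<longleftrightarrow> bij_betw T' V V" using eq by (rule bij_betw_cong)
  moreover have "T' \<in> ops"
    by (rule ops_cong[of T]) (use assms(1) eq in \<open>auto simp: invertible_op_def\<close>)
  ultimately show "invertible_op V N T'"
    using assms(1) unfolding invertible_op_def inv by blast
qed

end

text \<open>
  All partition sums vanish on an empty shift space. So zero pressure makes it nonempty.
\<close>

lemma pressure_empty:
  assumes "E_inf I A = {}" shows "pressure I A u \<noteq> 0"
proof -
  have "E_words I A n = {}" for n using assms by (auto simp: E_words_def)
  then have e: "ext_log (partition_sum I A u n) = -\<infinity>" for n by (simp add: partition_sum_def ext_log_def)
  have "(\<lambda>n. ext_log (partition_sum I A u n) / ereal (real n)) \<longlonglongrightarrow> -\<infinity>"
    by (rule Lim_transform_eventually[OF tendsto_const], rule eventually_sequentiallyI[of 1]) (simp add: e)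
  then have "pressure I A u = -\<infinity>" unfolding pressure_def by (rule limI)
  then show ?thesis by simp
qed

lemma birkhoff_sum_cong:
  assumes "\<And>x. x \<in> E_inf I A \<Longrightarrow> u x = v x" "x \<in> E_inf I A"
  shows "birkhoff_sum n u x = birkhoff_sum n v x"
proof -
  have "(shift ^^ j) x \<in> E_inf I A" for j
    using assms(2) by (induction j) (auto simp: E_inf_def shift_def)
  then show ?thesis unfolding birkhoff_sum_def using assms(1) by (intro sum.cong) auto
qed

lemma pressure_cong:
  assumes "\<And>x. x \<in> E_inf I A \<Longrightarrow> u x = v x" shows "pressure I A u = pressure I A v"
proof -
  have "partition_sum I A u n = partition_sum I A v n" for n
    unfolding partition_sum_def
    by (intro infsum_cong SUP_cong refl) (simp add: birkhoff_sum_cong[OF assms] cylinder_def)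
  then show ?thesis unfolding pressure_def by simp
qed

text \<open>
  The suprema over the cylinders of length one, read as real numbers.
\<close>

lemma summable_potential_majorant:
  assumes "summable_potential I A u"
  obtains M where "summable M" "\<And>i. 0 \<le> M i" "\<And>y. y \<in> E_inf I A \<Longrightarrow> exp (u y) \<le> M (y 0)"
proof -
  define s where "s e = (SUP \<tau>\<in>cylinder I A [e]. ennreal (exp (u \<tau>)))" for e
  define S where "S = (\<Sum>\<^sub>\<infinity>e\<in>I. s e)"
  have S: "S < \<infinity>" using assms unfolding summable_potential_def S_def s_def .
  have sum_le: "sum s F \<le> S" if "finite F" "F \<subseteq> I" for F
    unfolding S_def by (subst nonneg_infsum_complete) (use that in \<open>auto intro: SUP_upper\<close>)
  have fin: "s e < \<infinity>" if "e \<in> I" for e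
    using sum_le[of "{e}"] that S by (auto intro: le_less_trans)
  define M where "M i = (if i \<in> I then enn2real (s i) else 0)" for i
  have nn: "0 \<le> M i" for i by (simp add: M_def)
  have "summable M"
  proof (rule summableI_nonneg_bounded[where x="enn2real S"])
    fix n
    let ?F = "{..<n} \<inter> I"
    have "(\<Sum>i<n. M i) = (\<Sum>i\<in>?F. enn2real (s i))"
      unfolding M_def by (simp add: sum.inter_restrict)
    also have "\<dots> = enn2real (sum s ?F)" using fin by (subst enn2real_sum) (auto simp: o_def)
    also have "\<dots> \<le> enn2real S" using S by (intro enn2real_mono sum_le) auto
    finally show "(\<Sum>i<n. M i) \<le> enn2real S" .
  qed (rule nn)
  moreover have "exp (u y) \<le> M (y 0)" if y: "y \<in> E_inf I A" for y
  proof -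
    have i: "y 0 \<in> I" using y by (simp add: E_inf_def)
    have "ennreal (exp (u y)) \<le> s (y 0)" unfolding s_def
      using y by (intro SUP_upper) (simp add: cylinder_def)
    then have "enn2real (ennreal (exp (u y))) \<le> enn2real (s (y 0))"
      using fin[OF i] by (intro enn2real_mono) auto
    then show ?thesis using i by (simp add: M_def)
  qed
  ultimately show ?thesis using that nn by blast
qed

text \<open>
  A word that joins \<open>i\<close> to the first letter of \<open>x\<close> is read off from some point of the shift space. As transitions
  only involve two neighbouring letters, the rest of that point can be replaced by \<open>x\<close>.
\<close>

lemma finitely_irreducible_connect:
  assumes "finitely_irreducible I A"
  obtains \<Lambda> where "finite \<Lambda>" "\<And>\<omega>. \<omega> \<in> \<Lambda> \<Longrightarrow> set \<omega> \<subseteq> I"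
    "\<And>i x. shift_space I A \<theta> \<Longrightarrow> i \<in> I \<Longrightarrow> x \<in> E_inf I A \<Longrightarrow> \<exists>\<omega>\<in>\<Lambda>. cons_seq i (prepend \<omega> x) \<in> E_inf I A"
proof -
  obtain \<Lambda> where \<Lambda>: "finite \<Lambda>" "\<Lambda> \<subseteq> E_star I A"
    and con: "\<And>i j. i \<in> I \<Longrightarrow> j \<in> I \<Longrightarrow> \<exists>\<omega>\<in>\<Lambda>. [i] @ \<omega> @ [j] \<in> E_star I A"
    using assms unfolding finitely_irreducible_def by blast
  show ?thesis
  proof (rule that[OF \<Lambda>(1)])
    show "set \<omega> \<subseteq> I" if "\<omega> \<in> \<Lambda>" for \<omega>
      using that \<Lambda>(2) by (fastforce simp: E_star_def E_words_def E_inf_def)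
    fix i x assume sp: "shift_space I A \<theta>" and i: "i \<in> I" and x: "x \<in> E_inf I A"
    have "x 0 \<in> I" using x by (simp add: E_inf_def)
    then obtain \<omega> where \<omega>: "\<omega> \<in> \<Lambda>" "[i] @ \<omega> @ [x 0] \<in> E_star I A" using con i by blast
    then obtain \<tau> k n where "\<tau> \<in> E_inf I A" "[i] @ \<omega> @ [x 0] = map \<tau> [k..<k + n]"
      unfolding E_star_def E_words_def by blast
    then have \<tau>: "\<tau> \<in> E_inf I A" "(i # \<omega>) @ [x 0] = map \<tau> [k..<k + n]" by simp_all
    have "length ((i # \<omega>) @ [x 0]) = n" using \<tau>(2) by simp
    then obtain l where n: "n = Suc l" by (cases n) auto
    have "i # \<omega> = map \<tau> [k..<k + l]" "x 0 = \<tau> (k + l)" using \<tau>(2) unfolding n by auto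
    then have "prepend (i # \<omega>) x \<in> E_inf I A"
      using shift_space.prepend_word(1)[OF sp \<tau>(1) x, of k l] by metis
    then show "\<exists>\<omega>\<in>\<Lambda>. cons_seq i (prepend \<omega> x) \<in> E_inf I A" using \<omega>(1) by auto
  qed
qed

context shift_space
begin

lemma F_theta_lip:
  assumes "f \<in> F_theta I A \<theta>" obtains b where "0 \<le> b" "lip f b"
proof -
  have "theta_norm I A \<theta> f < \<infinity>" using assms by (simp add: F_theta_def)
  from lip_theta_norm[OF this] show ?thesis by (rule that[OF enn2real_nonneg])
qed

lemma preimages: "{y \<in> E. shift y = x} = (\<lambda>i. cons_seq i x) ` {i. cons_seq i x \<in> E}"
proof
  show "{y \<in> E. shift y = x} \<subseteq> (\<lambda>i. cons_seq i x) ` {i. cons_seq i x \<in> E}"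
  proof
    fix y assume "y \<in> {y \<in> E. shift y = x}"
    then have "y = cons_seq (y 0) x" "cons_seq (y 0) x \<in> E" using cons_seq_shift[of y] by auto
    then show "y \<in> (\<lambda>i. cons_seq i x) ` {i. cons_seq i x \<in> E}" by blast
  qed
qed auto

lemma transfer_op_eq_ker_op:
  assumes k: "kernel (\<lambda>y. if y \<in> E then exp (f y) else 0) M" and g: "g \<in> V"
  shows "transfer_op I A f g = ker_op (\<lambda>y. if y \<in> E then exp (f y) else 0) g"
proof
  fix x
  let ?W = "\<lambda>y. if y \<in> E then exp (f y) else 0"
  have sm: "summable (\<lambda>i. norm (?W (cons_seq i x) * g (cons_seq i x)))"
    by (rule kernel_summable[where g=g, OF k Fb_bound[OF g]])
  have "transfer_op I A f g x = infsum (\<lambda>i. exp (f (cons_seq i x)) * g (cons_seq i x)) {i. cons_seq i x \<in> E}"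
    unfolding transfer_op_def preimages
    by (subst infsum_reindex) (auto intro: inj_on_subset[OF inj_cons_seq] simp: o_def)
  also have "\<dots> = infsum (\<lambda>i. ?W (cons_seq i x) * g (cons_seq i x)) UNIV"
    by (rule infsum_cong_neutral) auto
  also have "\<dots> = ker_op ?W g x"
    unfolding ker_op_def
    by (intro infsumI norm_summable_imp_has_sum[OF sm] summable_sums summable_norm_cancel[OF sm])
  finally show "transfer_op I A f g x = ker_op ?W g x" .
qed

text \<open>
  As \<open>\<xi> \<ge> 0\<close>, the weight at \<open>z\<close> is dominated by the one at any real \<open>t \<ge> Re z\<close>, where summability is known. The
  variation of the exponential is bounded by that of the exponent times the size of the weight.
\<close>

lemma kernel_perturbed:
  assumes b: "lip \<eta> b" "0 \<le> b" "lip \<xi> d" "0 \<le> d" and nn: "\<And>y. y \<in> E \<Longrightarrow> 0 \<le> \<xi> y"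
    and M: "summable M" "\<And>i. 0 \<le> M i" "\<And>y. y \<in> E \<Longrightarrow> exp (\<eta> y + t * \<xi> y) \<le> M (y 0)"
    and z: "Re z \<le> t" "cmod z \<le> R"
  shows "kernel (\<lambda>y. if y \<in> E then exp (complex_of_real (\<eta> y) + z * complex_of_real (\<xi> y)) else 0)
     (\<lambda>i. (1 + 2 * (b + R * d)) * M i)"
proof -
  let ?f = "\<lambda>y. complex_of_real (\<eta> y) + z * complex_of_real (\<xi> y)"
  have R: "0 \<le> R" using z(2) norm_ge_zero order_trans by blast
  have bR: "0 \<le> b + R * d" using R b by simp
  have le: "cmod (exp (?f y)) \<le> M (y 0)" if "y \<in> E" for y
  proof -
    have "Re z * \<xi> y \<le> t * \<xi> y" using z(1) nn[OF that] by (rule mult_right_mono)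
    then have "exp (\<eta> y + Re z * \<xi> y) \<le> exp (\<eta> y + t * \<xi> y)" by simp
    also note M(3)[OF that]
    finally show ?thesis by (simp add: norm_exp_eq_Re)
  qed
  have c: "M i \<le> (1 + 2 * (b + R * d)) * M i" for i
    using mult_right_mono[of 1 "1 + 2 * (b + R * d)" "M i"] M(2)[of i] bR by simp
  show ?thesis
    unfolding kernel_def
  proof (intro conjI allI ballI impI)
    show "summable (\<lambda>i. (1 + 2 * (b + R * d)) * M i)" by (rule summable_mult[OF M(1)])
    show "0 \<le> (1 + 2 * (b + R * d)) * M i" for i using M(2)[of i] bR by simp
    show "cmod (if y \<in> E then exp (?f y) else 0) \<le> (1 + 2 * (b + R * d)) * M (y 0)" if "y \<in> E" for y
      using le[OF that] c[of "y 0"] that by simp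
    fix n :: nat and x y assume a: "1 \<le> n" "x \<in> E" "y \<in> E" "agree n x y"
    have "cmod (?f x - ?f y) \<le> (b + R * d) * \<theta> ^ n"
    proof -
      have eq: "?f x - ?f y = complex_of_real (\<eta> x - \<eta> y) + z * complex_of_real (\<xi> x - \<xi> y)"
        by (simp add: algebra_simps)
      have "cmod (?f x - ?f y) \<le> cmod (complex_of_real (\<eta> x - \<eta> y)) + cmod (z * complex_of_real (\<xi> x - \<xi> y))"
        unfolding eq by (rule norm_triangle_ineq)
      also have "\<dots> = \<bar>\<eta> x - \<eta> y\<bar> + cmod z * \<bar>\<xi> x - \<xi> y\<bar>" by (simp only: norm_mult norm_of_real)
      also have "\<dots> \<le> b * \<theta> ^ n + R * (d * \<theta> ^ n)"
        using lipD[OF b(1) a] lipD[OF b(3) a] z(2) R by (intro add_mono mult_mono) auto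
      finally show ?thesis by (simp add: algebra_simps)
    qed
    moreover have "cmod (exp (?f x)) + cmod (exp (?f y)) \<le> 2 * M (x 0)"
      using le[OF a(2)] le[OF a(3)] agree_head[OF a(4,1)] by simp
    ultimately have "cmod (?f x - ?f y) * (cmod (exp (?f x)) + cmod (exp (?f y)))
        \<le> ((b + R * d) * \<theta> ^ n) * (2 * M (x 0))"
      using bR theta_power(1)[of n] by (intro mult_mono) auto
    also have "\<dots> \<le> (1 + 2 * (b + R * d)) * M (x 0) * \<theta> ^ n"
      using M(2)[of "x 0"] theta_power(1)[of n] by (simp add: algebra_simps)
    finally show "cmod ((if x \<in> E then exp (?f x) else 0) - (if y \<in> E then exp (?f y) else 0))
        \<le> (1 + 2 * (b + R * d)) * M (x 0) * \<theta> ^ n"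
      using norm_exp_diff_le[of "?f x" "?f y"] a(2,3) by simp
  qed auto
qed

definition nonneg_fun :: "(seq \<Rightarrow> complex) \<Rightarrow> bool" where
  "nonneg_fun f \<longleftrightarrow> (\<forall>x. f x \<in> \<real> \<and> 0 \<le> Re (f x))"

lemma nonneg_fun_add: "nonneg_fun f \<Longrightarrow> nonneg_fun g \<Longrightarrow> nonneg_fun (f + g)"
  by (simp add: nonneg_fun_def)

lemma nonneg_fun_zero: "nonneg_fun 0" by (simp add: nonneg_fun_def)

lemma nonneg_fun_sum: "(\<And>i. i \<in> S \<Longrightarrow> nonneg_fun (F i)) \<Longrightarrow> nonneg_fun (sum F S)"
  by (induction S rule: infinite_finite_induct) (auto simp: nonneg_fun_zero intro: nonneg_fun_add)

lemma nonneg_fun_cscale: "nonneg_fun f \<Longrightarrow> 0 \<le> c \<Longrightarrow> nonneg_fun (complex_of_real c *\<^sub>C f)"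
  by (simp add: nonneg_fun_def cscale_fun_def cscale_complex_def)

lemma nonneg_fun_ker_op:
  assumes W: "kernel W M" and Wnn: "nonneg_fun W" and f: "f \<in> V" "nonneg_fun f"
  shows "nonneg_fun (ker_op W f)"
    and "Re (W (cons_seq i x)) * Re (f (cons_seq i x)) \<le> Re (ker_op W f x)"
proof -
  let ?t = "\<lambda>x i. W (cons_seq i x) * f (cons_seq i x)"
  have sm: "summable (?t x)" for x
    by (rule summable_norm_cancel, rule kernel_summable[where g=f, OF W Fb_bound[OF f(1)]])
  have im: "Im (W y) = 0" "Im (f y) = 0" for y
    using Wnn f(2) by (auto simp: nonneg_fun_def complex_is_Real_iff)
  have re: "0 \<le> Re (W y)" "0 \<le> Re (f y)" for y using Wnn f(2) by (auto simp: nonneg_fun_def)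
  have nn: "0 \<le> Re (?t x i)" for x i using re im by simp
  have "Im (ker_op W f x) = (\<Sum>i. Im (?t x i))" for x
    unfolding ker_op_def by (rule bounded_linear.suminf[OF bounded_linear_Im sm])
  then have "Im (ker_op W f x) = 0" for x using im by simp
  moreover have Re: "Re (ker_op W f x) = (\<Sum>i. Re (?t x i))" for x
    unfolding ker_op_def by (rule bounded_linear.suminf[OF bounded_linear_Re sm])
  moreover have "0 \<le> (\<Sum>i. Re (?t x i))" for x by (intro suminf_nonneg summable_Re sm nn)
  ultimately show "nonneg_fun (ker_op W f)" by (simp add: nonneg_fun_def complex_is_Real_iff)
  have "(\<Sum>i\<in>{i}. Re (?t x i)) \<le> (\<Sum>i. Re (?t x i))"
    by (rule sum_le_suminf[OF summable_Re[OF sm]]) (use nn in auto)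
  then show "Re (W (cons_seq i x)) * Re (f (cons_seq i x)) \<le> Re (ker_op W f x)"
    using im by (simp add: Re)
qed

end

text \<open>
  All operators involved have nonnegative weights, so no cancellation occurs. In the derivative
  of the average the first summand \<open>D (R0 e) / m\<close>, and in the cofactor the summand \<open>R0 e / m\<close>, is already nonzero.
\<close>

lemma (in normalized_system) transversality_and_nonvanishing:
  assumes R0: "two_sided_inverse (\<lambda>f. f - power_average m Lc f + \<phi> f *\<^sub>C e) R0"
    and R0e: "R0 e = ofr h"
    and D: "D = ker_op W'" and W': "kernel W' M'" "nonneg_fun W'" and x1: "W' x1 \<noteq> 0"
  shows "\<phi> (R0 ((1 / of_nat m) *\<^sub>C (\<Sum>k<m. power_deriv Lc D (Suc k) (R0 e)))) \<noteq> 0"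
    and "power_cofactor m Lc (R0 e) \<noteq> 0"
proof -
  note RD = two_sided_inverseD[OF R0]
  have x1E: "x1 \<in> E" using kernelD(3)[OF W'(1), of x1] x1 by blast
  have hV: "R0 e \<in> V" by (rule ops_mem[OF RD(2) e_in_V])
  have hnn: "nonneg_fun (R0 e)" using h_ge_unit unit_nonneg unfolding R0e nonneg_fun_def ofr_def
    by (auto intro: order_trans)
  have hpos: "0 < Re (R0 e x)" if "x \<in> E" for x
    using h_ge_unit[of x] that unfolding R0e ofr_def by (simp add: unit_def)
  have wnn: "nonneg_fun (\<lambda>y. complex_of_real (w y))" by (simp add: nonneg_fun_def w_nonneg)
  have Lnn: "nonneg_fun (Lc f)" if "f \<in> V" "nonneg_fun f" for f
    unfolding Lc_def by (rule nonneg_fun_ker_op(1)[OF kernel_c wnn that])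
  have D_ops: "D \<in> ops" unfolding D by (rule ker_op_in_ops[OF W'(1)])
  have Dnn: "nonneg_fun (D f)" if "f \<in> V" "nonneg_fun f" for f
    unfolding D by (rule nonneg_fun_ker_op(1)[OF W' that])
  have powV: "(Lc ^^ n) (R0 e) \<in> V" for n by (rule ops_mem[OF funpow_in_ops[OF Lc_ops] hV])
  have pow: "nonneg_fun ((Lc ^^ n) (R0 e))" for n
    by (induction n) (auto intro: hnn Lnn powV)
  have derV: "power_deriv Lc D n (R0 e) \<in> V" for n
    by (induction n; simp only: power_deriv.simps zero_mem)
      (intro add_mem ops_mem[OF D_ops] ops_mem[OF Lc_ops] powV)
  have der: "nonneg_fun (power_deriv Lc D n (R0 e))" for n
    by (induction n; simp only: power_deriv.simps nonneg_fun_zero)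
      (intro nonneg_fun_add Dnn Lnn powV pow derV)
  have scale: "(1 / of_nat m :: complex) = complex_of_real (1 / real m)" by simp
  let ?f = "(1 / of_nat m) *\<^sub>C (\<Sum>k<m. power_deriv Lc D (Suc k) (R0 e))"
  have fV: "?f \<in> V" by (intro cscale_mem sum_mem derV)
  have fnn: "nonneg_fun ?f" unfolding scale by (intro nonneg_fun_cscale nonneg_fun_sum der) auto
  let ?y = "shift x1"
  have sum_pos: "0 < Re ((\<Sum>k<m. F k) x)" if "0 < Re (F 0 x)" "\<And>k. nonneg_fun (F k)" for F :: "nat \<Rightarrow> seq \<Rightarrow> complex" and x
  proof -
    have "0 < (\<Sum>k<m. Re (F k x))"
      using that m_pos by (intro sum_pos2[of _ 0]) (auto simp: nonneg_fun_def)
    then show ?thesis by (simp add: sum_fun_apply)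
  qed
  have "0 < Re (D (R0 e) ?y)"
  proof -
    have "W' x1 \<in> \<real>" "0 \<le> Re (W' x1)" using W'(2) by (auto simp: nonneg_fun_def)
    with x1 have "0 < Re (W' x1)" by (auto simp: complex_is_Real_iff complex_eq_iff less_le)
    then have "0 < Re (W' x1) * Re (R0 e x1)" using hpos[OF x1E] by simp
    then show ?thesis
      using nonneg_fun_ker_op(2)[OF W' hV hnn, of "x1 0" "shift x1"] unfolding D cons_seq_shift by linarith
  qed
  then have "0 < Re ((\<Sum>k<m. power_deriv Lc D (Suc k) (R0 e)) ?y)"
    by (intro sum_pos der) (simp add: ops_zero[OF Lc_ops])
  then have "0 < Re (?f ?y)"
    unfolding scale using m_pos by (simp add: cscale_fun_def cscale_complex_def)
  then have "?f ?y \<noteq> 0" by auto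
  then show "\<phi> (R0 ?f) \<noteq> 0"
    using fnn by (intro functional_nonzero[OF R0 fV]) (auto simp: nonneg_fun_def)
  have x0: "0 < Re ((\<Sum>k<m. \<Sum>j<Suc k. (Lc ^^ j) (R0 e)) x1)"
    using hpos[OF x1E] by (intro sum_pos nonneg_fun_sum pow) simp
  have "power_cofactor m Lc (R0 e) x1 = complex_of_real (1 / real m) * (\<Sum>k<m. \<Sum>j<Suc k. (Lc ^^ j) (R0 e)) x1"
    unfolding power_cofactor_def scale by (simp only: cscale_fun_def cscale_complex_def)
  moreover have "(\<Sum>k<m. \<Sum>j<Suc k. (Lc ^^ j) (R0 e)) x1 \<noteq> 0" using x0 by auto
  ultimately have "power_cofactor m Lc (R0 e) x1 \<noteq> 0" using m_pos by simp
  then show "power_cofactor m Lc (R0 e) \<noteq> 0" by auto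
qed

text \<open>
  On the disc of radius \<open>t + \<delta>\<close> the real part of \<open>z\<close> stays below \<open>t\<close>, where the potential is summable, so the transfer
  operators form a holomorphic family of kernel operators there. The weight of its derivative at \<open>z0\<close>
  is \<open>\<xi> * exp (\<eta> - \<delta> * \<xi>)\<close>, which is nonnegative and nonzero at \<open>x1\<close>.
\<close>

theorem (in shift_space) perturbed_resolvent_simple_pole:
  fixes \<delta> :: real and \<eta> \<xi> :: "seq \<Rightarrow> real"
  assumes irr: "finitely_irreducible I A"
    and F: "\<eta> \<in> F_theta I A \<theta>" "\<xi> \<in> F_theta I A \<theta>"
    and nn: "\<forall>\<omega>\<in>E. 0 \<le> \<xi> \<omega>"
    and P: "pressure I A (\<lambda>\<omega>. \<eta> \<omega> - \<delta> * \<xi> \<omega>) = 0"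
    and \<xi>: "x1 \<in> E" "\<xi> x1 \<noteq> 0"
    and t_star: "ereal (- \<delta>) < t_star I A \<eta> \<xi>"
  defines "z0 \<equiv> complex_of_real (- \<delta>)"
  shows "\<forall>\<^sub>F z in at z0. invertible_op V N (\<lambda>g. g - perturbed_op I A \<eta> \<xi> z g)"
    and "simple_pole_op V N (\<lambda>z. inv_into V (\<lambda>g. g - perturbed_op I A \<eta> \<xi> z g)) z0"
proof -
  obtain t where t: "- \<delta> < t" "summable_potential I A (\<lambda>\<omega>. \<eta> \<omega> + t * \<xi> \<omega>)"
    using t_star unfolding t_star_def less_Sup_iff by auto
  obtain M where M: "summable M" "\<And>i. 0 \<le> M i" "\<And>y. y \<in> E \<Longrightarrow> exp (\<eta> y + t * \<xi> y) \<le> M (y 0)"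
    using summable_potential_majorant[OF t(2)] by metis
  obtain b where b: "0 \<le> b" "lip \<eta> b" by (rule F_theta_lip[OF F(1)])
  obtain d where d: "0 \<le> d" "lip \<xi> d" by (rule F_theta_lip[OF F(2)])
  define \<rho> where "\<rho> = t + \<delta>"
  have \<rho>: "0 < \<rho>" using t(1) by (simp add: \<rho>_def)
  define W where "W z y = (if y \<in> E then exp (complex_of_real (\<eta> y) + z * complex_of_real (\<xi> y)) else 0)" for z y
  define M' where "M' i = (1 + 2 * (b + (cmod z0 + \<rho>) * d)) * M i" for i
  have W_kernel: "kernel (W z) M'" if z: "z \<in> ball z0 \<rho>" for z
    unfolding W_def[abs_def] M'_def[abs_def]
  proof (rule kernel_perturbed[OF b(2,1) d(2,1) _ M])
    have "cmod (z - z0) < \<rho>" using z by (simp add: dist_norm norm_minus_commute)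
    then have "Re (z - z0) \<le> \<rho>" "cmod z \<le> cmod z0 + \<rho>"
      using complex_Re_le_cmod[of "z - z0"] norm_triangle_sub[of z z0] by linarith+
    then show "Re z \<le> t" "cmod z \<le> cmod z0 + \<rho>" by (auto simp: z0_def \<rho>_def)
  qed (use nn in auto)
  have W_hol: "(\<lambda>z. W z y) holomorphic_on ball z0 \<rho>" if "y \<in> E" for y
    using that unfolding W_def by (auto intro!: holomorphic_intros)
  have op_eq: "perturbed_op I A \<eta> \<xi> z g = ker_op (W z) g" if "z \<in> ball z0 \<rho>" "g \<in> V" for z g
    unfolding perturbed_op_def W_def[abs_def]
    using W_kernel[OF that(1)] that(2) unfolding W_def[abs_def] by (rule transfer_op_eq_ker_op)
  define u where "u \<omega> = \<eta> \<omega> - \<delta> * \<xi> \<omega>" for \<omega>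
  define a where "a = b + \<bar>\<delta>\<bar> * d"
  have u_lip: "lip u a"
  proof (rule lipI)
    fix n :: nat and x y assume A: "1 \<le> n" "x \<in> E" "y \<in> E" "agree n x y"
    have "u x - u y = (\<eta> x - \<eta> y) - \<delta> * (\<xi> x - \<xi> y)" by (simp add: u_def algebra_simps)
    then have "\<bar>u x - u y\<bar> \<le> \<bar>\<eta> x - \<eta> y\<bar> + \<bar>\<delta> * (\<xi> x - \<xi> y)\<bar>" by linarith
    also have "\<dots> = \<bar>\<eta> x - \<eta> y\<bar> + \<bar>\<delta>\<bar> * \<bar>\<xi> x - \<xi> y\<bar>" by (simp only: abs_mult)
    also have "\<dots> \<le> b * \<theta> ^ n + \<bar>\<delta>\<bar> * (d * \<theta> ^ n)"
      using lipD[OF b(2) A] lipD[OF d(2) A] by (intro add_mono mult_left_mono) auto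
    finally show "norm (u x - u y) \<le> a * \<theta> ^ n" by (simp add: a_def algebra_simps)
  qed
  have W0: "W z0 y = complex_of_real (if y \<in> E then exp (u y) else 0)" for y
    unfolding W_def z0_def u_def by (simp add: exp_of_real[symmetric])
  have z0: "z0 \<in> ball z0 \<rho>" using \<rho> by simp
  have u_kernel: "kernel (\<lambda>y. if y \<in> E then exp (u y) else 0) M'"
  proof -
    let ?w = "\<lambda>y. if y \<in> E then exp (u y) else 0"
    have n: "norm (?w y) = norm (W z0 y)" for y unfolding W0 norm_of_real by simp
    have nd: "norm (?w x - ?w y) = norm (W z0 x - W z0 y)" for x y
      unfolding W0 of_real_diff[symmetric] norm_of_real by (simp only: real_norm_def)
    show ?thesis using W_kernel[OF z0] unfolding kernel_def n nd by (simp add: W0)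
  qed
  have sp: "shift_space I A \<theta>" by unfold_locales
  obtain \<Lambda> where \<Lambda>: "finite \<Lambda>" "\<And>\<omega>. \<omega> \<in> \<Lambda> \<Longrightarrow> set \<omega> \<subseteq> I"
    "\<And>i x. i \<in> I \<Longrightarrow> x \<in> E \<Longrightarrow> \<exists>\<omega>\<in>\<Lambda>. cons_seq i (prepend \<omega> x) \<in> E"
    using finitely_irreducible_connect[OF irr, of \<theta>] sp by metis
  interpret T: transfer_system I A \<theta> u a M' \<Lambda>
  proof
    show "0 \<le> a" using b d by (simp add: a_def)
  qed (use u_lip u_kernel \<Lambda> in auto)
  have "pressure I A u = 0" using P by (simp add: u_def[abs_def])
  then obtain C0 c0 where "normalized_system I A \<theta> u a M' \<Lambda> C0 c0"
    by (rule T.normalized_if_pressure_zero)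
  then interpret S: normalized_system I A \<theta> u a M' \<Lambda> C0 c0 .
  define D where "D z = ker_op (\<lambda>y. deriv (\<lambda>z. W z y) z)" for z
  have L_deriv: "has_op_deriv (\<lambda>z. ker_op (W z)) (D z) z" if "z \<in> ball z0 (\<rho> / 2)" for z
    unfolding D_def using that by (intro kernel_family_has_op_deriv(1)[OF W_kernel W_hol])
  have Lc: "S.Lc = ker_op (W z0)" unfolding S.Lc_def T.w_def[abs_def] W0[abs_def] ..
  obtain R0 where R0: "two_sided_inverse (\<lambda>f. f - power_average T.m S.Lc f + S.\<phi> f *\<^sub>C S.e) R0"
    and R0e: "R0 S.e = S.ofr S.h" and h: "T.bdd S.h"
    by (rule S.spectral_gap) blast
  define W' where "W' y = complex_of_real (if y \<in> E then \<xi> y * exp (u y) else 0)" for y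
  have W'_eq: "deriv (\<lambda>z. W z y) z0 = W' y" for y
  proof (cases "y \<in> E")
    case True
    have "((\<lambda>z. exp (complex_of_real (\<eta> y) + z * complex_of_real (\<xi> y))) has_field_derivative
      exp (complex_of_real (\<eta> y) + z0 * complex_of_real (\<xi> y)) * complex_of_real (\<xi> y)) (at z0)"
      by (auto intro!: derivative_eq_intros)
    then have "deriv (\<lambda>z. W z y) z0 = W z0 y * complex_of_real (\<xi> y)"
      using True unfolding W_def by (simp add: DERIV_imp_deriv)
    then show ?thesis using True by (simp add: W0 W'_def)
  qed (simp add: W_def W'_def)
  have D0: "D z0 = ker_op W'" unfolding D_def W'_eq ..
  have z0': "z0 \<in> ball z0 (\<rho> / 2)" using \<rho> by simp
  have W'_kernel: "\<exists>M''. kernel W' M''"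
    using kernel_family_has_op_deriv(2)[OF W_kernel W_hol z0'] unfolding W'_eq by blast
  then obtain M'' where W'_kernel: "kernel W' M''" by blast
  have W'_nn: "nonneg_fun W'" using nn by (simp add: nonneg_fun_def W'_def)
  have W'_x1: "W' x1 \<noteq> 0" using \<xi> by (simp add: W'_def)
  note cond = S.transversality_and_nonvanishing[OF R0 R0e D0 W'_kernel W'_nn W'_x1]
  have half: "0 < \<rho> / 2" using \<rho> by simp
  note R0' = R0[unfolded Lc] and cond' = cond[unfolded Lc]
  note pole = simple_pole_of_resolvent[where L="\<lambda>z. ker_op (W z)" and D=D and ?z0.0=z0 and m=T.m
      and \<phi>=S.\<phi> and e=S.e and ?R0.0=R0 and r="\<rho> / 2", OF half L_deriv T.m_pos S.\<phi>_dual S.e_in_V R0' S.\<phi>_h[OF R0 R0e h] cond']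
  have near: "\<forall>\<^sub>F z in at z0. z \<in> ball z0 \<rho>"
    by (rule eventually_at_in_open'[OF open_ball z0])
  show inv: "\<forall>\<^sub>F z in at z0. invertible_op V N (\<lambda>g. g - perturbed_op I A \<eta> \<xi> z g)"
    using eventually_conj[OF pole(1) near]
    by (rule eventually_mono) (auto intro: invertible_op_cong simp: op_eq)
  from pole(2) obtain s G where s: "0 < s"
    and G: "holomorphic_into ops (map_norm V N N) G (ball z0 s)" "\<exists>f\<in>V. G z0 f \<noteq> 0"
    and R: "\<And>z. z \<in> ball z0 s - {z0} \<Longrightarrow> inv_into V (\<lambda>f. f - ker_op (W z) f) \<in> ops"
      "\<And>z f. z \<in> ball z0 s - {z0} \<Longrightarrow> f \<in> V \<Longrightarrow> (z - z0) *\<^sub>C inv_into V (\<lambda>f. f - ker_op (W z) f) f = G z f"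
    unfolding simple_pole_op_def by blast
  have inv_eq: "inv_into V (\<lambda>g. g - perturbed_op I A \<eta> \<xi> z g) = inv_into V (\<lambda>f. f - ker_op (W z) f)"
    if "z \<in> ball z0 \<rho>" for z
    unfolding inv_into_def using op_eq[OF that] by (intro ext arg_cong[where f=Eps]) auto
  show "simple_pole_op V N (\<lambda>z. inv_into V (\<lambda>g. g - perturbed_op I A \<eta> \<xi> z g)) z0"
    unfolding simple_pole_op_def
  proof (intro exI[of _ "min s \<rho>"] exI[of _ G] conjI ballI)
    show "holomorphic_into ops (map_norm V N N) G (ball z0 (min s \<rho>))"
      using G(1) unfolding holomorphic_into_def by auto
  qed (use s \<rho> G(2) R inv_eq in auto)
qed

theorem proposition2p16:
  fixes I :: "nat set" and A :: "nat \<Rightarrow> nat \<Rightarrow> bool" and \<theta> \<delta> :: real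
    and \<eta> \<xi> :: "(nat \<Rightarrow> nat) \<Rightarrow> real"
  assumes "finitely_irreducible I A"
    and "0 < \<theta>" and "\<theta> < 1"
    and "\<eta> \<in> F_theta I A \<theta>" and "\<xi> \<in> F_theta I A \<theta>"
    and "\<forall>\<omega>\<in>E_inf I A. 0 \<le> \<xi> \<omega>"
    and "pressure I A (\<lambda>\<omega>. \<eta> \<omega> - \<delta> * \<xi> \<omega>) = 0"
    and "\<forall>\<delta>'. pressure I A (\<lambda>\<omega>. \<eta> \<omega> - \<delta>' * \<xi> \<omega>) = 0 \<longrightarrow> \<delta>' = \<delta>"
    and "ereal (- \<delta>) < t_star I A \<eta> \<xi>"
  shows "let V = Fb_theta I A \<theta>; N = Fb_norm I A \<theta>;
             IdL = (\<lambda>z g. g - perturbed_op I A \<eta> \<xi> z g);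
             z0 = complex_of_real (- \<delta>)
         in (\<forall>\<^sub>F z in at z0. invertible_op V N (IdL z)) \<and>
            simple_pole_op V N (\<lambda>z. inv_into V (IdL z)) z0 \<and>
            (\<forall>U \<gamma> h \<nu>. eigendata_extension I A \<theta> \<eta> \<xi> U \<gamma> h \<nu> \<longrightarrow>
               (\<forall>\<^sub>F z in at z0.
                  z \<in> U \<and> \<gamma> z \<noteq> 1 \<and> invertible_op V N (IdL z) \<and>
                  invertible_op V N (\<lambda>g. g - remainder_op I A \<eta> \<xi> \<gamma> h \<nu> z g) \<and>
                  (\<forall>\<phi>\<in>V. inv_into V (IdL z) \<phi>
                     = (\<gamma> z / (1 - \<gamma> z) * \<nu> z \<phi>) *\<^sub>C h z
                       + inv_into V (\<lambda>g. g - remainder_op I A \<eta> \<xi> \<gamma> h \<nu> z g) \<phi>)))"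
proof -
  have nonempty: "E_inf I A \<noteq> {}" using pressure_empty assms(7) by blast
  interpret shift_space I A \<theta> using assms(2,3) nonempty by unfold_locales
  have "\<exists>x\<in>E. \<xi> x \<noteq> 0"
  proof (rule ccontr)
    assume "\<not> (\<exists>x\<in>E. \<xi> x \<noteq> 0)"
    then have "pressure I A (\<lambda>\<omega>. \<eta> \<omega> - (\<delta> + 1) * \<xi> \<omega>) = pressure I A (\<lambda>\<omega>. \<eta> \<omega> - \<delta> * \<xi> \<omega>)"
      by (intro pressure_cong) simp
    \<comment> \<open>Then every real number would be a zero of the pressure.\<close>
    then have "\<delta> + 1 = \<delta>" using assms(7,8) by metis
    then show False by simp
  qed
  then obtain x1 where x1: "x1 \<in> E" "\<xi> x1 \<noteq> 0" by blast
  let ?z0 = "complex_of_real (- \<delta>)"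
  let ?IdL = "\<lambda>z g. g - perturbed_op I A \<eta> \<xi> z g"
  note pole = perturbed_resolvent_simple_pole[OF assms(1,4,5,6,7) x1 assms(9)]
  have split: "\<forall>\<^sub>F z in at ?z0. z \<in> U \<and> \<gamma> z \<noteq> 1 \<and> invertible_op V N (?IdL z) \<and>
       invertible_op V N (\<lambda>g. g - remainder_op I A \<eta> \<xi> \<gamma> h \<nu> z g) \<and>
       (\<forall>\<phi>\<in>V. inv_into V (?IdL z) \<phi> = (\<gamma> z / (1 - \<gamma> z) * \<nu> z \<phi>) *\<^sub>C h z
          + inv_into V (\<lambda>g. g - remainder_op I A \<eta> \<xi> \<gamma> h \<nu> z g) \<phi>)"
    if ext: "eigendata_extension I A \<theta> \<eta> \<xi> U \<gamma> h \<nu>" for U \<gamma> h \<nu>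
  proof -
    have U: "open U" "?z0 \<in> U"
      and h: "holomorphic_into V N h U" and \<nu>: "holomorphic_into (dual_space V N) (map_norm V N cmod) \<nu> U"
      and eig: "\<And>z. z \<in> U \<Longrightarrow> perturbed_op I A \<eta> \<xi> z (h z) = \<gamma> z *\<^sub>C h z \<and>
        (\<forall>g\<in>V. \<nu> z (perturbed_op I A \<eta> \<xi> z g) = \<gamma> z * \<nu> z g) \<and> \<nu> z (h z) = 1"
      using ext assms(9) unfolding eigendata_extension_def by blast+
    have "\<forall>\<^sub>F z in at ?z0. z \<in> U" by (rule eventually_at_in_open'[OF U])
    with pole(1) show ?thesis
    proof eventually_elim
      case (elim z)
      let ?T = "perturbed_op I A \<eta> \<xi> z"
      have R: "two_sided_inverse (?IdL z) (inv_into V (?IdL z))"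
        using elim(1) by (rule invertible_op_imp_two_sided_inverse)
      have T: "?T \<in> ops" using diff_in_ops[OF id_in_ops two_sided_inverseD(1)[OF R]] by simp
      have hz: "h z \<in> V" and \<nu>z: "\<nu> z \<in> dual_space V N"
        using h \<nu> elim(2) unfolding holomorphic_into_def by blast+
      have eigz: "?T (h z) = \<gamma> z *\<^sub>C h z" "\<And>g. g \<in> V \<Longrightarrow> \<nu> z (?T g) = \<gamma> z * \<nu> z g" "\<nu> z (h z) = 1"
        using eig[OF elim(2)] by auto
      note sp = resolvent_split[OF T R \<nu>z hz eigz]
      have rem: "(\<lambda>g. g - remainder_op I A \<eta> \<xi> \<gamma> h \<nu> z g) = (\<lambda>f. f - (?T f - (\<gamma> z * \<nu> z f) *\<^sub>C h z))"
        by (simp add: remainder_op_def principal_op_def)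
      note inv = two_sided_inverse_imp_invertible[OF sp(2), folded rem]
      show ?case using elim sp(1) inv by (auto simp: algebra_simps)
    qed
  qed
  show ?thesis unfolding Let_def using pole split by blast
qed

end
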